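(* Let $s\geqslant 1$ be an integer and let $G$ be a finite simple $2$-connected graph with at least $4s$ vertices. Suppose that either $\delta_2(G)\geqslant 4s$ or $G$ is a complete graph. Then $G$ contains $s$ pairwise vertex-disjoint chorded cycles.
   Context: For a vertex set $S\subseteq V(G)$, $N_G(S)$ denotes the set of vertices of $G$ adjacent to at least one vertex of $S$. $\delta_2(G)=\min\{|N_G(S)| : S \text{ an independent set of } G \text{ with } |S|=2\}$, i.e. the minimum of $|N_G(u)\cup N_G(v)|$ over pairs of distinct nonadjacent vertices $u,v$. A chord of a cycle $C$ in $G$ is an edge of $G$ not in $E(C)$ whose two ends both lie on $C$; a chorded cycle is a cycle having at least one chord. *)

theory Defs
  imports Main
begin

definition simple_graph :: "'a set \<Rightarrow> ('a \<Rightarrow> 'a \<Rightarrow> bool) \<Rightarrow> bool" where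
  "simple_graph V E \<longleftrightarrow> finite V \<and> (\<forall>u v. E u v \<longrightarrow> u \<in> V \<and> v \<in> V) \<and>
     (\<forall>u v. E u v \<longrightarrow> E v u) \<and> (\<forall>v. \<not> E v v)"

definition connected_on :: "'a set \<Rightarrow> ('a \<Rightarrow> 'a \<Rightarrow> bool) \<Rightarrow> bool" where
  "connected_on W E \<longleftrightarrow>
     (\<forall>u\<in>W. \<forall>v\<in>W. (\<lambda>x y. x \<in> W \<and> y \<in> W \<and> E x y)\<^sup>*\<^sup>* u v)"

definition two_connected :: "'a set \<Rightarrow> ('a \<Rightarrow> 'a \<Rightarrow> bool) \<Rightarrow> bool" where
  "two_connected V E \<longleftrightarrow> card V \<ge> 3 \<and> connected_on V E \<and>
     (\<forall>x\<in>V. connected_on (V - {x}) E)"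

definition complete_graph :: "'a set \<Rightarrow> ('a \<Rightarrow> 'a \<Rightarrow> bool) \<Rightarrow> bool" where
  "complete_graph V E \<longleftrightarrow> (\<forall>u\<in>V. \<forall>v\<in>V. u \<noteq> v \<longrightarrow> E u v)"

definition nbhd_set :: "'a set \<Rightarrow> ('a \<Rightarrow> 'a \<Rightarrow> bool) \<Rightarrow> 'a set \<Rightarrow> 'a set" where
  "nbhd_set V E S = {v \<in> V. \<exists>u\<in>S. E u v}"

definition independent_set :: "'a set \<Rightarrow> ('a \<Rightarrow> 'a \<Rightarrow> bool) \<Rightarrow> 'a set \<Rightarrow> bool" where
  "independent_set V E S \<longleftrightarrow> S \<subseteq> V \<and> (\<forall>u\<in>S. \<forall>v\<in>S. \<not> E u v)"

text \<open>delta_2(G) = min |N_G(S)| over independent S with |S| = 2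
  (Inf of the empty set of naturals is 0; only relevant for complete graphs).\<close>
definition delta2 :: "'a set \<Rightarrow> ('a \<Rightarrow> 'a \<Rightarrow> bool) \<Rightarrow> nat" where
  "delta2 V E = Inf {card (nbhd_set V E S) | S. independent_set V E S \<and> card S = 2}"

definition is_cycle :: "'a set \<Rightarrow> ('a \<Rightarrow> 'a \<Rightarrow> bool) \<Rightarrow> 'a list \<Rightarrow> bool" where
  "is_cycle V E C \<longleftrightarrow> length C \<ge> 3 \<and> distinct C \<and> set C \<subseteq> V \<and>
     (\<forall>i < length C. E (C ! i) (C ! ((i + 1) mod length C)))"

definition cycle_edges :: "'a list \<Rightarrow> 'a set set" where
  "cycle_edges C = {{C ! i, C ! ((i + 1) mod length C)} | i. i < length C}"

definition is_chord :: "('a \<Rightarrow> 'a \<Rightarrow> bool) \<Rightarrow> 'a list \<Rightarrow> 'a \<Rightarrow> 'a \<Rightarrow> bool" where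
  "is_chord E C u v \<longleftrightarrow> E u v \<and> u \<in> set C \<and> v \<in> set C \<and> {u, v} \<notin> cycle_edges C"

definition chorded_cycle :: "'a set \<Rightarrow> ('a \<Rightarrow> 'a \<Rightarrow> bool) \<Rightarrow> 'a list \<Rightarrow> bool" where
  "chorded_cycle V E C \<longleftrightarrow> is_cycle V E C \<and> (\<exists>u v. is_chord E C u v)"

end

theory Submission
  imports Defs
begin

text \<open>Only the hypothesis that any two nonadjacent vertices have at least \<open>4 * s\<close> neighbours in
  total is inherited by subgraphs, so the induction on \<open>s \<ge> 2\<close> proves, without connectivity, that
  \<open>s\<close> disjoint chorded cycles exist unless the graph has \<open>4 * s + 2\<close> vertices and is not 2-connected.
  If the shortest chorded cycle \<open>C\<close> has at most five vertices, two vertices outside \<open>C\<close> have at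
  most four neighbours on it, so \<open>C\<close> can be removed. If the remainder is exceptional, it consists of
  two cliques whose cross edges all meet one vertex. The whole graph then also splits into two cliques,
  and 2-connectivity gives two disjoint cross edges, which close one more chorded cycle.

  If every chorded cycle has at least six vertices, take \<open>s - 1\<close> disjoint ones with fewest vertices
  and, subject to that, most edges in the rest \<open>H\<close>. A graph without chorded cycles has vertices of
  degree at most two, and counting the neighbours of two such vertices of \<open>H\<close> leaves a hexagon
  whose colour classes are joined to one of them each. Opposite pairs on a 4-cycle now have
  disjoint neighbourhoods, and the \<open>8 * s\<close> neighbours of both pairs exceed what the extremal choice
  of the cycles allows.\<close>

section \<open>Chorded cycles as vertex sets\<close>

text \<open>The exception is real. Disjoint cliques on \<open>4 * a + 3\<close> and
  \<open>4 * b + 3\<close> vertices have \<open>4 * s + 2\<close> vertices for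
  \<open>s = a + b + 1\<close>, and a pair across them has exactly \<open>4 * s\<close> neighbours.
  But each clique leaves three vertices over, so only \<open>s - 1\<close> disjoint chorded cycles
  exist. The induction cannot start at \<open>s = 1\<close>: disjoint triangles, however many,
  satisfy the condition with four neighbours and contain no chorded cycle, so exceptions occur in
  unbounded size. Hence \<open>s = 2\<close> is the base case, and \<open>s = 1\<close> is settled
  separately by 2-connectivity.

  The count over a pair in \<open>H\<close> needs a pair with at most three neighbours in
  \<open>H\<close>. If there is none, \<open>H\<close> contains two disjoint triangles, each
  attached to the rest through at most one vertex. The four pairs formed by their free vertices then
  have, added up, at most 15 neighbours on each cycle, while the condition asks for an average of
  16.\<close>

locale sgraph =
  fixes E :: "'a \<Rightarrow> 'a \<Rightarrow> bool"
  assumes sym: "E x y \<Longrightarrow> E y x"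
    and irrefl: "\<not> E x x"
begin

text \<open>Neighbourhoods are taken in the whole relation. Subgraphs are always induced, so the
  degree of \<open>x\<close> in the graph on \<open>W\<close> is
  \<open>card (nb x \<inter> W)\<close>, and passing to a subgraph changes only
  \<open>W\<close>.\<close>

definition nb :: "'a \<Rightarrow> 'a set" where
  "nb x = {y. E x y}"

text \<open>Disjointness and size depend on vertices only, so a chorded cycle is represented by the
  set it spans: the graph induced on \<open>S\<close> has a Hamiltonian cycle with a chord.\<close>

definition ccset :: "'a set \<Rightarrow> bool" where
  "ccset S \<longleftrightarrow> (\<exists>C. chorded_cycle S E C \<and> set C = S)"

definition ccfree :: "'a set \<Rightarrow> bool" where
  "ccfree W \<longleftrightarrow> (\<forall>S. ccset S \<longrightarrow> \<not> S \<subseteq> W)"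

lemma in_nb [simp]: "y \<in> nb x \<longleftrightarrow> E x y"
  by (simp add: nb_def)

text \<open>A chorded cycle seen from one end \<open>w\<close> of its chord: the path
  \<open>xs\<close> is closed through \<open>w\<close>, and the edge from \<open>w\<close> to an
  inner vertex of \<open>xs\<close> is the chord. Every chorded cycle constructed below is exhibited
  in this form.\<close>

definition fan :: "'a \<Rightarrow> 'a list \<Rightarrow> bool" where
  "fan w xs \<longleftrightarrow> successively E xs \<and> distinct (w # xs) \<and> E w (hd xs) \<and> E w (last xs) \<and>
     (\<exists>m\<in>set xs. m \<noteq> hd xs \<and> m \<noteq> last xs \<and> E w m)"

lemma fan_ccset:
  assumes "fan w xs"
  shows "ccset (insert w (set xs))"
proof -
  obtain m where m: "m \<in> set xs" "m \<noteq> hd xs" "m \<noteq> last xs" "E w m"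
    using assms by (auto simp: fan_def)
  have succ: "successively E xs" and dist: "distinct (w # xs)" and hl: "E w (hd xs)" "E w (last xs)"
    using assms by (auto simp: fan_def)
  have len: "length xs \<ge> 2"
    using m by (cases xs; cases "tl xs") auto
  have ne: "xs \<noteq> []" using m by auto
  let ?C = "w # xs"
  have L: "length ?C = Suc (length xs)" by simp
  have hd0: "?C ! Suc 0 = hd xs" using ne by (simp add: hd_conv_nth)
  have lastL: "?C ! length xs = last xs" using ne len by (cases "length xs") (auto simp: last_conv_nth)
  have succC: "successively E ?C"
    using succ hl ne by (cases xs) auto
  have cyc: "is_cycle (insert w (set xs)) E ?C"
    unfolding is_cycle_def
  proof (intro conjI allI impI)
    show "3 \<le> length ?C" using len by simp
    show "distinct ?C" by (rule dist)
    show "set ?C \<subseteq> insert w (set xs)" by simp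
    fix i assume i: "i < length ?C"
    show "E (?C ! i) (?C ! ((i + 1) mod length ?C))"
    proof (cases "i = length xs")
      case True
      then have "(i + 1) mod length ?C = 0" by simp
      then show ?thesis using True lastL hl sym by simp
    next
      case False
      then have "Suc i < length ?C" using i by simp
      then show ?thesis using successively_nth[OF succC] by simp
    qed
  qed
  have "{w, m} \<notin> cycle_edges ?C"
  proof
    assume "{w, m} \<in> cycle_edges ?C"
    then obtain i where i: "i < length ?C" and e: "{w, m} = {?C ! i, ?C ! ((i + 1) mod length ?C)}"
      unfolding cycle_edges_def by blast
    \<comment> \<open>\<open>w\<close> occurs at index 0 only, so the cycle edges at
      \<open>w\<close> lead to the two ends of \<open>xs\<close>, and \<open>m\<close> is
      neither.\<close>
    have w0: "?C ! j = w \<longleftrightarrow> j = 0" if "j < length ?C" for j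
      using nth_eq_iff_index_eq[OF dist, of j 0] that by simp
    have jlt: "(i + 1) mod length ?C < length ?C" by simp
    from e have "(?C ! i = w \<and> ?C ! ((i + 1) mod length ?C) = m) \<or> (?C ! i = m \<and> ?C ! ((i + 1) mod length ?C) = w)"
      by (auto simp: doubleton_eq_iff)
    then show False
    proof
      assume a: "?C ! i = w \<and> ?C ! ((i + 1) mod length ?C) = m"
      then have "i = 0" using w0[OF i] by simp
      then have "?C ! ((i + 1) mod length ?C) = hd xs" using hd0 ne by (simp add: hd_conv_nth)
      then show False using a m by simp
    next
      assume a: "?C ! i = m \<and> ?C ! ((i + 1) mod length ?C) = w"
      then have "(i + 1) mod length ?C = 0" using w0[OF jlt] by simp
      then have "i = length xs" using i by (simp add: mod_eq_0_iff_dvd dvd_imp_le)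
          (metis Suc_leI dvd_imp_le le_antisym Suc_inject less_Suc_eq_le nat_dvd_not_less zero_less_Suc not_less_eq i L)
      then show False using a lastL m by simp
    qed
  qed
  then have "is_chord E ?C w m" unfolding is_chord_def using m by simp
  then show ?thesis unfolding ccset_def chorded_cycle_def using cyc
    by (intro exI[of _ ?C]) auto
qed

lemma fan_ccset': "fan w xs \<Longrightarrow> S = insert w (set xs) \<Longrightarrow> ccset S"
  using fan_ccset by simp

lemma is_cycle_mono: "is_cycle S E C \<Longrightarrow> S \<subseteq> V \<Longrightarrow> is_cycle V E C"
  by (auto simp: is_cycle_def)

lemma ccset_finite: "ccset S \<Longrightarrow> finite S"
  by (auto simp: ccset_def)

lemma ccset_card_ge4:
  assumes "ccset S"
  shows "card S \<ge> 4"
proof -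
  obtain C where C: "chorded_cycle S E C" "set C = S" using assms by (auto simp: ccset_def)
  obtain u v where uv: "E u v" "u \<in> set C" "v \<in> set C" "{u, v} \<notin> cycle_edges C"
    using C by (auto simp: chorded_cycle_def is_chord_def)
  have d: "distinct C" and L: "length C \<ge> 3" using C by (auto simp: chorded_cycle_def is_cycle_def)
  have "length C \<noteq> 3"
  proof
    assume l3: "length C = 3"
    then obtain a b c where abc: "C = [a, b, c]"
      by (metis (no_types, lifting) length_0_conv length_Suc_conv numeral_3_eq_3)
    have "{a, b} \<in> cycle_edges C" "{b, c} \<in> cycle_edges C" "{c, a} \<in> cycle_edges C"
      unfolding cycle_edges_def abc
      by (rule CollectI, rule exI[of _ 0], simp)
        (rule CollectI, rule exI[of _ 1], simp, rule CollectI, rule exI[of _ 2], simp)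
    then show False using uv irrefl by (auto simp: abc insert_commute)
  qed
  then show ?thesis using L d distinct_card[OF d] C by simp
qed

text \<open>The cycle is \<open>p w q r\<close> with chord \<open>p q\<close>. Four vertices are the
  least possible number, which makes this the standard contradiction to a lower bound on the size of
  chorded cycles.\<close>

lemma diamond:
  assumes "E p q" "E w p" "E w q" "E r p" "E r q" "w \<noteq> r"
  shows "ccset {w, p, q, r}"
proof (rule fan_ccset')
  have "p \<noteq> q" "w \<noteq> p" "w \<noteq> q" "r \<noteq> p" "r \<noteq> q" using assms irrefl by auto
  then show "fan p [w, q, r]" using assms sym by (auto simp: fan_def)
qed auto

lemma cycle_list:
  assumes "is_cycle S E C"
  shows "successively E C" "E (last C) (hd C)" "distinct C" "length C \<ge> 3"
proof -
  show d: "distinct C" and L: "length C \<ge> 3" using assms by (auto simp: is_cycle_def)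
  have e: "E (C ! i) (C ! ((i + 1) mod length C))" if "i < length C" for i
    using assms that by (auto simp: is_cycle_def)
  show "successively E C" unfolding successively_conv_nth
    using e by (metis Suc_eq_plus1 Suc_lessD mod_less)
  have "length C - 1 + 1 = length C" "length C - 1 < length C" using L by auto
  then have "E (C ! (length C - 1)) (C ! 0)" using e[of "length C - 1"] by (metis mod_self)
  then show "E (last C) (hd C)" using L by (cases C) (auto simp: last_conv_nth)
qed

text \<open>Together with \<open>arc_outer\<close>, which wraps around the end of the list, this
  describes the two arcs between two vertices of a cycle. Their vertex counts drive all later
  distance estimates.\<close>

lemma arc_inner:
  assumes "successively E C" "distinct C" "i \<le> k" "k < length C"
  defines "xs \<equiv> drop i (take (Suc k) C)"
  shows "successively E xs" "distinct xs" "hd xs = C ! i" "last xs = C ! k"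
    "set xs = (!) C ` {i..k}" "set xs \<subseteq> set C" "card (set xs) = k - i + 1"
proof -
  have len: "length xs = Suc k - i" using assms by simp
  have n: "xs ! j = C ! (i + j)" if "j < Suc k - i" for j using that assms by simp
  show "successively E xs" unfolding successively_conv_nth
  proof (intro allI impI)
    fix j assume j: "Suc j < length xs"
    then have "Suc (i + j) < length C" using len assms by simp
    then show "E (xs ! j) (xs ! Suc j)" using successively_nth[OF assms(1)] n len j by simp
  qed
  show d: "distinct xs" using assms by simp
  have ne: "xs \<noteq> []" using len assms by auto
  show "hd xs = C ! i" using ne n[of 0] assms(3) by (simp add: hd_conv_nth)
  show "last xs = C ! k" using ne n[of "k - i"] len assms(3) by (simp add: last_conv_nth Suc_diff_le)
  show "set xs = (!) C ` {i..k}"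
  proof -
    have "set xs = (!) xs ` {0..<length xs}" by (simp add: set_conv_nth image_def atLeast0LessThan) blast
    also have "\<dots> = (\<lambda>j. C ! (i + j)) ` {0..<Suc k - i}" using n len by (intro image_cong) auto
    also have "\<dots> = (!) C ` ((+) i ` {0..<Suc k - i})" by (rule image_image[symmetric])
    also have "(+) i ` {0..<Suc k - i} = {i..k}"
    proof -
      have "i + 0 = i" "Suc k - i + i = Suc k" using assms(3) by auto
      then show ?thesis unfolding image_add_atLeastLessThan
        by (simp add: atLeastLessThanSuc_atLeastAtMost add.commute[of i])
    qed
    finally show ?thesis .
  qed
  show "set xs \<subseteq> set C" unfolding xs_def by (auto dest: in_set_dropD in_set_takeD)
  show "card (set xs) = k - i + 1" using distinct_card[OF d] len assms(3) by simp
qed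

lemma arc_outer:
  assumes "successively E C" "E (last C) (hd C)" "distinct C" "i < k" "k < length C"
  defines "xs \<equiv> drop k C @ take (Suc i) C"
  shows "successively E xs" "distinct xs" "hd xs = C ! k" "last xs = C ! i"
    "set xs = (!) C ` ({..i} \<union> {k..<length C})" "set xs \<subseteq> set C" "card (set xs) = length C - k + i + 1"
proof -
  have A: "successively E (take (Suc i) C)" "last (take (Suc i) C) = C ! i" "set (take (Suc i) C) = (!) C ` {..i}"
    using arc_inner[OF assms(1,3), of 0 i] assms by (auto simp: atLeast0AtMost)
  have tk: "take (Suc (length C - 1)) C = C" by simp
  have B: "successively E (drop k C)" "hd (drop k C) = C ! k" "set (drop k C) = (!) C ` {k..<length C}"
    using arc_inner[OF assms(1,3), of k "length C - 1"] assms(5) tk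
    by (auto simp: atLeastLessThanSuc_atLeastAtMost[symmetric])
  have ne: "C \<noteq> []" "drop k C \<noteq> []" using assms by auto
  show "successively E xs" unfolding xs_def successively_append_iff
    using A B ne assms(2) by (simp add: hd_take last_drop assms(5))
  show "hd xs = C ! k" using B ne xs_def by simp
  show "last xs = C ! i" using A ne xs_def by simp
  show s: "set xs = (!) C ` ({..i} \<union> {k..<length C})" using A B xs_def by auto
  show "set xs \<subseteq> set C" unfolding xs_def by (auto dest: in_set_dropD in_set_takeD)
  show d: "distinct xs"
    unfolding xs_def distinct_append
    using assms(3-5) set_take_disj_set_drop_if_distinct[OF assms(3), of "Suc i" k] by auto
  show "card (set xs) = length C - k + i + 1" using distinct_card[OF d] assms(4,5) by (simp add: xs_def)
qed

text \<open>For any two of the three neighbours, \<open>w\<close> closes the arc between them that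
  contains the third, and the edge to the third is the chord. The three sizes add up to
  \<open>2 * length C + 6\<close>.\<close>

lemma three_neighbours:
  assumes cyc: "is_cycle S E C" and w: "w \<notin> set C"
    and ijk: "i < j" "j < k" "k < length C" and e: "E w (C ! i)" "E w (C ! j)" "E w (C ! k)"
  shows "\<exists>T \<subseteq> insert w (set C). ccset T \<and> card T = k - i + 2"
    "\<exists>T \<subseteq> insert w (set C). ccset T \<and> card T = length C - j + i + 2"
    "\<exists>T \<subseteq> insert w (set C). ccset T \<and> card T = length C - k + j + 2"
proof -
  note c = cycle_list[OF cyc]
  have neq: "C ! a \<noteq> C ! b" if "a \<noteq> b" "a < length C" "b < length C" for a b
    using that c(3) by (simp add: nth_eq_iff_index_eq)
  have main: "\<exists>T \<subseteq> insert w (set C). ccset T \<and> card T = n + 1"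
    if xs: "successively E xs" "distinct xs" "set xs \<subseteq> set C" "card (set xs) = n"
      and f: "E w (hd xs)" "E w (last xs)" and m: "m \<in> set xs" "m \<noteq> hd xs" "m \<noteq> last xs" "E w m"
    for xs n m
  proof -
    have "w \<notin> set xs" using w xs by auto
    then have "fan w xs" unfolding fan_def using xs f m by auto
    from fan_ccset[OF this] show ?thesis using xs \<open>w \<notin> set xs\<close>
      by (intro exI[of _ "insert w (set xs)"]) auto
  qed
  note I = arc_inner[OF c(1,3), of i k]
  show "\<exists>T \<subseteq> insert w (set C). ccset T \<and> card T = k - i + 2"
    using main[OF I(1,2,6,7), of "C ! j"] I(3-5) ijk e neq by auto
  note O = arc_outer[OF c(1,2,3), of i j]
  have "C ! k \<in> set (drop j C @ take (Suc i) C)" using O(5) ijk by auto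
  then show "\<exists>T \<subseteq> insert w (set C). ccset T \<and> card T = length C - j + i + 2"
    using main[OF O(1,2,6,7), of "C ! k"] O(3,4) ijk e neq by auto
  note O = arc_outer[OF c(1,2,3), of j k]
  have "C ! i \<in> set (drop k C @ take (Suc j) C)" using O(5) ijk by auto
  then show "\<exists>T \<subseteq> insert w (set C). ccset T \<and> card T = length C - k + j + 2"
    using main[OF O(1,2,6,7), of "C ! i"] O(3,4) ijk e neq by auto
qed

section \<open>Neighbours of outside vertices on a shortest chorded cycle\<close>

lemma three_elements_nat:
  fixes I :: "nat set"
  assumes "finite I" "card I \<ge> 3"
  obtains i j k where "i \<in> I" "j \<in> I" "k \<in> I" "i < j" "j < k"
proof -
  have ne: "I \<noteq> {}" using assms by auto
  have "\<not> I \<subseteq> {Min I, Max I}"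
  proof
    assume "I \<subseteq> {Min I, Max I}"
    then have "card I \<le> card {Min I, Max I}" by (intro card_mono) auto
    also have "\<dots> \<le> 2" by (simp add: card_insert_if)
    finally show False using assms by simp
  qed
  then obtain j where j: "j \<in> I" "j \<noteq> Min I" "j \<noteq> Max I" by auto
  have "Min I \<le> j" "j \<le> Max I" using j assms(1) by auto
  then have "Min I < j" "j < Max I" using j by auto
  then show ?thesis using that[of "Min I" j "Max I"] j assms ne by auto
qed

lemma nb_image_index:
  fixes C :: "'a list" and w :: 'a
  assumes "distinct C"
  defines "I \<equiv> {i. i < length C \<and> E w (C ! i)}"
  shows "nb w \<inter> set C = (!) C ` I" "card (nb w \<inter> set C) = card I" "finite I"
proof -
  show 1: "nb w \<inter> set C = (!) C ` I" by (auto simp: I_def in_set_conv_nth)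
  have "inj_on ((!) C) I" using assms by (intro inj_on_nth) (auto simp: I_def)
  then show "card (nb w \<inter> set C) = card I" using 1 by (simp add: card_image)
  show "finite I" by (simp add: I_def)
qed

text \<open>Each of the three cycles from \<open>three_neighbours\<close> has at least
  \<open>length C\<close> vertices, so \<open>3 * length C\<close> is at most
  \<open>2 * length C + 6\<close>. This is the origin of the threshold six: at six vertices all
  estimates are equalities, and the neighbours are two steps apart.\<close>

lemma outside_neighbours:
  assumes cyc: "is_cycle S E C" and L: "length C \<ge> 6" and w: "w \<notin> set C"
    and mn: "\<And>T. T \<subseteq> insert w (set C) \<Longrightarrow> ccset T \<Longrightarrow> length C \<le> card T"
    and three: "card (nb w \<inter> set C) \<ge> 3"
  shows "length C = 6" "nb w \<inter> set C = {C!0, C!2, C!4} \<or> nb w \<inter> set C = {C!1, C!3, C!5}"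
proof -
  define I where "I = {i. i < length C \<and> E w (C ! i)}"
  note idx = nb_image_index[OF cycle_list(3)[OF cyc], of w, folded I_def]
  have trip: "length C = 6 \<and> j = i + 2 \<and> k = i + 4 \<and> i < 2"
    if "i \<in> I" "j \<in> I" "k \<in> I" "i < j" "j < k" for i j k
  proof -
    have k: "k < length C" and e: "E w (C!i)" "E w (C!j)" "E w (C!k)" using that I_def by auto
    note t = three_neighbours[OF cyc w that(4,5) k e]
    have "length C \<le> k - i + 2" using t(1) mn by metis
    moreover have "length C \<le> length C - j + i + 2" using t(2) mn by metis
    moreover have "length C \<le> length C - k + j + 2" using t(3) mn by metis
    ultimately show ?thesis using that(4,5) k L by linarith
  qed
  obtain i j k where ijk: "i \<in> I" "j \<in> I" "k \<in> I" "i < j" "j < k"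
    using three_elements_nat[OF idx(3)] three idx(2) by metis
  note T = trip[OF ijk]
  show "length C = 6" using T by simp
  \<comment> \<open>A fourth neighbour would form, with two of the others, a triple that violates
    the spacing.\<close>
  have "I \<subseteq> {i, j, k}"
  proof
    fix t assume t: "t \<in> I"
    show "t \<in> {i, j, k}"
    proof (rule ccontr)
      assume "t \<notin> {i, j, k}"
      then consider "t < i" | "i < t" "t < j" | "j < t" "t < k" | "k < t" using ijk by fastforce
      then show False
      proof cases
        case 1 show ?thesis using trip[OF t ijk(1) ijk(3)] 1 ijk T by linarith
      next
        case 2 show ?thesis using trip[OF ijk(1) t ijk(3)] 2 ijk T by linarith
      next
        case 3 show ?thesis using trip[OF ijk(1) t ijk(3)] 3 ijk T by linarith
      next
        case 4 show ?thesis using trip[OF ijk(1) ijk(3) t] 4 ijk T by linarith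
      qed
    qed
  qed
  then have "I = {i, i + 2, i + 4}" using ijk T by auto
  moreover have "i = 0 \<or> i = 1" using T by auto
  ultimately have "I = {0, 2, 4} \<or> I = {1, 3, 5}" by auto
  then show "nb w \<inter> set C = {C!0, C!2, C!4} \<or> nb w \<inter> set C = {C!1, C!3, C!5}"
    using idx(1) by auto
qed

text \<open>The pattern left over in the neighbourhood count: a hexagon with a long chord, one outside
  vertex joined to one colour class and another joined to at least two vertices of the other.\<close>

definition hexpat :: "'a set \<Rightarrow> 'a \<Rightarrow> 'a \<Rightarrow> 'a \<Rightarrow> 'a \<Rightarrow> 'a \<Rightarrow> 'a \<Rightarrow> 'a \<Rightarrow> 'a \<Rightarrow> bool" where
  "hexpat S u v b1 a1 b2 a2 b3 a3 \<longleftrightarrow>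
     S = {b1, a1, b2, a2, b3, a3} \<and> distinct [b1, a1, b2, a2, b3, a3] \<and>
     E b1 a1 \<and> E a1 b2 \<and> E b2 a2 \<and> E a2 b3 \<and> E b3 a3 \<and> E a3 b1 \<and> E b1 a2 \<and>
     nb u \<inter> S = {b1, b2, b3} \<and> nb v \<inter> S \<subseteq> {a1, a2, a3} \<and> card (nb v \<inter> S) \<ge> 2"

text \<open>A chord between two \<open>b\<close>s gives a diamond with \<open>u\<close> and the
  \<open>a\<close> between them; a chord between two \<open>a\<close>s gives a fan at the
  \<open>b\<close> between them, on five vertices. The chords that remain join opposite vertices of
  the hexagon.\<close>

lemma hex_chord:
  assumes d: "distinct [u, b1, a1, b2, a2, b3, a3]"
    and e: "E b1 a1" "E a1 b2" "E b2 a2" "E a2 b3" "E b3 a3" "E a3 b1"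
    and u: "E u b1" "E u b2" "E u b3"
    and mn: "\<And>T. T \<subseteq> {u, b1, a1, b2, a2, b3, a3} \<Longrightarrow> ccset T \<Longrightarrow> 6 \<le> card T"
    and pq: "E p q" "p \<in> {b1, a1, b2, a2, b3, a3}" "q \<in> {b1, a1, b2, a2, b3, a3}"
    and nc: "{p, q} \<notin> {{b1, a1}, {a1, b2}, {b2, a2}, {a2, b3}, {b3, a3}, {a3, b1}}"
  shows "E b1 a2 \<or> E b2 a3 \<or> E b3 a1"
proof -
  have no: False if "ccset T" "T \<subseteq> {u, b1, a1, b2, a2, b3, a3}" "card T \<le> 5" for T
    using mn[OF that(2,1)] that(3) by simp
  have four: "card {x, y, z, w} \<le> 5" for x y z w :: 'a by (simp add: card_insert_if)
  have five: "card {x, y, z, w, v} \<le> 5" for x y z w v :: 'a by (simp add: card_insert_if)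
  have "\<not> E b1 b2" using no[OF diamond[of b1 b2 u a1] _ four] d e u sym by auto
  moreover have "\<not> E b2 b3" using no[OF diamond[of b2 b3 u a2] _ four] d e u sym by auto
  moreover have "\<not> E b3 b1" using no[OF diamond[of b3 b1 u a3] _ four] d e u sym by auto
  moreover have "\<not> E a1 a2"
  proof
    assume "E a1 a2"
    then have "fan b2 [u, b1, a1, a2]" using d e u sym by (auto simp: fan_def)
    from no[OF fan_ccset[OF this]] show False using d by (auto simp: card_insert_if)
  qed
  moreover have "\<not> E a2 a3"
  proof
    assume "E a2 a3"
    then have "fan b3 [u, b2, a2, a3]" using d e u sym by (auto simp: fan_def)
    from no[OF fan_ccset[OF this]] show False using d by (auto simp: card_insert_if)
  qed
  moreover have "\<not> E a3 a1"
  proof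
    assume "E a3 a1"
    then have "fan b1 [u, b3, a3, a1]" using d e u sym by (auto simp: fan_def)
    from no[OF fan_ccset[OF this]] show False using d by (auto simp: card_insert_if)
  qed
  ultimately have N: "\<not> E b1 b2" "\<not> E b2 b3" "\<not> E b3 b1" "\<not> E a1 a2" "\<not> E a2 a3" "\<not> E a3 a1"
    by auto
  then have N': "\<not> E b2 b1" "\<not> E b3 b2" "\<not> E b1 b3" "\<not> E a2 a1" "\<not> E a3 a2" "\<not> E a1 a3"
    using sym by blast+
  have L: "E a2 b1 \<Longrightarrow> E b1 a2" "E a3 b2 \<Longrightarrow> E b2 a3" "E a1 b3 \<Longrightarrow> E b3 a1" using sym by blast+
  show ?thesis using pq(2,3) unfolding insert_iff empty_iff
    by (elim disjE) (use pq(1) nc N N' L irrefl in \<open>simp_all add: doubleton_eq_iff\<close>)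
qed

text \<open>Shifting the names by two places along the hexagon moves the long chord to
  \<open>b1\<close> and \<open>a2\<close>.\<close>

lemma hexpat_exists_aux:
  assumes S: "S = {b1, a1, b2, a2, b3, a3}" and d: "distinct [b1, a1, b2, a2, b3, a3]"
    and e: "E b1 a1" "E a1 b2" "E b2 a2" "E a2 b3" "E b3 a3" "E a3 b1"
    and pq: "E p q" "p \<in> S" "q \<in> S"
    and nc: "{p, q} \<notin> {{b1, a1}, {a1, b2}, {b2, a2}, {a2, b3}, {b3, a3}, {a3, b1}}"
    and u: "u \<notin> S" "nb u \<inter> S = {b1, b2, b3}"
    and mn: "\<And>T. T \<subseteq> insert u S \<Longrightarrow> ccset T \<Longrightarrow> 6 \<le> card T"
    and v: "nb v \<inter> S \<subseteq> {a1, a2, a3}" "card (nb v \<inter> S) \<ge> 2"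
  shows "\<exists>b1 a1 b2 a2 b3 a3. hexpat S u v b1 a1 b2 a2 b3 a3"
proof -
  have ub: "E u b1" "E u b2" "E u b3" using u(2) by auto
  have du: "distinct [u, b1, a1, b2, a2, b3, a3]" using d u S by auto
  have "E b1 a2 \<or> E b2 a3 \<or> E b3 a1"
    using hex_chord[OF du e ub _ pq(1) _ _ nc] mn pq S by auto
  then have "hexpat S u v b1 a1 b2 a2 b3 a3 \<or> hexpat S u v b2 a2 b3 a3 b1 a1 \<or> hexpat S u v b3 a3 b1 a1 b2 a2"
    unfolding hexpat_def using S d e u v by auto
  then show ?thesis by blast
qed

lemma six_list:
  assumes "length C = 6"
  obtains c0 c1 c2 c3 c4 c5 where "C = [c0, c1, c2, c3, c4, c5]"
  using assms by (auto simp: length_Suc_conv numeral_eq_Suc)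

text \<open>\<open>u\<close> takes a whole colour class, so five neighbours in all leave at least
  two for \<open>v\<close>. If \<open>v\<close> has three, they form a colour class too, and not
  that of \<open>u\<close>; if it has two, the count leaves no room for a common neighbour. Either
  way they lie in the other class.\<close>

lemma hexpat_exists_half:
  assumes C: "chorded_cycle S E C" "set C = S" "length C = 6"
    and u: "u \<notin> S" "card (nb u \<inter> S) \<ge> 3" and v: "v \<notin> S"
    and mnu: "\<And>T. T \<subseteq> insert u S \<Longrightarrow> ccset T \<Longrightarrow> 6 \<le> card T"
    and mnv: "\<And>T. T \<subseteq> insert v S \<Longrightarrow> ccset T \<Longrightarrow> 6 \<le> card T"
    and five: "card ((nb u \<union> nb v) \<inter> S) \<ge> 5"
  shows "\<exists>b1 a1 b2 a2 b3 a3. hexpat S u v b1 a1 b2 a2 b3 a3"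
proof -
  obtain c0 c1 c2 c3 c4 c5 where cs: "C = [c0, c1, c2, c3, c4, c5]" using six_list[OF C(3)] .
  have S: "S = {c0, c1, c2, c3, c4, c5}" using C cs by auto
  have cyc: "is_cycle S E C" using C by (simp add: chorded_cycle_def)
  note cl = cycle_list[OF cyc]
  have d: "distinct [c0, c1, c2, c3, c4, c5]" using cl(3) cs by simp
  have e: "E c0 c1" "E c1 c2" "E c2 c3" "E c3 c4" "E c4 c5" "E c5 c0" using cl(1,2) cs by auto
  obtain p q where pq: "E p q" "p \<in> S" "q \<in> S" "{p, q} \<notin> cycle_edges C"
    using C by (auto simp: chorded_cycle_def is_chord_def)
  have ce: "cycle_edges C = {{c0, c1}, {c1, c2}, {c2, c3}, {c3, c4}, {c4, c5}, {c5, c0}}"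
  proof -
    have "{..<6::nat} = {0, 1, 2, 3, 4, 5}" by auto
    moreover have "cycle_edges C = (\<lambda>i. {C ! i, C ! ((i + 1) mod 6)}) ` {..<6}"
      unfolding cycle_edges_def using C(3) by auto
    ultimately show ?thesis by (simp add: cs)
  qed
  have fS: "finite S" using S by simp
  have ix: "C!0 = c0" "C!1 = c1" "C!2 = c2" "C!3 = c3" "C!4 = c4" "C!5 = c5" using cs by simp_all
  have L6: "6 \<le> length C" using C by simp
  have U: "nb u \<inter> S = {c0, c2, c4} \<or> nb u \<inter> S = {c1, c3, c5}"
    using outside_neighbours(2)[OF cyc L6, of u, unfolded ix C(2,3)] u mnu by blast
  have V: "card (nb v \<inter> S) \<ge> 3 \<Longrightarrow> nb v \<inter> S = {c0, c2, c4} \<or> nb v \<inter> S = {c1, c3, c5}"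
    using outside_neighbours(2)[OF cyc L6, of v, unfolded ix C(2,3)] v mnv by blast
  have un: "(nb u \<union> nb v) \<inter> S = (nb u \<inter> S) \<union> (nb v \<inter> S)" by auto
  have "card {c0, c2, c4} = 3" "card {c1, c3, c5} = 3" using d by auto
  then have cu: "card (nb u \<inter> S) = 3" using U by metis
  have cn: "card ((nb u \<inter> S) \<union> (nb v \<inter> S)) + card ((nb u \<inter> S) \<inter> (nb v \<inter> S)) = card (nb u \<inter> S) + card (nb v \<inter> S)"
    using card_Un_Int[of "nb u \<inter> S" "nb v \<inter> S"] fS by simp
  note five' = five[unfolded un]
  have v2: "card (nb v \<inter> S) \<ge> 2" using cn cu five' by linarith
  have disj: "(nb u \<inter> S) \<inter> (nb v \<inter> S) = {}"
  proof (cases "card (nb v \<inter> S) \<ge> 3")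
    case True
    have "nb u \<inter> S \<noteq> nb v \<inter> S" using five' cu by auto
    moreover have "{c0, c2, c4} \<inter> {c1, c3, c5} = {}" using d by auto
    ultimately show ?thesis using U V[OF True] by (metis Int_commute)
  next
    case False
    then have "card ((nb u \<inter> S) \<inter> (nb v \<inter> S)) = 0" using cn cu five' by linarith
    then show ?thesis using fS by auto
  qed
  from U show ?thesis
  proof
    assume A: "nb u \<inter> S = {c0, c2, c4}"
    then have "nb v \<inter> S \<subseteq> {c1, c3, c5}" using disj S by auto
    then show ?thesis
      using hexpat_exists_aux[OF S d e pq(1,2,3) pq(4)[unfolded ce] u(1) A mnu _ v2] by blast
  next
    assume A: "nb u \<inter> S = {c1, c3, c5}"
    have nv: "nb v \<inter> S \<subseteq> {c2, c4, c0}" using disj S A by auto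
    have S': "S = {c1, c2, c3, c4, c5, c0}" using S by auto
    have d': "distinct [c1, c2, c3, c4, c5, c0]" using d by auto
    have nc: "{p, q} \<notin> {{c1, c2}, {c2, c3}, {c3, c4}, {c4, c5}, {c5, c0}, {c0, c1}}" using pq(4) ce by auto
    show ?thesis
      by (rule hexpat_exists_aux[OF S' d' e(2-6) e(1) pq(1,2,3) nc u(1) A mnu nv v2])
  qed
qed

lemma pair_union_or_hexpat:
  assumes S: "ccset S" "card S \<ge> 6" and uv: "u \<notin> S" "v \<notin> S"
    and mnu: "\<And>T. T \<subseteq> insert u S \<Longrightarrow> ccset T \<Longrightarrow> card S \<le> card T"
    and mnv: "\<And>T. T \<subseteq> insert v S \<Longrightarrow> ccset T \<Longrightarrow> card S \<le> card T"
    and five: "card ((nb u \<union> nb v) \<inter> S) \<ge> 5"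
  shows "\<exists>b1 a1 b2 a2 b3 a3. hexpat S u v b1 a1 b2 a2 b3 a3 \<or> hexpat S v u b1 a1 b2 a2 b3 a3"
proof -
  obtain C where C: "chorded_cycle S E C" "set C = S" using S by (auto simp: ccset_def)
  have cyc: "is_cycle S E C" using C by (simp add: chorded_cycle_def)
  have L: "length C = card S" using cycle_list(3)[OF cyc] C distinct_card by metis
  have un: "(nb u \<union> nb v) \<inter> S = (nb u \<inter> S) \<union> (nb v \<inter> S)" by auto
  have "card ((nb u \<union> nb v) \<inter> S) \<le> card (nb u \<inter> S) + card (nb v \<inter> S)"
    unfolding un by (rule card_Un_le)
  then consider "card (nb u \<inter> S) \<ge> 3" | "card (nb v \<inter> S) \<ge> 3" using five by linarith
  then show ?thesis
  proof cases
    case 1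
    then have "length C = 6"
      using outside_neighbours(1)[OF cyc, of u] uv mnu S C L by auto
    then show ?thesis using hexpat_exists_half[OF C _ uv(1) 1 uv(2) _ _ five] mnu mnv L by metis
  next
    case 2
    then have "length C = 6"
      using outside_neighbours(1)[OF cyc, of v] uv mnv S C L by auto
    then show ?thesis using hexpat_exists_half[OF C _ uv(2) 2 uv(1)] five mnu mnv L
      by (metis Un_commute)
  qed
qed

lemma few_neighbours_long:
  assumes S: "ccset S" "card S \<ge> 7" and u: "u \<notin> S"
    and mnu: "\<And>T. T \<subseteq> insert u S \<Longrightarrow> ccset T \<Longrightarrow> card S \<le> card T"
  shows "card (nb u \<inter> S) \<le> 2"
proof (rule ccontr)
  assume three: "\<not> ?thesis"
  obtain C where C: "chorded_cycle S E C" "set C = S" using S by (auto simp: ccset_def)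
  have cyc: "is_cycle S E C" using C by (simp add: chorded_cycle_def)
  have L: "length C = card S" using cycle_list(3)[OF cyc] C distinct_card by metis
  show False using outside_neighbours(1)[OF cyc, of u] u mnu S C L three by auto
qed

section \<open>Triangles outside a shortest chorded cycle\<close>

definition triangle_off :: "'a set \<Rightarrow> 'a \<Rightarrow> 'a \<Rightarrow> 'a \<Rightarrow> bool" where
  "triangle_off S p q r \<longleftrightarrow> E p q \<and> E q r \<and> E r p \<and> p \<notin> S \<and> q \<notin> S \<and> r \<notin> S"

text \<open>The path is closed through \<open>p\<close>, \<open>r\<close> and \<open>q\<close>, and
  the edge \<open>p q\<close> is the chord; hence the three extra vertices.\<close>

lemma triangle_path:
  assumes t: "triangle_off (set C) p q r" and xs: "successively E xs" "distinct xs" "set xs \<subseteq> set C" "xs \<noteq> []"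
    and e: "(E p (hd xs) \<and> E q (last xs)) \<or> (E q (hd xs) \<and> E p (last xs))"
  shows "\<exists>T \<subseteq> {p, q, r} \<union> set C. ccset T \<and> card T = card (set xs) + 3"
proof -
  have main: "ccset ({p, q, r} \<union> set xs)"
    if "triangle_off (set C) p q r" "E p (hd xs)" "E q (last xs)" for p q r
  proof (rule fan_ccset')
    have ne: "p \<noteq> q" "q \<noteq> r" "r \<noteq> p" using that irrefl by (auto simp: triangle_off_def)
    have "successively E (rev xs)" using xs(1) sym by (auto simp: successively_conv_nth rev_nth Suc_diff_Suc)
        (metis (no_types, lifting) Suc_diff_Suc Suc_lessD diff_less xs(1) successively_nth length_greater_0_conv xs(4) zero_less_Suc)
    then have s: "successively E (r # q # rev xs)"
      using that xs(4) sym by (cases "rev xs") (auto simp: triangle_off_def hd_rev[symmetric])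
    have "last (r # q # rev xs) = hd xs" using xs(4) by (simp add: last_rev)
    moreover have "q \<noteq> hd xs" using that xs(3) hd_in_set[OF xs(4)] by (auto simp: triangle_off_def)
    moreover have "p \<notin> set xs" "q \<notin> set xs" "r \<notin> set xs" using that xs(3) by (auto simp: triangle_off_def)
    ultimately show "fan p (r # q # rev xs)"
      unfolding fan_def using s ne that xs(2) sym by (auto simp: triangle_off_def)
  qed auto
  have "ccset ({p, q, r} \<union> set xs)"
    using e
  proof
    assume "E p (hd xs) \<and> E q (last xs)"
    then show ?thesis using main[OF t] by auto
  next
    assume a: "E q (hd xs) \<and> E p (last xs)"
    have "triangle_off (set C) q p r" using t sym by (auto simp: triangle_off_def)
    then show ?thesis using main[of q p r] a by (simp add: insert_commute)
  qed
  moreover have "card ({p, q, r} \<union> set xs) = card (set xs) + 3"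
  proof -
    have "p \<noteq> q" "q \<noteq> r" "r \<noteq> p" using t irrefl by (auto simp: triangle_off_def)
    moreover have "p \<notin> set xs" "q \<notin> set xs" "r \<notin> set xs" using t xs(3) by (auto simp: triangle_off_def)
    ultimately show ?thesis by simp
  qed
  ultimately show ?thesis using xs(3) by (intro exI[of _ "{p, q, r} \<union> set xs"]) auto
qed

text \<open>Both arcs between a neighbour of \<open>p\<close> and a neighbour of \<open>q\<close>
  can be closed through the triangle, so each has at least \<open>length C - 3\<close> vertices. On
  nine or more vertices no such two neighbours exist.\<close>

lemma triangle_distance:
  assumes cyc: "is_cycle S E C" and t: "triangle_off (set C) p q r"
    and mn: "\<And>T. T \<subseteq> {p, q, r} \<union> set C \<Longrightarrow> ccset T \<Longrightarrow> length C \<le> card T"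
    and ij: "i < j" "j < length C" and e: "(E p (C ! i) \<and> E q (C ! j)) \<or> (E q (C ! i) \<and> E p (C ! j))"
  shows "length C \<le> j - i + 4" "j - i \<le> 4"
proof -
  note c = cycle_list[OF cyc]
  note I = arc_inner[OF c(1,3), of i j]
  have ne: "drop i (take (Suc j) C) \<noteq> []" using ij by auto
  have "\<exists>T \<subseteq> {p, q, r} \<union> set C. ccset T \<and> card T = j - i + 1 + 3"
    using triangle_path[OF t I(1,2,6) ne] I(3,4,7) ij e by auto
  then have "length C \<le> j - i + 1 + 3" using mn by metis
  then show "length C \<le> j - i + 4" by simp
  note O = arc_outer[OF c(1,2,3), of i j]
  have ne: "drop j C @ take (Suc i) C \<noteq> []" using ij by auto
  have "\<exists>T \<subseteq> {p, q, r} \<union> set C. ccset T \<and> card T = length C - j + i + 1 + 3"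
    using triangle_path[OF t O(1,2,6) ne] O(3,4,7) ij e by auto
  then have "length C \<le> length C - j + i + 1 + 3" using mn by metis
  then show "j - i \<le> 4" using ij by linarith
qed

lemma two_elements_nat:
  fixes I :: "nat set"
  assumes "card I \<ge> 2"
  obtains i j where "i \<in> I" "j \<in> I" "i < j"
proof -
  obtain i j where "i \<in> I" "j \<in> I" "i \<noteq> j" using assms
    by (metis card_le_Suc0_iff_eq card.infinite not_less_eq_eq numeral_2_eq_2 zero_le)
  then show ?thesis using that by (cases "i < j") auto
qed

text \<open>A common neighbour would give a diamond on four vertices, so the bound for five is just
  disjointness. On six vertices either both have at most two neighbours, or one has a colour class
  and the other has none. From seven on, both have at most two, and two each is excluded by
  distances.\<close>

lemma triangle_neighbours:
  assumes S: "ccset S" "card S \<ge> 5" and t: "triangle_off S p q r"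
    and mn: "\<And>T. T \<subseteq> {p, q, r} \<union> S \<Longrightarrow> ccset T \<Longrightarrow> card S \<le> card T"
  shows "nb p \<inter> nb q \<inter> S = {}"
    "card (nb p \<inter> S) + card (nb q \<inter> S) \<le> (if card S = 5 then 5 else if card S = 6 then 4 else 3)"
proof -
  obtain C where C: "chorded_cycle S E C" "set C = S" using S by (auto simp: ccset_def)
  have cyc: "is_cycle S E C" using C by (simp add: chorded_cycle_def)
  have L: "length C = card S" using cycle_list(3)[OF cyc] C distinct_card by metis
  have fS: "finite S" using C by auto
  show dj: "nb p \<inter> nb q \<inter> S = {}"
  proof (rule ccontr)
    assume "\<not> ?thesis"
    then obtain c where c: "c \<in> S" "E p c" "E q c" by auto
    have "ccset {c, p, q, r}" using diamond[of p q c r] c t sym by (auto simp: triangle_off_def)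
    then have "card S \<le> card {c, p, q, r}" using mn c by auto
    also have "\<dots> \<le> 4" by (simp add: card_insert_if)
    finally show False using S by simp
  qed
  have sum: "card (nb p \<inter> S) + card (nb q \<inter> S) = card ((nb p \<inter> S) \<union> (nb q \<inter> S))"
    using fS dj by (intro card_Un_disjoint[symmetric]) auto
  define I where "I = {i. i < length C \<and> E p (C ! i)}"
  define J where "J = {i. i < length C \<and> E q (C ! i)}"
  note idI = nb_image_index[OF cycle_list(3)[OF cyc], of p, folded I_def, unfolded C(2)]
  note idJ = nb_image_index[OF cycle_list(3)[OF cyc], of q, folded J_def, unfolded C(2)]
  have IJ: "I \<inter> J = {}" using dj C by (auto simp: I_def J_def)
  have dist: "length C \<le> j - i + 4 \<and> j - i \<le> 4 \<and> j < length C"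
    if "(i \<in> I \<and> j \<in> J) \<or> (i \<in> J \<and> j \<in> I)" "i < j" for i j
  proof -
    have "j < length C" "(E p (C ! i) \<and> E q (C ! j)) \<or> (E q (C ! i) \<and> E p (C ! j))"
      using that by (auto simp: I_def J_def)
    then show ?thesis using triangle_distance[OF cyc, of p q r i j] t mn that(2) C(2) L by auto
  qed
  have mnp: "length C \<le> card T" if "T \<subseteq> insert p (set C)" "ccset T" for T
    using mn[of T] that C L by auto
  have mnq: "length C \<le> card T" if "T \<subseteq> insert q (set C)" "ccset T" for T
    using mn[of T] that C L by auto
  have pq: "p \<notin> set C" "q \<notin> set C" using t C by (auto simp: triangle_off_def)
  have out: "length C = 6 \<and> (I = {0, 2, 4} \<or> I = {1, 3, 5}) \<and> J = {}" 
    if L6: "length C \<ge> 6" and three: "card I \<ge> 3" 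
      and pp: "p' \<notin> set C" "\<And>T. T \<subseteq> insert p' (set C) \<Longrightarrow> ccset T \<Longrightarrow> length C \<le> card T"
      and I: "I = {i. i < length C \<and> E p' (C ! i)}"
      and JJ: "\<And>j. j \<in> J \<Longrightarrow> j < length C" "I \<inter> J = {}"
      and dist: "\<And>i j. (i \<in> I \<and> j \<in> J) \<or> (i \<in> J \<and> j \<in> I) \<Longrightarrow> i < j \<Longrightarrow> length C \<le> j - i + 4" for I J p'
  proof -
    note id = nb_image_index[OF cycle_list(3)[OF cyc], of p', folded I]
    note o = outside_neighbours[OF cyc L6 pp] 
    have c6: "length C = 6" using o(1) three id by simp
    have "I = {0, 2, 4} \<or> I = {1, 3, 5}"
    proof -
      have inj: "inj_on ((!) C) {..<length C}" using cycle_list(3)[OF cyc] by (simp add: inj_on_nth)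
      have sub: "I \<subseteq> {..<length C}" "{0, 2, 4} \<subseteq> {..<length C}" "{1, 3, 5} \<subseteq> {..<length C}" using I c6 by auto
      have "(!) C ` I = (!) C ` {0, 2, 4} \<or> (!) C ` I = (!) C ` {1, 3, 5}"
        using o(2) three id by simp
      then show ?thesis using inj_on_image_eq_iff[OF inj sub(1)] sub(2,3) by blast
    qed
    moreover have "J = {}"
    proof (rule ccontr)
      assume "J \<noteq> {}"
      then obtain j where j: "j \<in> J" by auto
      have j6: "j < 6" using JJ(1)[OF j] c6 by simp
      \<comment> \<open>On six vertices \<open>triangle_distance\<close> demands an index difference
        of at least two, but every index outside a colour class is next to one inside it.\<close>
      have far: "i + 2 \<le> j \<or> j + 2 \<le> i" if "i \<in> I" for i
      proof -
        have "i \<noteq> j" using that j JJ(2) by auto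
        then consider "i < j" | "j < i" by linarith
        then show ?thesis
        proof cases
          case 1 then show ?thesis using dist[of i j] that j c6 by auto
        next
          case 2 then show ?thesis using dist[of j i] that j c6 by auto
        qed
      qed
      show False using calculation
      proof
        assume "I = {0, 2, 4}"
        then show False using far[of 0] far[of 2] far[of 4] j6 by auto
      next
        assume "I = {1, 3, 5}"
        then show False using far[of 1] far[of 3] far[of 5] j6 by auto
      qed
    qed
    ultimately show ?thesis using c6 by simp
  qed
  have outp: "length C = 6 \<and> card I = 3 \<and> J = {}" if "length C \<ge> 6" "card I \<ge> 3"
  proof -
    have "length C = 6 \<and> (I = {0, 2, 4} \<or> I = {1, 3, 5}) \<and> J = {}"
    proof (rule out[OF that pq(1) mnp I_def _ IJ])
      show "j < length C" if "j \<in> J" for j using that by (simp add: J_def)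
      show "length C \<le> j - i + 4" if "i \<in> I \<and> j \<in> J \<or> i \<in> J \<and> j \<in> I" "i < j" for i j
        using dist[OF that] by simp
    qed
    then show ?thesis by auto
  qed
  have outq: "length C = 6 \<and> card J = 3 \<and> I = {}" if "length C \<ge> 6" "card J \<ge> 3"
  proof -
    have "length C = 6 \<and> (J = {0, 2, 4} \<or> J = {1, 3, 5}) \<and> I = {}"
    proof (rule out[OF that pq(2) mnq J_def])
      show "j < length C" if "j \<in> I" for j using that by (simp add: I_def)
      show "J \<inter> I = {}" using IJ by blast
      show "length C \<le> j - i + 4" if "i \<in> J \<and> j \<in> I \<or> i \<in> I \<and> j \<in> J" "i < j" for i j
        using dist[OF _ that(2)] that(1) by blast
    qed
    then show ?thesis by auto
  qed
  consider "card S = 5" | "card S = 6" | "card S \<ge> 7" using S by linarith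
  then show "card (nb p \<inter> S) + card (nb q \<inter> S) \<le> (if card S = 5 then 5 else if card S = 6 then 4 else 3)"
  proof cases
    case 1
    have "card ((nb p \<inter> S) \<union> (nb q \<inter> S)) \<le> card S" using fS by (intro card_mono) auto
    then show ?thesis using sum 1 by simp
  next
    case 2
    show ?thesis
    proof (cases "card I \<ge> 3 \<or> card J \<ge> 3")
      case True
      have "length C \<ge> 6" using 2 L by simp
      then have "card I + card J \<le> 3"
        using True outp outq by (metis add.commute add_0 card.empty order_refl)
      then show ?thesis unfolding idI(2) idJ(2) using 2 by simp
    next
      case False
      then show ?thesis unfolding idI(2) idJ(2) using 2 by simp
    qed
  next
    case 3
    have "length C \<ge> 6" "length C \<noteq> 6" using 3 L by auto
    then have "\<not> card I \<ge> 3" "\<not> card J \<ge> 3" using outp outq by blast+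
    then have le: "card I \<le> 2" "card J \<le> 2" by auto
    \<comment> \<open>The length can only be seven or eight, and indices from \<open>I\<close> and
      \<open>J\<close> differ by three or four, for length eight by exactly four. Two indices of
      each kind cannot all be placed like this.\<close>
    have "\<not> (card I = 2 \<and> card J = 2)"
    proof
      assume c: "card I = 2 \<and> card J = 2"
      obtain i i' where i: "i \<in> I" "i' \<in> I" "i < i'" using two_elements_nat[of I] c by auto
      obtain j j' where j: "j \<in> J" "j' \<in> J" "j < j'" using two_elements_nat[of J] c by auto
      have D: "length C \<le> (b - a) + 4 \<and> b - a \<le> 4 \<and> b < length C \<and> a < b \<or> length C \<le> (a - b) + 4 \<and> a - b \<le> 4 \<and> a < length C \<and> b < a"
        if "a \<in> I" "b \<in> J" for a b
      proof -
        have "a \<noteq> b" using that IJ by auto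
        then show ?thesis using dist[of a b] dist[of b a] that by (cases "a < b") auto
      qed
      have "length C \<ge> 7" using 3 L by simp
      then have D': "b = a + 3 \<or> b = a + 4 \<or> a = b + 3 \<or> a = b + 4" "length C = 8 \<longrightarrow> b = a + 4 \<or> a = b + 4"
        "length C \<le> 8" "a < length C" "b < length C" if "a \<in> I" "b \<in> J" for a b
        using D[OF that] by auto
      show False using D'[OF i(1) j(1)] D'[OF i(1) j(2)] D'[OF i(2) j(1)] D'[OF i(2) j(2)] i(3) j(3)
        by (elim disjE) linarith+
    qed
    then have "card I + card J \<le> 3" using le by linarith
    then show ?thesis unfolding idI(2) idJ(2) using 3 by simp
  qed
qed

text \<open>Let \<open>a\<close> count the neighbours of \<open>p1\<close> and \<open>p2\<close>,
  and \<open>b\<close> those of \<open>q1\<close> and \<open>q2\<close>. By inclusion-exclusion the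
  sum is \<open>2 * (a + b)\<close> minus four intersections; these partition the intersection of
  \<open>P1 \<union> P2\<close> with \<open>Q1 \<union> Q2\<close>, so they number at least
  \<open>a + b - card S\<close>. The resulting bound \<open>a + b + card S\<close> is 15 for five
  vertices and 14 for six; from seven on, \<open>2 * (a + b)\<close> is at most 12. What matters is
  that 15 is less than four pairs times four neighbours.\<close>

lemma two_triangles_bound:
  assumes S: "ccset S" "card S \<ge> 5" and t: "triangle_off S p1 p2 p3" "triangle_off S q1 q2 q3"
    and mn: "\<And>T. T \<subseteq> {p1, p2, p3} \<union> {q1, q2, q3} \<union> S \<Longrightarrow> ccset T \<Longrightarrow> card S \<le> card T"
  shows "card ((nb p1 \<union> nb q1) \<inter> S) + card ((nb p1 \<union> nb q2) \<inter> S)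
    + card ((nb p2 \<union> nb q1) \<inter> S) + card ((nb p2 \<union> nb q2) \<inter> S) \<le> 15"
proof -
  have fS: "finite S" using S ccset_finite by auto
  have mp: "\<And>T. T \<subseteq> {p1, p2, p3} \<union> S \<Longrightarrow> ccset T \<Longrightarrow> card S \<le> card T"
    and mq: "\<And>T. T \<subseteq> {q1, q2, q3} \<union> S \<Longrightarrow> ccset T \<Longrightarrow> card S \<le> card T" 
    using mn by (meson Un_mono order_refl sup.cobounded1 sup.cobounded2 subset_trans)+
  note P = triangle_neighbours[OF S t(1) mp]
  note Q = triangle_neighbours[OF S t(2) mq]
  define P1 P2 Q1 Q2 where d: "P1 = nb p1 \<inter> S" "P2 = nb p2 \<inter> S" "Q1 = nb q1 \<inter> S" "Q2 = nb q2 \<inter> S"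
  have f: "finite P1" "finite P2" "finite Q1" "finite Q2" using fS d by auto
  have u: "card ((nb x \<union> nb y) \<inter> S) + card (nb x \<inter> S \<inter> (nb y \<inter> S)) = card (nb x \<inter> S) + card (nb y \<inter> S)" for x y
    using card_Un_Int[of "nb x \<inter> S" "nb y \<inter> S"] fS by (simp add: Int_Un_distrib2)
  have PP: "P1 \<inter> P2 = {}" "Q1 \<inter> Q2 = {}" using P(1) Q(1) d by auto
  have "(P1 \<union> P2) \<inter> (Q1 \<union> Q2) = (P1 \<inter> Q1) \<union> ((P1 \<inter> Q2) \<union> ((P2 \<inter> Q1) \<union> (P2 \<inter> Q2)))" by auto
  also have "card \<dots> = card (P1 \<inter> Q1) + (card (P1 \<inter> Q2) + (card (P2 \<inter> Q1) + card (P2 \<inter> Q2)))"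
    using f PP by (subst card_Un_disjoint; (force)?)+
  finally have i: "card ((P1 \<union> P2) \<inter> (Q1 \<union> Q2)) = card (P1 \<inter> Q1) + card (P1 \<inter> Q2) + card (P2 \<inter> Q1) + card (P2 \<inter> Q2)" by simp
  have j: "card ((P1 \<union> P2) \<union> (Q1 \<union> Q2)) + card ((P1 \<union> P2) \<inter> (Q1 \<union> Q2)) = card P1 + card P2 + card Q1 + card Q2"
    using card_Un_Int[of "P1 \<union> P2" "Q1 \<union> Q2"] f PP by (simp add: card_Un_disjoint)
  have k: "card ((P1 \<union> P2) \<union> (Q1 \<union> Q2)) \<le> card S" using fS d by (intro card_mono) auto
  note U = u[of p1 q1, folded d] u[of p1 q2, folded d] u[of p2 q1, folded d] u[of p2 q2, folded d]
  note PQ = P(2)[folded d] Q(2)[folded d]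
  consider "card S = 5" | "card S = 6" | "card S \<ge> 7" using S(2) by linarith
  then show ?thesis
  proof cases
    case 1
    then have "card P1 + card P2 \<le> 5" "card Q1 + card Q2 \<le> 5" using PQ by simp_all
    then show ?thesis using U i j k 1 by linarith
  next
    case 2
    then have "card P1 + card P2 \<le> 4" "card Q1 + card Q2 \<le> 4" using PQ by simp_all
    then show ?thesis using U i j k 2 by linarith
  next
    case 3
    then have "card P1 + card P2 \<le> 3" "card Q1 + card Q2 \<le> 3" using PQ by simp_all
    then show ?thesis using U by linarith
  qed
qed

section \<open>Graphs without chorded cycles\<close>

lemma ccfree_mono: "ccfree W \<Longrightarrow> W' \<subseteq> W \<Longrightarrow> ccfree W'"
  by (auto simp: ccfree_def)

text \<open>The end \<open>z\<close> is prescribed so that low-degree vertices avoiding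
  \<open>z\<close> can be found at the heads of longest paths.\<close>

definition path_to :: "'a set \<Rightarrow> 'a \<Rightarrow> 'a list \<Rightarrow> bool" where
  "path_to W z xs \<longleftrightarrow> xs \<noteq> [] \<and> distinct xs \<and> set xs \<subseteq> W \<and> successively E xs \<and> last xs = z"

definition longest_to :: "'a set \<Rightarrow> 'a \<Rightarrow> 'a list \<Rightarrow> bool" where
  "longest_to W z xs \<longleftrightarrow> path_to W z xs \<and> (\<forall>ys. path_to W z ys \<longrightarrow> length ys \<le> length xs)"

lemma longest_to_exists:
  assumes "finite W" "z \<in> W"
  shows "\<exists>xs. longest_to W z xs"
proof -
  have "path_to W z [z]" using assms by (simp add: path_to_def)
  moreover have "length ys < Suc (card W)" if "path_to W z ys" for ys
    using that assms by (metis path_to_def card_mono distinct_card le_imp_less_Suc)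
  ultimately show ?thesis
    using ex_has_greatest_nat[of "path_to W z" "[z]" length "Suc (card W)"] unfolding longest_to_def by blast
qed

lemma longest_to_hd_neighbours:
  assumes "longest_to W z xs"
  shows "nb (hd xs) \<inter> W \<subseteq> set xs"
proof
  fix y assume y: "y \<in> nb (hd xs) \<inter> W"
  show "y \<in> set xs"
  proof (rule ccontr)
    assume n: "y \<notin> set xs"
    have p: "path_to W z xs" using assms by (simp add: longest_to_def)
    then have "path_to W z (y # xs)" using y n sym by (cases xs) (auto simp: path_to_def)
    then show False using assms by (fastforce simp: longest_to_def)
  qed
qed

text \<open>All neighbours of the head lie on the path. One strictly between the first and the last
  of them would be the inner vertex of a fan at the head, so there are at most two.\<close>

lemma longest_to_last_neighbour:
  assumes free: "ccfree W" and l: "longest_to W z xs" and deg: "nb (hd xs) \<inter> W \<noteq> {}"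
  obtains j where "1 \<le> j" "j < length xs" "E (hd xs) (xs ! j)" "nb (hd xs) \<inter> W \<subseteq> {xs ! 1, xs ! j}"
proof -
  have p: "xs \<noteq> []" "distinct xs" "set xs \<subseteq> W" "successively E xs" using l by (auto simp: longest_to_def path_to_def)
  let ?J = "{j. j < length xs \<and> E (hd xs) (xs ! j)}"
  obtain y where "y \<in> nb (hd xs) \<inter> W" using deg by blast
  then have "y \<in> set xs" "E (hd xs) y" using longest_to_hd_neighbours[OF l] by auto
  then have ne: "?J \<noteq> {}" by (auto simp: in_set_conv_nth)
  define j where "j = Max ?J"
  have j: "j \<in> ?J" unfolding j_def using ne by (intro Max_in) auto
  have hd0: "hd xs = xs ! 0" using p by (simp add: hd_conv_nth)
  have nz: "i \<noteq> 0" if "i \<in> ?J" for i using that irrefl[of "xs ! 0"] hd0 by (intro notI) simp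
  have "nb (hd xs) \<inter> W \<subseteq> {xs ! 1, xs ! j}"
  proof
    fix y assume y: "y \<in> nb (hd xs) \<inter> W"
    then have "y \<in> set xs" using longest_to_hd_neighbours[OF l] by auto
    then obtain i where i: "i < length xs" "xs ! i = y" by (auto simp: in_set_conv_nth)
    then have iJ: "i \<in> ?J" using y by auto
    then have le: "i \<le> j" unfolding j_def by (intro Max_ge) auto
    show "y \<in> {xs ! 1, xs ! j}"
    proof (rule ccontr)
      assume "y \<notin> {xs ! 1, xs ! j}"
      then have ij: "1 < i" "i < j" using i le nz[OF iJ] by (auto simp: le_less) (metis One_nat_def Suc_lessI less_one not_gr_zero)
      let ?ys = "drop 1 (take (Suc j) xs)"
      note A = arc_inner[OF p(4) p(2), of 1 j]
      have jl: "j < length xs" using j by simp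
      have neq: "xs ! a \<noteq> xs ! b" if "a \<noteq> b" "a < length xs" "b < length xs" for a b
        using that p(2) by (simp add: nth_eq_iff_index_eq)
      have succ0: "E (hd xs) (xs ! 1)" using successively_nth[OF p(4), of 0] hd0 ij jl by simp
      have "hd xs \<noteq> xs ! x" if "x \<in> {1..j}" for x
        unfolding hd0 by (rule neq) (use that jl in auto)
      then have "hd xs \<notin> (!) xs ` {1..j}" by blast
      then have "hd xs \<notin> set ?ys" using A(5) ij jl by simp
      moreover have "xs ! i \<in> set ?ys" "xs ! i \<noteq> xs ! 1" "xs ! i \<noteq> xs ! j" using A(5) ij jl neq by auto
      ultimately have "fan (hd xs) ?ys" unfolding fan_def using A(1-4) ij jl j iJ succ0 by auto
      note cc = fan_ccset[OF this]
      have "set ?ys \<subseteq> W" using A(6) ij jl p(3) by fastforce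
      moreover have "hd xs \<in> W" using p(1,3) by auto
      ultimately show False using free cc unfolding ccfree_def by blast
    qed
  qed
  then show ?thesis using that[of j] j nz[OF j] by auto
qed

lemma longest_to_low:
  assumes "ccfree W" "longest_to W z xs"
  shows "card (nb (hd xs) \<inter> W) \<le> 2"
proof (cases "nb (hd xs) \<inter> W = {}")
  case False
  then obtain j where "nb (hd xs) \<inter> W \<subseteq> {xs ! 1, xs ! j}"
    using longest_to_last_neighbour[OF assms False] by blast
  then have "card (nb (hd xs) \<inter> W) \<le> card {xs ! 1, xs ! j}" by (intro card_mono) auto
  then show ?thesis by (simp add: card_insert_if split: if_splits)
qed simp

text \<open>A Posa rotation: the head is adjacent to \<open>xs ! j\<close>, so reversing the part
  before \<open>j\<close> gives another longest path to \<open>z\<close>, with head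
  \<open>xs ! (j - 1)\<close>. Both heads have low degree and are adjacent to
  \<open>xs ! j\<close>.\<close>

lemma two_low_common_neighbour:
  assumes fin: "finite W" and free: "ccfree W" and z: "z \<in> W"
    and deg: "\<And>x. x \<in> W \<Longrightarrow> card (nb x \<inter> W) \<ge> 2"
  obtains y y' m where "y \<in> W" "y' \<in> W" "m \<in> W" "y \<noteq> z" "y' \<noteq> z" "y \<noteq> y'" "E y m" "E y' m"
    "card (nb y \<inter> W) \<le> 2" "card (nb y' \<inter> W) \<le> 2"
proof -
  obtain xs where l: "longest_to W z xs" using longest_to_exists[OF fin z] by blast
  have p: "xs \<noteq> []" "distinct xs" "set xs \<subseteq> W" "successively E xs" "last xs = z"
    using l by (auto simp: longest_to_def path_to_def)
  have hW: "hd xs \<in> W" using p by auto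
  have d: "card (nb (hd xs) \<inter> W) \<ge> 2" using deg[OF hW] .
  then have dn: "nb (hd xs) \<inter> W \<noteq> {}" by auto
  obtain j where j: "1 \<le> j" "j < length xs" "E (hd xs) (xs ! j)" "nb (hd xs) \<inter> W \<subseteq> {xs ! 1, xs ! j}"
    using longest_to_last_neighbour[OF free l dn] by blast
  have "j \<noteq> 1"
  proof
    assume "j = 1"
    then have "card (nb (hd xs) \<inter> W) \<le> card {xs ! 1}" using j by (intro card_mono) auto
    then show False using d by simp
  qed
  then have j2: "2 \<le> j" using j by simp
  have neq: "xs ! a \<noteq> xs ! b" if "a \<noteq> b" "a < length xs" "b < length xs" for a b
    using that p(2) by (simp add: nth_eq_iff_index_eq)
  have hd0: "hd xs = xs ! 0" using p by (simp add: hd_conv_nth)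
  have z': "z = xs ! (length xs - 1)" using p by (simp add: last_conv_nth)
  define ys where "ys = rev (take j xs) @ drop j xs"
  have "longest_to W z ys"
  proof -
    have "take j xs \<noteq> []" "drop j xs \<noteq> []" using j j2 by auto
    moreover have "successively E (take j xs)" "successively E (drop j xs)"
      using p(4) by (metis append_take_drop_id successively_append_iff)+
    moreover have "successively E (rev (take j xs))"
    proof -
      have "successively (\<lambda>x y. E y x) (take j xs)" using \<open>successively E (take j xs)\<close> sym
        by (simp add: successively_conv_nth)
      then show ?thesis by (simp add: successively_rev)
    qed
    moreover have "last (rev (take j xs)) = hd xs" "hd (drop j xs) = xs ! j"
      using j j2 by (simp_all add: last_rev hd_take hd_drop_conv_nth)
    ultimately have "successively E ys" unfolding ys_def successively_append_iff using j by simp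
    moreover have "distinct ys" "length ys = length xs"
      unfolding ys_def using p(2) set_take_disj_set_drop_if_distinct[OF p(2), of j j] by auto
    moreover have "set ys = set xs"
      unfolding ys_def set_append set_rev by (metis set_append append_take_drop_id)
    moreover have "last ys = z" unfolding ys_def using j p by simp
    ultimately have "path_to W z ys" using p by (auto simp: path_to_def)
    then show ?thesis using l \<open>length ys = length xs\<close> by (simp add: longest_to_def)
  qed
  moreover have "hd ys = xs ! (j - 1)"
  proof -
    have tn: "take j xs \<noteq> []" using j j2 by auto
    then have "hd ys = last (take j xs)" by (simp add: ys_def hd_rev)
    also have "\<dots> = xs ! (j - 1)" using j j2 last_conv_nth[OF tn] by simp
    finally show ?thesis .
  qed
  ultimately have low': "card (nb (xs ! (j - 1)) \<inter> W) \<le> 2" using longest_to_low[OF free] by metis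
  have low: "card (nb (hd xs) \<inter> W) \<le> 2" using longest_to_low[OF free l] .
  have e: "E (xs ! (j - 1)) (xs ! j)" using successively_nth[OF p(4), of "j - 1"] j by simp
  have W: "xs ! (j - 1) \<in> W" "xs ! j \<in> W" using p(3) j by auto
  have "hd xs \<noteq> z" unfolding hd0 z' by (rule neq) (use j j2 in auto)
  moreover have "xs ! (j - 1) \<noteq> z" unfolding z' by (rule neq) (use j j2 in auto)
  moreover have "hd xs \<noteq> xs ! (j - 1)" unfolding hd0 by (rule neq) (use j j2 in auto)
  ultimately show ?thesis
    using that[of "hd xs" "xs ! (j - 1)" "xs ! j"] hW W low low' e j(3) by blast
qed

text \<open>If all degrees are at least two, the previous lemma gives a low vertex \<open>y\<close>,
  and applied once more with \<open>y\<close> as the end it gives two others. Otherwise a vertex of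
  degree at most one is deleted: when it returns, only its neighbour can cease to be low, and the
  returning vertex makes up for that.\<close>

lemma three_low:
  assumes "finite W" "ccfree W" "card W \<ge> 3"
  shows "card {x \<in> W. card (nb x \<inter> W) \<le> 2} \<ge> 3"
  using assms
proof (induction "card W" arbitrary: W rule: less_induct)
  case less
  let ?L = "\<lambda>W. {x \<in> W. card (nb x \<inter> W) \<le> 2}"
  show ?case
  proof (cases "\<exists>x\<in>W. card (nb x \<inter> W) \<le> 1")
    case False
    then have deg: "\<And>x. x \<in> W \<Longrightarrow> card (nb x \<inter> W) \<ge> 2" by force
    obtain z where "z \<in> W" using less.prems by fastforce
    then obtain y where y: "y \<in> W" "card (nb y \<inter> W) \<le> 2"
      using two_low_common_neighbour[OF less.prems(1,2) _ deg] by metis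
    obtain a b where ab: "a \<in> W" "b \<in> W" "a \<noteq> y" "b \<noteq> y" "a \<noteq> b" "card (nb a \<inter> W) \<le> 2" "card (nb b \<inter> W) \<le> 2"
      using two_low_common_neighbour[OF less.prems(1,2) y(1) deg] by metis
    have "card {y, a, b} \<le> card (?L W)" using ab y less.prems by (intro card_mono) auto
    then show ?thesis using ab by auto
  next
    case True
    then obtain x where x: "x \<in> W" "card (nb x \<inter> W) \<le> 1" by auto
    show ?thesis
    proof (cases "card W = 3")
      case True
      have "?L W = W"
      proof -
        have "card (nb y \<inter> W) \<le> 2" if "y \<in> W" for y
        proof -
          have "card (nb y \<inter> W) \<le> card (W - {y})" using less.prems irrefl by (intro card_mono) auto
          then show ?thesis using True that less.prems by simp
        qed
        then show ?thesis by auto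
      qed
      then show ?thesis using True by simp
    next
      case False
      let ?W = "W - {x}"
      have c: "card ?W = card W - 1" using x less.prems by simp
      have "card ?W < card W" "finite ?W" "ccfree ?W" "3 \<le> card ?W" 
        using c less.prems False x ccfree_mono[of W ?W] by auto
      then have IH: "card (?L ?W) \<ge> 3" using less.hyps[of ?W] by auto
      have fin: "finite (?L ?W)" "finite (?L W)" "finite (nb x \<inter> W)" using less.prems by auto
      have "?L ?W - (nb x \<inter> W) \<subseteq> ?L W"
      proof
        fix y assume y: "y \<in> ?L ?W - (nb x \<inter> W)"
        then have "\<not> E y x" using sym by auto
        then have "nb y \<inter> W = nb y \<inter> ?W" by auto
        then show "y \<in> ?L W" using y by auto
      qed
      moreover have "x \<in> ?L W" using x by auto
      ultimately have "insert x (?L ?W - (nb x \<inter> W)) \<subseteq> ?L W" by auto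
      then have "card (insert x (?L ?W - (nb x \<inter> W))) \<le> card (?L W)" using fin by (intro card_mono)
      moreover have "card (insert x (?L ?W - (nb x \<inter> W))) = Suc (card (?L ?W - (nb x \<inter> W)))"
        using fin by (subst card_insert_disjoint) auto
      moreover have "card (?L ?W) - card (nb x \<inter> W) \<le> card (?L ?W - (nb x \<inter> W))"
        using fin by (intro diff_card_le_card_Diff)
      ultimately show ?thesis using IH x by linarith
    qed
  qed
qed

text \<open>A triangle attached to the rest of \<open>W\<close> through \<open>r\<close> at most.
  Such triangles are what obstructs finding a low pair with few neighbours.\<close>

definition end_triangle :: "'a set \<Rightarrow> 'a \<Rightarrow> 'a \<Rightarrow> 'a \<Rightarrow> bool" where
  "end_triangle W p q r \<longleftrightarrow> p \<in> W \<and> q \<in> W \<and> r \<in> W \<and> E p q \<and> E q r \<and> E r p \<and>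
     nb p \<inter> W = {q, r} \<and> nb q \<inter> W = {p, r}"

text \<open>Two low vertices with a common neighbour \<open>m\<close> have at most three neighbours
  together, so \<open>un\<close> forces them to be adjacent. Each other and \<open>m\<close> then
  use up their degree of two.\<close>

lemma end_triangle_exists:
  assumes fin: "finite W" and free: "ccfree W" and z: "z \<in> W"
    and deg: "\<And>x. x \<in> W \<Longrightarrow> card (nb x \<inter> W) \<ge> 2"
    and un: "\<And>u v. u \<in> W \<Longrightarrow> v \<in> W \<Longrightarrow> u \<noteq> v \<Longrightarrow> \<not> E u v \<Longrightarrow> card (nb u \<inter> W) \<le> 2 \<Longrightarrow> card (nb v \<inter> W) \<le> 2
      \<Longrightarrow> card ((nb u \<union> nb v) \<inter> W) \<ge> 4"
  obtains p q r where "end_triangle W p q r" "z \<noteq> p" "z \<noteq> q"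
proof -
  obtain y y' m where y: "y \<in> W" "y' \<in> W" "m \<in> W" "y \<noteq> z" "y' \<noteq> z" "y \<noteq> y'" "E y m" "E y' m"
    "card (nb y \<inter> W) \<le> 2" "card (nb y' \<inter> W) \<le> 2"
    using two_low_common_neighbour[OF fin free z deg] by metis
  have "E y y'"
  proof (rule ccontr)
    assume "\<not> E y y'"
    then have four: "card ((nb y \<union> nb y') \<inter> W) \<ge> 4" using un y by auto
    have "card ((nb y \<inter> W) \<union> (nb y' \<inter> W)) + card ((nb y \<inter> W) \<inter> (nb y' \<inter> W)) \<le> 4"
      using card_Un_Int[of "nb y \<inter> W" "nb y' \<inter> W"] fin y by simp
    moreover have "card ((nb y \<inter> W) \<inter> (nb y' \<inter> W)) > 0"
      using y fin by (subst card_gt_0_iff) auto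
    ultimately show False using four by (simp add: Int_Un_distrib2)
  qed
  have two: "nb a \<inter> W = {b, m}" if "E a b" "E a m" "b \<in> W" "b \<noteq> m" "card (nb a \<inter> W) \<le> 2" for a b
  proof -
    have "{b, m} \<subseteq> nb a \<inter> W" using that y by auto
    moreover have "card {b, m} = 2" using that by simp
    ultimately show ?thesis using that(5) fin by (metis card_seteq finite_Int)
  qed
  have ne: "y \<noteq> m" "y' \<noteq> m" using y irrefl by auto
  have "end_triangle W y y' m"
    unfolding end_triangle_def using two[of y y'] two[of y' y] y ne \<open>E y y'\<close> sym by auto
  then show ?thesis using that y by metis
qed

text \<open>Without such a pair all degrees are at least two, since a vertex of degree at most one
  would form one with a low vertex not adjacent to it. End triangles then exist whose free vertices
  avoid any given vertex. If the first is a whole component, the second is found in the rest,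
  otherwise by avoiding \<open>p1\<close>.\<close>

lemma low_pair_or_end_triangles:
  assumes fin: "finite W" and free: "ccfree W" and c: "card W \<ge> 4"
  shows "(\<exists>u\<in>W. \<exists>v\<in>W. u \<noteq> v \<and> \<not> E u v \<and> card (nb u \<inter> W) \<le> 2 \<and> card (nb v \<inter> W) \<le> 2 \<and> card ((nb u \<union> nb v) \<inter> W) \<le> 3)
    \<or> (\<exists>p1 p2 p3 q1 q2 q3. end_triangle W p1 p2 p3 \<and> end_triangle W q1 q2 q3 \<and> {p1, p2, p3} \<inter> {q1, q2, q3} = {})"
proof (subst disj_commute, rule disjCI)
  assume "\<not> (\<exists>u\<in>W. \<exists>v\<in>W. u \<noteq> v \<and> \<not> E u v \<and> card (nb u \<inter> W) \<le> 2 \<and> card (nb v \<inter> W) \<le> 2 \<and> card ((nb u \<union> nb v) \<inter> W) \<le> 3)"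
  then have un: "card ((nb u \<union> nb v) \<inter> W) \<ge> 4" if "u \<in> W" "v \<in> W" "u \<noteq> v" "\<not> E u v" "card (nb u \<inter> W) \<le> 2" "card (nb v \<inter> W) \<le> 2" for u v
    using that by force
  let ?L = "{x \<in> W. card (nb x \<inter> W) \<le> 2}"
  have three: "card ?L \<ge> 3" using three_low[OF fin free] c by simp
  have deg: "card (nb x \<inter> W) \<ge> 2" if x: "x \<in> W" for x
  proof (rule ccontr)
    assume n: "\<not> card (nb x \<inter> W) \<ge> 2"
    have "\<not> ?L \<subseteq> insert x (nb x \<inter> W)"
    proof
      assume "?L \<subseteq> insert x (nb x \<inter> W)"
      then have "card ?L \<le> card (insert x (nb x \<inter> W))" using fin by (intro card_mono) auto
      also have "\<dots> \<le> Suc (card (nb x \<inter> W))" using fin by (simp add: card_insert_if)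
      finally show False using three n by simp
    qed
    then obtain y where "y \<in> ?L" "y \<notin> insert x (nb x \<inter> W)" by blast
    then have y: "y \<in> ?L" "y \<noteq> x" "\<not> E x y" by auto
    then have "card ((nb x \<union> nb y) \<inter> W) \<ge> 4" using un[of x y] x n by auto
    moreover have "card ((nb x \<union> nb y) \<inter> W) \<le> card (nb x \<inter> W) + card (nb y \<inter> W)"
      unfolding Int_Un_distrib2 by (rule card_Un_le)
    ultimately show False using y n by auto
  qed
  have ET: "\<exists>p q r. end_triangle W p q r \<and> z \<noteq> p \<and> z \<noteq> q" if z: "z \<in> W" for z
    by (rule end_triangle_exists[OF fin free z]) (use deg un in blast)+
  have "W \<noteq> {}" using c by auto
  then obtain z where z: "z \<in> W" by auto
  obtain p1 p2 p3 where T1: "end_triangle W p1 p2 p3" using ET[OF z] by blast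
  have p: "p1 \<in> W" "p2 \<in> W" "p3 \<in> W" "E p1 p2" "E p2 p3" "E p3 p1" "nb p1 \<inter> W = {p2, p3}" "nb p2 \<inter> W = {p1, p3}"
    using T1 by (auto simp: end_triangle_def)
  have pn: "p1 \<noteq> p2" "p2 \<noteq> p3" "p3 \<noteq> p1" using p irrefl by auto
  have "\<exists>q1 q2 q3. end_triangle W q1 q2 q3 \<and> {p1, p2, p3} \<inter> {q1, q2, q3} = {}"
  proof (cases "nb p3 \<inter> W = {p1, p2}")
    case True
    have "\<not> W \<subseteq> {p1, p2, p3}"
    proof
      assume "W \<subseteq> {p1, p2, p3}"
      then have "card W \<le> card {p1, p2, p3}" by (intro card_mono) auto
      then show False using c pn by simp
    qed
    let ?W = "W - {p1, p2, p3}"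
    obtain z' where z': "z' \<in> ?W" using \<open>\<not> W \<subseteq> {p1, p2, p3}\<close> by auto
    have same: "nb x \<inter> ?W = nb x \<inter> W" if "x \<in> ?W" for x
    proof -
      have "x \<notin> nb p1" "x \<notin> nb p2" "x \<notin> nb p3" using that p(7,8) True by blast+
      then have "\<not> E x p1" "\<not> E x p2" "\<not> E x p3" using sym by auto
      then show ?thesis by auto
    qed
    have finW: "finite ?W" "ccfree ?W" using fin free ccfree_mono[of W ?W] by auto
    obtain q1 q2 q3 where T2: "end_triangle ?W q1 q2 q3"
    proof (rule end_triangle_exists[OF finW z'])
      show "2 \<le> card (nb x \<inter> ?W)" if "x \<in> ?W" for x using deg[of x] same[OF that] that by auto
      show "4 \<le> card ((nb u \<union> nb v) \<inter> ?W)" if "u \<in> ?W" "v \<in> ?W" "u \<noteq> v" "\<not> E u v" "card (nb u \<inter> ?W) \<le> 2" "card (nb v \<inter> ?W) \<le> 2" for u v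
        using un[of u v] same[of u] same[of v] that by (simp add: Int_Un_distrib2)
    qed metis
    then have "q1 \<in> ?W" "q2 \<in> ?W" by (auto simp: end_triangle_def)
    then have "end_triangle W q1 q2 q3" using T2 same[of q1] same[of q2] by (simp add: end_triangle_def)
    then show ?thesis using T2 by (auto simp: end_triangle_def)
  next
    case False
    obtain q1 q2 q3 where T2: "end_triangle W q1 q2 q3" "p1 \<noteq> q1" "p1 \<noteq> q2"
      using ET[OF p(1)] by blast
    have q: "q1 \<in> W" "q2 \<in> W" "q3 \<in> W" "E q1 q2" "E q2 q3" "E q3 q1" "nb q1 \<inter> W = {q2, q3}" "nb q2 \<inter> W = {q1, q3}"
      using T2 by (auto simp: end_triangle_def)
    have qn: "q1 \<noteq> q2" "q2 \<noteq> q3" "q3 \<noteq> q1" using q irrefl by auto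
    have p2: "p2 \<noteq> q1" "p2 \<noteq> q2"
    proof -
      show "p2 \<noteq> q1"
      proof
        assume e: "p2 = q1"
        then have "{p1, p3} = {q2, q3}" using p(8) q(7) by simp
        then have "q2 = p3" "q3 = p1" using T2(3) by (auto simp: doubleton_eq_iff)
        then show False using False q(8) e by (simp add: insert_commute)
      qed
      show "p2 \<noteq> q2"
      proof
        assume e: "p2 = q2"
        then have "{p1, p3} = {q1, q3}" using p(8) q(8) by simp
        then have "q1 = p3" "q3 = p1" using T2(2) by (auto simp: doubleton_eq_iff)
        then show False using False q(7) e by (simp add: insert_commute)
      qed
    qed
    have p1q: "\<not> E p1 q1"
    proof
      assume "E p1 q1"
      then have "q1 \<in> nb p1 \<inter> W" using q(1) by simp
      then have "q1 \<in> {p2, p3}" by (simp only: p(7))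
      then have e: "q1 = p3" using p2 by auto
      have "{p1, p2} \<subseteq> nb q1 \<inter> W" using e p(1,2,5,6) sym by simp
      then have "{p1, p2} \<subseteq> {q2, q3}" by (simp only: q(7))
      then have "{q2, q3} = {p1, p2}" using pn by auto
      then show False using False q(7) e by simp
    qed
    \<comment> \<open>\<open>p1\<close> and \<open>q1\<close> are low and nonadjacent, so their
      neighbours \<open>p2\<close>, \<open>p3\<close>, \<open>q2\<close>, \<open>q3\<close> must be
      four different vertices; this yields disjointness.\<close>
    have "card ((nb p1 \<union> nb q1) \<inter> W) \<ge> 4" 
    proof (rule un[OF p(1) q(1) T2(2) p1q])
      show "card (nb p1 \<inter> W) \<le> 2" "card (nb q1 \<inter> W) \<le> 2"
        unfolding p(7) q(7) by (simp_all add: card_insert_if)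
    qed
    moreover have "(nb p1 \<union> nb q1) \<inter> W = {p2, p3, q2, q3}" unfolding Int_Un_distrib2 p(7) q(7) by auto
    ultimately have four: "card {p2, p3, q2, q3} \<ge> 4" by simp
    have "card {x, y, z} \<le> 3" for x y z :: 'a by (simp add: card_insert_if)
    note three = this
    have "{p2, p3, q2, q3} = {p2, q2, q3}" if "p3 = q2" by (simp only: that insert_absorb2)
    then have "p3 \<noteq> q2" using three[of p2 q2 q3] four by force
    moreover have "{p2, p3, q2, q3} = {p2, q2, q3}" if "p3 = q3" unfolding that by blast
    then have "p3 \<noteq> q3" using three[of p2 q2 q3] four by force
    moreover have "{p2, p3, q2, q3} = {p3, q2, q3}" if "p2 = q3" unfolding that by blast
    then have "p2 \<noteq> q3" using three[of p3 q2 q3] four by force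
    moreover have "p3 \<noteq> q1" using p1q sym[OF p(6)] by (intro notI) simp
    moreover have "p1 \<noteq> q3" using p1q q(6) by (intro notI) simp
    ultimately have "{p1, p2, p3} \<inter> {q1, q2, q3} = {}" using T2(2,3) p2 by simp
    then show ?thesis using T2(1) by blast
  qed
  then obtain q1 q2 q3 where "end_triangle W q1 q2 q3" "{p1, p2, p3} \<inter> {q1, q2, q3} = {}" by auto
  then show "\<exists>p1 p2 p3 q1 q2 q3. end_triangle W p1 p2 p3 \<and> end_triangle W q1 q2 q3 \<and> {p1, p2, p3} \<inter> {q1, q2, q3} = {}"
    using T1 by (intro exI conjI)
qed

section \<open>Packings and cliques\<close>

definition packing :: "'a set set \<Rightarrow> 'a set \<Rightarrow> bool" where
  "packing \<F> W \<longleftrightarrow> finite \<F> \<and> pairwise disjnt \<F> \<and> (\<forall>S\<in>\<F>. S \<subseteq> W \<and> ccset S)"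

definition pack :: "nat \<Rightarrow> 'a set \<Rightarrow> bool" where
  "pack k W \<longleftrightarrow> (\<exists>\<F>. packing \<F> W \<and> card \<F> = k)"

lemma packing_disjoint: "packing \<F> W \<Longrightarrow> S \<in> \<F> \<Longrightarrow> T \<in> \<F> \<Longrightarrow> S \<noteq> T \<Longrightarrow> S \<inter> T = {}"
  by (auto simp: packing_def pairwise_def disjnt_def)

lemma pack_0 [simp]: "pack 0 W"
  unfolding pack_def by (intro exI[of _ "{}"]) (simp add: packing_def)

lemma pack_mono: "pack k W \<Longrightarrow> W \<subseteq> W' \<Longrightarrow> pack k W'"
  unfolding pack_def packing_def by blast

lemma ccset_nonempty: "ccset S \<Longrightarrow> S \<noteq> {}"
  using ccset_card_ge4 by fastforce

lemma pack_Un: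
  assumes "pack j X" "pack k Y" "X \<inter> Y = {}"
  shows "pack (j + k) (X \<union> Y)"
proof -
  obtain \<F> \<G> where F: "packing \<F> X" "card \<F> = j" and G: "packing \<G> Y" "card \<G> = k"
    using assms by (auto simp: pack_def)
  have sub: "S \<subseteq> X" "S \<noteq> {}" if "S \<in> \<F>" for S using F that ccset_nonempty by (auto simp: packing_def)
  have subG: "S \<subseteq> Y" if "S \<in> \<G>" for S using G that by (auto simp: packing_def)
  have d: "\<F> \<inter> \<G> = {}" using sub subG assms(3) by blast
  have "packing (\<F> \<union> \<G>) (X \<union> Y)"
    unfolding packing_def pairwise_def disjnt_def
  proof (intro conjI ballI impI)
    show "finite (\<F> \<union> \<G>)" using F G by (auto simp: packing_def)
    show "S \<subseteq> X \<union> Y" "ccset S" if "S \<in> \<F> \<union> \<G>" for S using that F G by (auto simp: packing_def)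
    show "S \<inter> T = {}" if "S \<in> \<F> \<union> \<G>" "T \<in> \<F> \<union> \<G>" "S \<noteq> T" for S T
      using that packing_disjoint[OF F(1), of S T] packing_disjoint[OF G(1), of S T] sub[of S] sub[of T] subG[of S] subG[of T] assms(3)
      by (simp only: Un_iff) blast
  qed
  moreover have "card (\<F> \<union> \<G>) = j + k" using F G d by (auto simp: packing_def card_Un_disjoint)
  ultimately show ?thesis by (auto simp: pack_def)
qed

lemma pack_1: "ccset S \<Longrightarrow> pack 1 S"
  unfolding pack_def by (intro exI[of _ "{S}"]) (simp add: packing_def)

lemma pack_1_iff: "pack 1 W \<longleftrightarrow> \<not> ccfree W"
proof
  assume "pack 1 W"
  then show "\<not> ccfree W" unfolding pack_def packing_def ccfree_def by (auto simp: card_1_singleton_iff)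
next
  assume "\<not> ccfree W"
  then show "pack 1 W" using pack_1 pack_mono by (auto simp: ccfree_def)
qed

lemma pack_Suc:
  assumes "ccset S" "S \<subseteq> W" "pack k (W - S)"
  shows "pack (Suc k) W"
proof -
  have "S \<union> (W - S) = W" using assms by auto
  then show ?thesis using pack_Un[OF pack_1[OF assms(1)] assms(3)] by simp
qed

definition clique :: "'a set \<Rightarrow> bool" where
  "clique K \<longleftrightarrow> (\<forall>x\<in>K. \<forall>y\<in>K. x \<noteq> y \<longrightarrow> E x y)"

lemma cliqueD: "clique K \<Longrightarrow> x \<in> K \<Longrightarrow> y \<in> K \<Longrightarrow> x \<noteq> y \<Longrightarrow> E x y"
  by (simp add: clique_def)

lemma clique_mono: "clique K \<Longrightarrow> K' \<subseteq> K \<Longrightarrow> clique K'"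
  by (auto simp: clique_def)

lemma clique_four:
  assumes "clique K" "card K = 4"
  shows "ccset K"
proof -
  obtain a b c d where K: "K = {a, b, c, d}" "distinct [a, b, c, d]"
    using assms(2) by (auto simp: card_Suc_eq numeral_eq_Suc)
  then show ?thesis using diamond[of b c a d] cliqueD[OF assms(1)] by auto
qed

lemma clique_four_subset:
  assumes "clique K" "finite K" "card K \<ge> 4"
  obtains T where "T \<subseteq> K" "card T = 4" "ccset T"
proof -
  obtain T where "T \<subseteq> K" "card T = 4" using obtain_subset_with_card_n[OF assms(3)] by metis
  then show ?thesis using that clique_four clique_mono[OF assms(1)] by blast
qed

lemma pack_clique:
  assumes "clique K" "finite K"
  shows "pack (card K div 4) K"
  using assms
proof (induction "card K" arbitrary: K rule: less_induct)
  case less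
  show ?case
  proof (cases "card K \<ge> 4")
    case True
    then obtain T where T: "T \<subseteq> K" "card T = 4" "ccset T" using clique_four_subset less.prems by blast
    have c: "card (K - T) = card K - 4" using T less.prems by (simp add: card_Diff_subset finite_subset)
    have "pack (card (K - T) div 4) (K - T)"
      using less.hyps[of "K - T"] less.prems clique_mono[of K "K - T"] c True by auto
    moreover have "card K div 4 = Suc (card (K - T) div 4)" using c True by simp
    ultimately show ?thesis using pack_Suc[OF T(3,1)] by simp
  qed simp
qed

lemma pack_clique_le: "clique K \<Longrightarrow> finite K \<Longrightarrow> k \<le> card K div 4 \<Longrightarrow> pack k K"
proof -
  assume K: "clique K" "finite K" "k \<le> card K div 4"
  then have "4 * k \<le> card K" by linarith
  then obtain T where T: "T \<subseteq> K" "card T = 4 * k" using obtain_subset_with_card_n by metis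
  then have "pack (card T div 4) T" using pack_clique clique_mono[OF K(1)] finite_subset[OF _ K(2)] by blast
  then show "pack k K" using T pack_mono by auto
qed

text \<open>\<open>pack_clique\<close> leaves three vertices over. Here \<open>c\<close>, two
  neighbours and one more clique vertex form a diamond, and \<open>4 * a\<close> vertices of the
  clique remain.\<close>

lemma pack_clique_insert:
  assumes K: "clique K" "finite K" "card K = 4 * a + 3" and c: "c \<notin> K" "card (nb c \<inter> K) \<ge> 2"
  shows "pack (Suc a) (insert c K)"
proof -
  obtain P where P: "P \<subseteq> nb c \<inter> K" "card P = 2" using c by (metis obtain_subset_with_card_n)
  then obtain p q where pq: "P = {p, q}" "p \<noteq> q" by (auto simp: card_Suc_eq numeral_eq_Suc)
  have in': "p \<in> K" "q \<in> K" "E c p" "E c q" using P pq by auto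
  have "\<not> K \<subseteq> P"
  proof
    assume "K \<subseteq> P"
    then have "card K \<le> card P" using pq by (intro card_mono) auto
    then show False using P K by simp
  qed
  then obtain r where r: "r \<in> K" "r \<noteq> p" "r \<noteq> q" using pq by auto
  have "ccset {c, p, q, r}" using diamond[of p q c r] in' r pq c cliqueD[OF K(1)] by auto
  moreover have "pack a (insert c K - {c, p, q, r})"
  proof -
    have e: "insert c K - {c, p, q, r} = K - {p, q, r}" using c by auto
    have "card (K - {p, q, r}) = 4 * a" using in' r pq K by (subst card_Diff_subset) auto
    then show ?thesis unfolding e using pack_clique_le[of "K - {p, q, r}" a] K clique_mono[of K "K - {p, q, r}"] by auto
  qed
  ultimately show ?thesis using in' r by (intro pack_Suc) auto
qed

section \<open>Separations and 2-connectivity\<close>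

lemma connected_on_no_split:
  assumes "connected_on W E" "W = X \<union> Y" "X \<noteq> {}" "Y \<noteq> {}"
  shows "\<exists>x\<in>X. \<exists>y\<in>Y. x = y \<or> E x y"
proof (rule ccontr)
  assume n: "\<not> ?thesis"
  obtain x y where xy: "x \<in> X" "y \<in> Y" using assms by auto
  have "(\<lambda>x y. x \<in> W \<and> y \<in> W \<and> E x y)\<^sup>*\<^sup>* x y" using assms xy by (auto simp: connected_on_def)
  then have "y \<in> X"
  proof (induction rule: rtranclp_induct)
    case base show ?case by (rule xy)
  next
    case (step y z)
    then show ?case using n assms(2) by blast
  qed
  then show False using n xy by blast
qed

lemma not_connected_split:
  assumes "\<not> connected_on W E"
  obtains X Y where "W = X \<union> Y" "X \<inter> Y = {}" "X \<noteq> {}" "Y \<noteq> {}" "\<And>x y. x \<in> X \<Longrightarrow> y \<in> Y \<Longrightarrow> \<not> E x y"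
proof -
  let ?R = "(\<lambda>x y. x \<in> W \<and> y \<in> W \<and> E x y)\<^sup>*\<^sup>*"
  obtain u v where uv: "u \<in> W" "v \<in> W" "\<not> ?R u v" using assms by (auto simp: connected_on_def)
  let ?X = "{x \<in> W. ?R u x}" and ?Y = "{x \<in> W. \<not> ?R u x}"
  show ?thesis
  proof (rule that[of ?X ?Y])
    show "?X \<noteq> {}" using uv by auto
    show "\<not> E x y" if xy: "x \<in> ?X" "y \<in> ?Y" for x y
    proof
      assume "E x y"
      then have "x \<in> W \<and> y \<in> W \<and> E x y" "?R u x" using xy by auto
      then have "?R u y" by (rule rtranclp.rtrancl_into_rtrancl[rotated])
      then show False using xy by auto
    qed
  qed (use uv in auto)
qed

text \<open>If \<open>W\<close> itself is disconnected, a side with at least two vertices gives up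
  one of them as \<open>x\<close>. Thus both ways of failing 2-connectivity take the shape of a cut
  vertex.\<close>

lemma not_two_connected_split:
  assumes "\<not> two_connected W E" "card W \<ge> 4"
  obtains X Y x where "W = insert x (X \<union> Y)" "x \<notin> X" "x \<notin> Y" "X \<inter> Y = {}" "X \<noteq> {}" "Y \<noteq> {}"
    "\<And>u v. u \<in> X \<Longrightarrow> v \<in> Y \<Longrightarrow> \<not> E u v"
proof (cases "\<exists>x\<in>W. \<not> connected_on (W - {x}) E")
  case True
  then obtain x where x: "x \<in> W" "\<not> connected_on (W - {x}) E" by auto
  obtain X Y where XY: "W - {x} = X \<union> Y" "X \<inter> Y = {}" "X \<noteq> {}" "Y \<noteq> {}" "\<And>x y. x \<in> X \<Longrightarrow> y \<in> Y \<Longrightarrow> \<not> E x y"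
    using not_connected_split[OF x(2)] by metis
  show ?thesis by (rule that[of x X Y]) (use x XY in blast)+
next
  case False
  note goal = that
  have "\<not> connected_on W E" using False assms by (auto simp: two_connected_def)
  then obtain X Y where XY: "W = X \<union> Y" "X \<inter> Y = {}" "X \<noteq> {}" "Y \<noteq> {}" "\<And>x y. x \<in> X \<Longrightarrow> y \<in> Y \<Longrightarrow> \<not> E x y"
    using not_connected_split by metis
  have *: thesis if XY: "W = X \<union> Y" "X \<inter> Y = {}" "Y \<noteq> {}" "\<And>x y. x \<in> X \<Longrightarrow> y \<in> Y \<Longrightarrow> \<not> E x y" and two: "card X \<ge> 2" for X Y
  proof -
    obtain x where x: "x \<in> X" using two by fastforce
    have ne: "X - {x} \<noteq> {}"
    proof
      assume "X - {x} = {}"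
      then have "card X \<le> card {x}" by (intro card_mono) auto
      then show False using two by simp
    qed
    show thesis by (rule goal[of x "X - {x}" Y]) (use x ne XY in blast)+
  qed
  have "finite X" "finite Y" using assms(2) XY(1) by (metis card.infinite finite_Un not_numeral_le_zero)+
  then have "card W = card X + card Y" using XY by (simp add: card_Un_disjoint)
  then consider "card X \<ge> 2" | "card Y \<ge> 2" using assms(2) by linarith
  then show ?thesis
  proof cases
    case 1 show ?thesis by (rule *[OF XY(1,2,4,5) 1])
  next
    case 2 show ?thesis by (rule *[of Y X]) (use XY 2 sym in blast)+
  qed
qed

text \<open>Given a cross edge \<open>x y\<close>, connectedness without \<open>x\<close> gives one
  that avoids \<open>x\<close>, and connectedness without \<open>y\<close> gives one that avoids
  \<open>y\<close>. Among these three edges two are disjoint.\<close>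

lemma two_disjoint_cross_edges:
  assumes "two_connected W E" "W = X \<union> Y" "X \<inter> Y = {}" "card X \<ge> 2" "card Y \<ge> 2"
  obtains x y x' y' where "x \<in> X" "x' \<in> X" "y \<in> Y" "y' \<in> Y" "x \<noteq> x'" "y \<noteq> y'" "E x y" "E x' y'"
proof -
  have minus: "A - {a} \<noteq> {}" if "card A \<ge> 2" for A :: "'a set" and a
  proof
    assume "A - {a} = {}"
    then have "card A \<le> card {a}" by (intro card_mono) auto
    then show False using that by simp
  qed
  have con: "connected_on W E" "\<And>x. x \<in> W \<Longrightarrow> connected_on (W - {x}) E" using assms by (auto simp: two_connected_def)
  have ne: "X \<noteq> {}" "Y \<noteq> {}" using assms by auto
  obtain x y where xy: "x \<in> X" "y \<in> Y" "E x y" using connected_on_no_split[OF con(1) assms(2) ne] assms(3) by blast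
  have "W - {x} = (X - {x}) \<union> Y" using assms xy by auto
  then obtain x2 y2 where xy2: "x2 \<in> X" "x2 \<noteq> x" "y2 \<in> Y" "E x2 y2"
    using connected_on_no_split[OF con(2)[of x], of "X - {x}" Y] assms(2,3) xy ne minus[OF assms(4)] by blast
  have "W - {y} = X \<union> (Y - {y})" using assms xy by auto
  then obtain x3 y3 where xy3: "x3 \<in> X" "y3 \<noteq> y" "y3 \<in> Y" "E x3 y3"
    using connected_on_no_split[OF con(2)[of y], of X "Y - {y}"] assms(2,3) xy ne minus[OF assms(5)] by blast
  show ?thesis
  proof (cases "y2 = y")
    case False
    then show ?thesis using that xy xy2 by metis
  next
    case True
    show ?thesis
    proof (cases "x3 = x")
      case True
      then show ?thesis using that[of x2 x y2 y3] xy2 xy3 \<open>y2 = y\<close> by auto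
    next
      case False
      then show ?thesis using that[of x x3 y y3] xy xy3 by auto
    qed
  qed
qed

text \<open>Separately the cliques give \<open>a + b\<close>, with three vertices over in each. Two
  disjoint cross edges join two triangles to the hexagon \<open>x x'' x' y' y'' y\<close> with chord
  \<open>x x'\<close>, and \<open>4 * a\<close> and \<open>4 * b\<close> vertices remain.\<close>

lemma pack_two_cliques:
  assumes K: "clique X" "clique Y" "X \<inter> Y = {}" "card X = 4 * a + 3" "card Y = 4 * b + 3"
    and two: "two_connected (X \<union> Y) E"
  shows "pack (a + b + 1) (X \<union> Y)"
proof -
  have fin: "finite X" "finite Y" using K by (metis card.infinite add_is_0 zero_neq_numeral)+
  obtain x y x' y' where xy: "x \<in> X" "x' \<in> X" "y \<in> Y" "y' \<in> Y" "x \<noteq> x'" "y \<noteq> y'" "E x y" "E x' y'"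
  proof -
    have "card X \<ge> 2" "card Y \<ge> 2" using K by simp_all
    from two_disjoint_cross_edges[OF two refl K(3) this] show ?thesis using that by metis
  qed
  have third: "\<exists>z\<in>A. z \<noteq> p \<and> z \<noteq> q" if "card A \<ge> 3" for A :: "'a set" and p q
  proof (rule ccontr)
    assume "\<not> ?thesis"
    then have "A \<subseteq> {p, q}" by auto
    then have "card A \<le> card {p, q}" by (intro card_mono) auto
    also have "\<dots> \<le> 2" by (simp add: card_insert_if)
    finally show False using that by simp
  qed
  obtain x'' where x'': "x'' \<in> X" "x'' \<noteq> x" "x'' \<noteq> x'" using third[of X x x'] K by auto
  obtain y'' where y'': "y'' \<in> Y" "y'' \<noteq> y" "y'' \<noteq> y'" using third[of Y y y'] K by auto
  let ?S = "{x, x', x'', y, y', y''}"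
  have d: "distinct [x, x', x'', y, y', y'']" using xy x'' y'' K(3) by auto
  have "fan x [x'', x', y', y'', y]"
    unfolding fan_def using d xy x'' y'' cliqueD[OF K(1)] cliqueD[OF K(2)] sym by auto
  then have cc: "ccset ?S" by (rule fan_ccset') auto
  have "(X \<union> Y) - ?S = (X - {x, x', x''}) \<union> (Y - {y, y', y''})" using xy x'' y'' K(3) by auto
  moreover have "pack (a + b) ((X - {x, x', x''}) \<union> (Y - {y, y', y''}))"
  proof (rule pack_Un)
    have "card (X - {x, x', x''}) = 4 * a" using xy x'' K fin d by (subst card_Diff_subset) auto
    then show "pack a (X - {x, x', x''})"
      using pack_clique_le[of "X - {x, x', x''}" a] fin clique_mono[OF K(1), of "X - {x, x', x''}"] by auto
    have "card (Y - {y, y', y''}) = 4 * b" using xy y'' K fin d by (subst card_Diff_subset) auto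
    then show "pack b (Y - {y, y', y''})"
      using pack_clique_le[of "Y - {y, y', y''}" b] fin clique_mono[OF K(2), of "Y - {y, y', y''}"] by auto
    show "(X - {x, x', x''}) \<inter> (Y - {y, y', y''}) = {}" using K(3) by auto
  qed
  ultimately have "pack (Suc (a + b)) (X \<union> Y)"
    using pack_Suc[OF cc, of "X \<union> Y"] xy x'' y'' by auto
  then show ?thesis by simp
qed

lemma pack_le: "pack k W \<Longrightarrow> j \<le> k \<Longrightarrow> pack j W"
proof -
  assume "pack k W" "j \<le> k"
  then obtain \<F> where F: "packing \<F> W" "card \<F> = k" by (auto simp: pack_def)
  then obtain \<G> where G: "\<G> \<subseteq> \<F>" "card \<G> = j" using obtain_subset_with_card_n[of j \<F>] \<open>j \<le> k\<close> by metis
  then have "packing \<G> W" using F unfolding packing_def by (auto intro: finite_subset pairwise_mono)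
  then show ?thesis using G by (auto simp: pack_def)
qed

section \<open>The neighbourhood condition and the exceptional graphs\<close>

text \<open>The degree hypothesis in a form that passes to induced subgraphs. It holds vacuously on
  a clique and so covers both alternatives of the theorem.\<close>

definition union_cond :: "'a set \<Rightarrow> nat \<Rightarrow> bool" where
  "union_cond W k \<longleftrightarrow> (\<forall>x\<in>W. \<forall>y\<in>W. x \<noteq> y \<longrightarrow> \<not> E x y \<longrightarrow> k \<le> card ((nb x \<union> nb y) \<inter> W))"

lemma union_condD: "union_cond W k \<Longrightarrow> x \<in> W \<Longrightarrow> y \<in> W \<Longrightarrow> x \<noteq> y \<Longrightarrow> \<not> E x y \<Longrightarrow> k \<le> card ((nb x \<union> nb y) \<inter> W)"
  by (simp add: union_cond_def)

lemma union_cond_Diff: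
  assumes fin: "finite W" "finite C" and c: "union_cond W k"
    and loss: "\<And>x y. x \<in> W - C \<Longrightarrow> y \<in> W - C \<Longrightarrow> x \<noteq> y \<Longrightarrow> \<not> E x y \<Longrightarrow> card ((nb x \<union> nb y) \<inter> C) \<le> m"
  shows "union_cond (W - C) (k - m)"
  unfolding union_cond_def
proof (intro ballI impI)
  fix x y assume xy: "x \<in> W - C" "y \<in> W - C" "x \<noteq> y" "\<not> E x y"
  let ?N = "nb x \<union> nb y"
  have "?N \<inter> W \<subseteq> (?N \<inter> (W - C)) \<union> (?N \<inter> C)" by auto
  then have "card (?N \<inter> W) \<le> card ((?N \<inter> (W - C)) \<union> (?N \<inter> C))" using fin by (intro card_mono) auto
  also have "\<dots> \<le> card (?N \<inter> (W - C)) + card (?N \<inter> C)" by (rule card_Un_le)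
  finally have "card (?N \<inter> W) \<le> card (?N \<inter> (W - C)) + card (?N \<inter> C)" .
  moreover have "k \<le> card (?N \<inter> W)" using union_condD[OF c, of x y] xy by blast
  moreover have "card (?N \<inter> C) \<le> m" using loss[OF xy] .
  ultimately show "k - m \<le> card (?N \<inter> (W - C))" by linarith
qed

lemma union_cond_Diff_card:
  assumes "finite W" "finite C" "union_cond W k"
  shows "union_cond (W - C) (k - card C)"
  using assms by (intro union_cond_Diff) (auto intro: card_mono)

lemma union_cond_nonadjacent_card:
  assumes "finite W" "union_cond W k" "x \<in> W" "y \<in> W" "x \<noteq> y" "\<not> E x y"
  shows "k + 2 \<le> card W"
proof -
  have "(nb x \<union> nb y) \<inter> W \<subseteq> W - {x, y}" using irrefl assms sym by auto
  then have "card ((nb x \<union> nb y) \<inter> W) \<le> card (W - {x, y})" using assms by (intro card_mono) auto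
  moreover have "card (W - {x, y}) = card W - 2" using assms by (subst card_Diff_subset) auto
  moreover have "card {x, y} \<le> card W" using assms by (intro card_mono) auto
  moreover have "card {x, y} = 2" using assms by simp
  moreover have "k \<le> card ((nb x \<union> nb y) \<inter> W)" using union_condD[OF assms(2-6)] .
  ultimately show ?thesis by linarith
qed

text \<open>The neighbours of \<open>x\<close> and \<open>y\<close> avoid these two, so with
  \<open>k + 2\<close> vertices they must be all the others. In other words, the complement is
  triangle-free.\<close>

lemma union_cond_dominating:
  assumes "finite W" "union_cond W k" "card W = k + 2" "x \<in> W" "y \<in> W" "x \<noteq> y" "\<not> E x y" "z \<in> W" "z \<noteq> x" "z \<noteq> y"
  shows "E x z \<or> E y z"
proof (rule ccontr)
  assume n: "\<not> ?thesis"
  have "(nb x \<union> nb y) \<inter> W \<subseteq> W - {x, y, z}" using irrefl assms sym n by auto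
  then have "card ((nb x \<union> nb y) \<inter> W) \<le> card (W - {x, y, z})" using assms(1) by (intro card_mono) auto
  moreover have "card (W - {x, y, z}) = card W - 3" using assms by (subst card_Diff_subset) auto
  moreover have "k \<le> card ((nb x \<union> nb y) \<inter> W)" using union_condD[OF assms(2,4-7)] .
  moreover have "card {x, y, z} \<le> card W" using assms by (intro card_mono) auto
  moreover have "card {x, y, z} = 3" using assms by simp
  ultimately show False using assms(3) by linarith
qed

text \<open>Two vertices of one side and one of the other do not form a triangle in the complement,
  so each side is a clique. For the same reason the cut vertex is complete to one of the sides,
  which it joins.\<close>

lemma not_two_connected_cliques:
  assumes fin: "finite W" and c: "union_cond W k" "card W = k + 2" and two: "\<not> two_connected W E" "card W \<ge> 4"
  obtains X Y x where "W = X \<union> Y" "X \<inter> Y = {}" "clique X" "clique Y" "x \<in> X" "card X \<ge> 2" "Y \<noteq> {}"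
    "\<And>u v. u \<in> X - {x} \<Longrightarrow> v \<in> Y \<Longrightarrow> \<not> E u v"
proof -
  note goal = that
  obtain X Y x where XY: "W = insert x (X \<union> Y)" "x \<notin> X" "x \<notin> Y" "X \<inter> Y = {}" "X \<noteq> {}" "Y \<noteq> {}"
    "\<And>u v. u \<in> X \<Longrightarrow> v \<in> Y \<Longrightarrow> \<not> E u v"
    using not_two_connected_split[OF two] by metis
  have dom: "E u z \<or> E v z" if "u \<in> W" "v \<in> W" "u \<noteq> v" "\<not> E u v" "z \<in> W" "z \<noteq> u" "z \<noteq> v" for u v z
    using union_cond_dominating[OF fin c that] .
  have cl: "clique A" if A: "A \<subseteq> W" "B \<subseteq> W" "A \<inter> B = {}" "B \<noteq> {}" "\<And>u v. u \<in> A \<Longrightarrow> v \<in> B \<Longrightarrow> \<not> E u v" for A B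
    unfolding clique_def
  proof (intro ballI impI)
    fix a a' assume a: "a \<in> A" "a' \<in> A" "a \<noteq> a'"
    obtain b where b: "b \<in> B" using A by auto
    have "E a a' \<or> E b a'" using dom[of a b a'] a b A by blast
    then show "E a a'" using A(5)[OF a(2) b] sym by blast
  qed
  have cX: "clique X" using cl[of X Y] XY by auto
  have cY: "clique Y" using cl[of Y X] XY sym by blast
  have complete: "(\<forall>u\<in>X. E u x) \<or> (\<forall>v\<in>Y. E v x)"
  proof (rule ccontr)
    assume "\<not> ?thesis"
    then obtain u v where "u \<in> X" "v \<in> Y" "\<not> E u x" "\<not> E v x" by auto
    then show False using dom[of u v x] XY by blast
  qed
  have *: thesis if A: "W = insert x (A \<union> B)" "x \<notin> A" "x \<notin> B" "A \<inter> B = {}" "A \<noteq> {}" "B \<noteq> {}"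
    "\<And>u v. u \<in> A \<Longrightarrow> v \<in> B \<Longrightarrow> \<not> E u v" "clique A" "clique B" "\<forall>u\<in>A. E u x" for A B
  proof -
    have "clique (insert x A)" using A(8,10) sym by (auto simp: clique_def)
    moreover have "card (insert x A) \<ge> 2"
    proof -
      have fA: "finite A" using fin A(1) by auto
      then have "card A > 0" using A(5) by (simp add: card_gt_0_iff)
      then show ?thesis using A(2) fA by simp
    qed
    ultimately show thesis
      using goal[of "insert x A" B x] A by auto
  qed
  from complete show thesis
  proof
    assume "\<forall>u\<in>X. E u x"
    then show thesis using *[of X Y] XY cX cY by blast
  next
    assume "\<forall>v\<in>Y. E v x"
    then show thesis using *[of Y X] XY cX cY sym by blast
  qed
qed

lemma clique_Un:
  assumes "clique X" "clique Y" "\<And>x y. x \<in> X \<Longrightarrow> y \<in> Y \<Longrightarrow> x \<noteq> y \<Longrightarrow> E x y"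
  shows "clique (X \<union> Y)"
  unfolding clique_def using assms cliqueD sym by blast

text \<open>The cliques of the remainder pack \<open>s - 1\<close>, and \<open>C\<close> completes
  them to \<open>s\<close>, unless both sizes are 3 mod 4. If different vertices of \<open>C\<close>
  have two neighbours in different cliques, both cliques gain a cycle by
  \<open>pack_clique_insert\<close>. Otherwise \<open>C\<close> attaches to one clique; as four
  vertices keep the residue 3, the last cycle has to come from cross edges.\<close>

lemma extremal_case:
  assumes fin: "finite W" and s: "s \<ge> 2" and c: "union_cond W (4 * s)" "card W = 4 * s + 2"
    and C: "C \<subseteq> W" "ccset C" "card C = 4" and two: "\<not> two_connected (W - C) E"
  shows "pack s W \<or> \<not> two_connected W E"
proof (rule ccontr)
  assume "\<not> ?thesis"
  then have np: "\<not> pack s W" and tc: "two_connected W E" by auto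
  have fC: "finite C" using C fin finite_subset by auto
  have cC: "card (W - C) = 4 * s - 4 + 2" using C c fC s by (simp add: card_Diff_subset)
  have "union_cond (W - C) (4 * s - 4)" using union_cond_Diff_card[OF fin fC c(1)] C by simp
  then obtain X Y x where XY: "W - C = X \<union> Y" "X \<inter> Y = {}" "clique X" "clique Y" "x \<in> X" "card X \<ge> 2" "Y \<noteq> {}"
    and cross: "\<And>u v. u \<in> X - {x} \<Longrightarrow> v \<in> Y \<Longrightarrow> \<not> E u v"
  proof -
    have "finite (W - C)" "card (W - C) \<ge> 4" using fin cC s by auto
    from not_two_connected_cliques[OF this(1) \<open>union_cond (W - C) (4 * s - 4)\<close> cC two this(2)]
    show ?thesis using that by metis
  qed
  have W: "W = X \<union> Y \<union> C" "X \<inter> C = {}" "Y \<inter> C = {}" using XY C by auto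
  have fX: "finite X" and fY: "finite Y" using W fin by auto
  have sum: "card X + card Y = 4 * s - 2" using cC XY fX fY s by (simp add: card_Un_disjoint)
  have dom: "E u z \<or> E v z" if "u \<in> W" "v \<in> W" "u \<noteq> v" "\<not> E u v" "z \<in> W" "z \<noteq> u" "z \<noteq> v" for u v z
    using union_cond_dominating[OF fin c that] .
  \<comment> \<open>The sizes add up to 2 mod 4, so the residues add up to 2 or 6, and only 6 costs
    a cycle.\<close>
  have "card X mod 4 = 3 \<and> card Y mod 4 = 3"
  proof (rule ccontr)
    assume "\<not> ?thesis"
    then have "card X mod 4 + card Y mod 4 \<le> 5"
      using mod_less_divisor[of 4 "card X"] mod_less_divisor[of 4 "card Y"] by linarith
    moreover have "card X = 4 * (card X div 4) + card X mod 4" "card Y = 4 * (card Y div 4) + card Y mod 4" by simp_all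
    ultimately have "s - 1 \<le> card X div 4 + card Y div 4" using sum s by linarith
    moreover have "pack (card X div 4 + card Y div 4) (X \<union> Y)"
      using pack_Un[OF pack_clique[OF XY(3) fX] pack_clique[OF XY(4) fY] XY(2)] .
    ultimately have "pack (s - 1) (W - C)" using pack_le XY(1) by simp
    from pack_Suc[OF C(2,1) this] show False using np s by simp
  qed
  then have "card X = 4 * (card X div 4) + 3" "card Y = 4 * (card Y div 4) + 3" 
    using mult_div_mod_eq[of 4 "card X"] mult_div_mod_eq[of 4 "card Y"] by simp_all
  then obtain a b where ab: "card X = 4 * a + 3" "card Y = 4 * b + 3" by blast
  have s': "s = a + b + 2" using sum ab s by linarith
  define P where "P c \<longleftrightarrow> card (nb c \<inter> X) \<ge> 2" for c
  define Q where "Q c \<longleftrightarrow> card (nb c \<inter> Y) \<ge> 2" for c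
  have PQ: False if "c \<in> C" "c' \<in> C" "c \<noteq> c'" "P c" "Q c'" for c c'
  proof -
    have "pack (Suc a) (insert c X)" using pack_clique_insert[OF XY(3) fX ab(1)] that W by (auto simp: P_def)
    moreover have "pack (Suc b) (insert c' Y)" using pack_clique_insert[OF XY(4) fY ab(2)] that W by (auto simp: Q_def)
    moreover have "insert c X \<inter> insert c' Y = {}" using that W XY by auto
    ultimately have "pack (Suc a + Suc b) (insert c X \<union> insert c' Y)" by (rule pack_Un)
    then have "pack s (insert c X \<union> insert c' Y)" using s' by simp
    moreover have "insert c X \<union> insert c' Y \<subseteq> W" using that W by auto
    ultimately show False using np pack_mono by blast
  qed
  have cX: "card (X - {x}) \<ge> 2" using XY ab fX by simp
  \<comment> \<open>Cross edges between the cliques meet \<open>x\<close>, so \<open>u\<close> and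
    \<open>v\<close> are nonadjacent and \<open>c\<close> is adjacent to one of them.\<close>
  have full: "(\<forall>u\<in>X - {x}. E c u) \<or> (\<forall>v\<in>Y. E c v)" if c: "c \<in> C" for c
  proof (rule ccontr)
    assume "\<not> ?thesis"
    then obtain u v where uv: "u \<in> X - {x}" "v \<in> Y" "\<not> E c u" "\<not> E c v" by auto
    then have "E u c \<or> E v c" using dom[of u v c] cross[OF uv(1,2)] W XY c by blast
    then show False using uv sym by blast
  qed
  have fullP: "P c" if "\<forall>u\<in>X - {x}. E c u" for c
  proof -
    have "card (X - {x}) \<le> card (nb c \<inter> X)" using that fX by (intro card_mono) auto
    then show ?thesis using cX by (simp add: P_def)
  qed
  have fullQ: "Q c" if "\<forall>v\<in>Y. E c v" for c
  proof -
    have "card Y \<le> card (nb c \<inter> Y)" using that fY by (intro card_mono) auto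
    then show ?thesis using ab by (simp add: Q_def)
  qed
  have PorQ: "P c \<or> Q c" if "c \<in> C" for c using full[OF that] fullP fullQ by blast
  have other: "\<exists>c'\<in>C. c' \<noteq> c" for c
  proof (rule ccontr)
    assume "\<not> ?thesis"
    then have "card C \<le> card {c}" by (intro card_mono) auto
    then show False using C by simp
  qed
  have small: "card Z \<le> 2" if "card (nb c \<inter> Z) \<le> 1" "card (nb c' \<inter> Z) \<le> 1" "Z \<subseteq> nb c \<union> nb c'" for c c' and Z :: "'a set"
  proof -
    have "card Z = card ((nb c \<inter> Z) \<union> (nb c' \<inter> Z))" using that by (intro arg_cong[of _ _ card]) auto
    also have "\<dots> \<le> card (nb c \<inter> Z) + card (nb c' \<inter> Z)" by (rule card_Un_le)
    finally show ?thesis using that by linarith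
  qed
  \<comment> \<open>Two nonadjacent vertices of \<open>C\<close> would dominate \<open>Z\<close>,
    but with one neighbour each they reach at most two of its vertices.\<close>
  have cl: "clique C" if Z: "Z \<subseteq> W" "Z \<inter> C = {}" "card Z \<ge> 3" "\<And>c. c \<in> C \<Longrightarrow> card (nb c \<inter> Z) \<le> 1" for Z
    unfolding clique_def
  proof (intro ballI impI, rule ccontr)
    fix c c' assume cc: "c \<in> C" "c' \<in> C" "c \<noteq> c'" "\<not> E c c'"
    have "Z \<subseteq> nb c \<union> nb c'"
    proof
      fix z assume "z \<in> Z"
      then have "z \<in> W" "z \<noteq> c" "z \<noteq> c'" using Z(1,2) cc by blast+
      then show "z \<in> nb c \<union> nb c'" using dom[of c c' z] cc C(1) by auto
    qed
    then show False using small[of c Z c'] Z cc by fastforce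
  qed
  have "(\<forall>c\<in>C. \<not> Q c) \<or> (\<forall>c\<in>C. \<not> P c)" using PQ PorQ other by metis
  then show False
  proof
    assume nQ: "\<forall>c\<in>C. \<not> Q c"
    then have lessQ: "card (nb c \<inter> Y) \<le> 1" if "c \<in> C" for c using that by (auto simp: Q_def)
    have fX': "\<forall>u\<in>X - {x}. E c u" if "c \<in> C" for c using full[OF that] fullQ nQ that by blast
    have cC': "clique C" using cl[of Y] W ab lessQ by auto
    show False
    proof (cases "\<forall>c\<in>C. E x c")
      case True
      have "clique (X \<union> C)" using clique_Un[OF XY(3) cC'] fX' True sym by blast
      moreover have "card (X \<union> C) = 4 * (a + 1) + 3" using W fX fC C ab by (simp add: card_Un_disjoint)
      moreover have "(X \<union> C) \<union> Y = W" "(X \<union> C) \<inter> Y = {}" using W XY by auto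
      ultimately have "pack (a + 1 + b + 1) W" using pack_two_cliques[of "X \<union> C" Y "a + 1" b] XY ab tc by simp
      then show False using np s' by simp
    next
      case False
      then obtain c where cx: "c \<in> C" "\<not> E x c" by auto
      \<comment> \<open>Here \<open>x\<close> changes sides. Since \<open>c\<close> has at most one
        neighbour in \<open>Y\<close>, domination gives \<open>x\<close> at least two there, so
        \<open>Y\<close> with \<open>x\<close> packs \<open>b + 1\<close>. The clique
        \<open>(X - {x}) \<union> C\<close> keeps \<open>4 * a + 6\<close> vertices, enough for
        \<open>a + 1\<close>.\<close>
      have "Y \<subseteq> nb x \<union> nb c"
      proof
        fix z assume "z \<in> Y"
        moreover have "x \<in> W" "c \<in> W" "x \<noteq> c" using W XY(5) cx(1) by blast+
        moreover have "z \<in> W" "z \<noteq> x" "z \<noteq> c" using calculation W XY(2,5) cx(1) by blast+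
        ultimately show "z \<in> nb x \<union> nb c" using dom[of x c z] cx(2) by auto
      qed
      then have "card (nb x \<inter> Y) \<ge> 2" using small[of x Y c] lessQ[OF cx(1)] ab by fastforce
      then have "pack (Suc b) (insert x Y)" using pack_clique_insert[OF XY(4) fY ab(2)] XY by auto
      moreover have "clique ((X - {x}) \<union> C)"
        using clique_Un[OF clique_mono[OF XY(3), of "X - {x}"] cC'] fX' sym by blast
      moreover have "card ((X - {x}) \<union> C) = 4 * a + 6"
        using W(2) fX fC C ab XY(5) by (subst card_Un_disjoint) auto
      moreover have "finite ((X - {x}) \<union> C)" using fX fC by simp
      ultimately have "pack (Suc b) (insert x Y)" "pack (Suc a) ((X - {x}) \<union> C)"
        using pack_clique_le[of "(X - {x}) \<union> C" "Suc a"] by simp_all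
      moreover have "insert x Y \<inter> ((X - {x}) \<union> C) = {}" using W XY(2,5) by blast
      ultimately have "pack (Suc b + Suc a) (insert x Y \<union> ((X - {x}) \<union> C))" by (rule pack_Un)
      moreover have "insert x Y \<union> ((X - {x}) \<union> C) = W" using W XY(5) by auto
      ultimately show False using np s' by (simp add: add.commute)
    qed
  next
    assume nP: "\<forall>c\<in>C. \<not> P c"
    then have lessP: "card (nb c \<inter> X) \<le> 1" if "c \<in> C" for c using that by (auto simp: P_def)
    have fY': "\<forall>u\<in>Y. E c u" if "c \<in> C" for c using full[OF that] fullP nP that by blast
    have cC': "clique C" using cl[of X] W ab lessP by auto
    \<comment> \<open>On this side there is no distinguished vertex: \<open>full\<close> gives
      adjacency to all of \<open>Y\<close>.\<close>
    have "clique (Y \<union> C)" using clique_Un[OF XY(4) cC'] fY' sym by blast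
    moreover have "card (Y \<union> C) = 4 * (b + 1) + 3" using W fY fC C ab by (simp add: card_Un_disjoint)
    moreover have "X \<union> (Y \<union> C) = W" "X \<inter> (Y \<union> C) = {}" using W XY by auto
    ultimately have "pack (a + (b + 1) + 1) W" using pack_two_cliques[of X "Y \<union> C" a "b + 1"] XY ab tc by simp
    then show False using np s' by simp
  qed
qed

section \<open>Graphs whose chorded cycles have at least six vertices\<close>

definition min_family :: "'a set \<Rightarrow> nat \<Rightarrow> 'a set set \<Rightarrow> bool" where
  "min_family W k \<F> \<longleftrightarrow> packing \<F> W \<and> card \<F> = k \<and>
     (\<forall>\<G>. packing \<G> W \<longrightarrow> card \<G> = k \<longrightarrow> card (\<Union>\<F>) \<le> card (\<Union>\<G>))"

lemma packing_exchange:
  assumes fin: "finite W" and F: "packing \<F> W" and C: "C \<in> \<F>" and S: "ccset S" "S \<subseteq> C \<union> (W - \<Union>\<F>)"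
  defines "\<G> \<equiv> insert S (\<F> - {C})"
  shows "packing \<G> W" "card \<G> = card \<F>" "card (\<Union>\<G>) + card C = card (\<Union>\<F>) + card S"
    "W - \<Union>\<G> = (C \<union> (W - \<Union>\<F>)) - S"
proof -
  have fF: "finite \<F>" and sub: "\<And>T. T \<in> \<F> \<Longrightarrow> T \<subseteq> W \<and> ccset T" using F by (auto simp: packing_def)
  have CW: "C \<subseteq> W" using sub C by auto
  have dC: "C \<inter> T = {}" if "T \<in> \<F> - {C}" for T using packing_disjoint[OF F C, of T] that by auto
  have dS: "S \<inter> T = {}" if "T \<in> \<F> - {C}" for T using dC[OF that] S(2) that by blast
  have SW: "S \<subseteq> W" using S CW by auto
  have nS: "S \<notin> \<F> - {C}" using dS[of S] ccset_nonempty[OF S(1)] by auto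
  show "packing \<G> W"
    unfolding packing_def pairwise_def disjnt_def \<G>_def
  proof (intro conjI ballI impI)
    show "finite (insert S (\<F> - {C}))" using fF by simp
    show "T \<subseteq> W" "ccset T" if "T \<in> insert S (\<F> - {C})" for T using that sub SW S(1) by auto
    show "T \<inter> T' = {}" if TT: "T \<in> insert S (\<F> - {C})" "T' \<in> insert S (\<F> - {C})" "T \<noteq> T'" for T T'
    proof -
      consider "T = S" "T' \<in> \<F> - {C}" | "T' = S" "T \<in> \<F> - {C}" | "T \<in> \<F>" "T' \<in> \<F>" using TT by blast
      then show ?thesis
      proof cases
        case 1 then show ?thesis using dS by blast
      next
        case 2 then show ?thesis using dS by blast
      next
        case 3 then show ?thesis using packing_disjoint[OF F 3 TT(3)] by simp
      qed
    qed
  qed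
  show "card \<G> = card \<F>" unfolding \<G>_def using nS fF C
    by (metis card_Suc_Diff1 card_insert_disjoint finite_Diff)
  have U: "\<Union>\<F> = C \<union> \<Union>(\<F> - {C})" using C by auto
  have dCU: "C \<inter> \<Union>(\<F> - {C}) = {}" using dC by auto
  have dSU: "S \<inter> \<Union>(\<F> - {C}) = {}" using dS by auto
  have UW: "\<Union>(\<F> - {C}) \<subseteq> W" using sub by blast
  have fin': "finite C" "finite S" "finite (\<Union>(\<F> - {C}))"
    using finite_subset[OF CW fin] finite_subset[OF SW fin] finite_subset[OF UW fin] by auto
  show "card (\<Union>\<G>) + card C = card (\<Union>\<F>) + card S"
    unfolding \<G>_def U using fin' dCU dSU by (simp add: card_Un_disjoint)
  show "W - \<Union>\<G> = (C \<union> (W - \<Union>\<F>)) - S"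
    unfolding \<G>_def U using CW dCU by auto
qed

text \<open>The exchange touches only \<open>C\<close> and the remainder, so minimality of the total
  is minimality of \<open>C\<close> there. This supplies the minimality assumption of the lemmas on
  outside neighbours.\<close>

lemma min_family_local:
  assumes fin: "finite W" and F: "min_family W k \<F>" and C: "C \<in> \<F>" and S: "ccset S" "S \<subseteq> C \<union> (W - \<Union>\<F>)"
  shows "card C \<le> card S"
proof -
  have p: "packing \<F> W" "card \<F> = k" using F by (auto simp: min_family_def)
  note x = packing_exchange[OF fin p(1) C S]
  have "card (\<Union>\<F>) \<le> card (\<Union>(insert S (\<F> - {C})))" using F x(1,2) p(2) by (auto simp: min_family_def)
  then show ?thesis using x(3) by linarith
qed

lemma min_family_exchange:
  assumes fin: "finite W" and F: "min_family W k \<F>" and C: "C \<in> \<F>" and S: "ccset S" "S \<subseteq> C \<union> (W - \<Union>\<F>)" "card S = card C"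
  shows "min_family W k (insert S (\<F> - {C}))" "card (\<Union>(insert S (\<F> - {C}))) = card (\<Union>\<F>)"
    "W - \<Union>(insert S (\<F> - {C})) = (C \<union> (W - \<Union>\<F>)) - S"
proof -
  have p: "packing \<F> W" "card \<F> = k" using F by (auto simp: min_family_def)
  note x = packing_exchange[OF fin p(1) C S(1,2)]
  show c: "card (\<Union>(insert S (\<F> - {C}))) = card (\<Union>\<F>)" using x(3) S(3) by simp
  show "min_family W k (insert S (\<F> - {C}))" unfolding min_family_def c
    using x(1,2) F by (auto simp: min_family_def)
  show "W - \<Union>(insert S (\<F> - {C})) = (C \<union> (W - \<Union>\<F>)) - S" by (rule x(4))
qed

text \<open>An exchange of equal size keeps the family minimal and puts \<open>w\<close> into its
  remainder, where \<open>few_neighbours_long\<close> applies. Bounds for vertices of the remainder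
  thus extend to vertices of \<open>C\<close> that can be swapped out.\<close>

lemma evicted_few_neighbours:
  assumes fin: "finite W" and F: "min_family W k \<F>" and C: "C \<in> \<F>" and S: "ccset S" "S \<subseteq> C \<union> (W - \<Union>\<F>)" "card S = card C"
    and w: "w \<in> C - S" and D: "D \<in> \<F> - {C}" "card D \<ge> 7"
  shows "card (nb w \<inter> D) \<le> 2"
proof -
  note x = min_family_exchange[OF fin F C S]
  let ?G = "insert S (\<F> - {C})"
  have D': "D \<in> ?G" using D by auto
  have cD: "ccset D" using F D by (auto simp: min_family_def packing_def)
  have wH: "w \<in> W - \<Union>?G" using x(3) w by auto
  have "w \<notin> D" using wH D' by auto
  then show ?thesis
    using few_neighbours_long[OF cD D(2), of w] min_family_local[OF fin x(1) D'] wH by blast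
qed

text \<open>\<open>x\<close> and \<open>y\<close> are consecutive on a 4-cycle. If \<open>z\<close>
  is on it, one of the edges to \<open>z\<close> is a diagonal; if not, \<open>x y' x' y z\<close>
  is a cycle on five vertices with chord \<open>x y\<close>.\<close>

lemma square_common_neighbour:
  assumes short: "\<forall>T. T \<subseteq> W \<longrightarrow> ccset T \<longrightarrow> 6 \<le> card T"
    and e: "E x y" "E y x'" "E x' y'" "E y' x" "x \<noteq> x'" "y \<noteq> y'"
    and W: "x \<in> W" "y \<in> W" "x' \<in> W" "y' \<in> W" "z \<in> W" and z: "E x z" "E y z"
  shows False
proof -
  have four: "card {p, q, r, t} \<le> 4" for p q r t :: 'a by (simp add: card_insert_if)
  have no: False if "ccset {p, q, r, t}" "{p, q, r, t} \<subseteq> W" for p q r t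
    using short[rule_format, OF that(2,1)] four[of p q r t] by simp
  have ne: "x \<noteq> y" "y \<noteq> x'" "x' \<noteq> y'" "y' \<noteq> x" "x \<noteq> z" "y \<noteq> z" using e z irrefl by auto
  consider "z = x'" | "z = y'" | "z \<noteq> x'" "z \<noteq> y'" by blast
  then show False
  proof cases
    case 1
    then have "ccset {y, x, x', y'}" using diamond[of x x' y y'] e z sym by auto
    then show False using no W by auto
  next
    case 2
    then have "ccset {x, y, y', x'}" using diamond[of y y' x x'] e z sym by auto
    then show False using no W by auto
  next
    case 3
    then have "fan x [y', x', y, z]" using e z ne sym by (auto simp: fan_def)
    from fan_ccset[OF this] have "6 \<le> card (insert x (set [y', x', y, z]))"
      using short[rule_format, of "insert x (set [y', x', y, z])"] W by simp
    moreover have "card (insert x (set [y', x', y, z])) \<le> Suc (card (set [y', x', y, z]))" by (simp add: card_insert_if)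
    moreover have "card (set [y', x', y, z]) \<le> 4" using card_length[of "[y', x', y, z]"] by simp
    ultimately show False by simp
  qed
qed

lemma square_neighbourhoods_disjoint:
  assumes short: "\<forall>T. T \<subseteq> W \<longrightarrow> ccset T \<longrightarrow> 6 \<le> card T"
    and e: "E x y" "E y x'" "E x' y'" "E y' x" "x \<noteq> x'" "y \<noteq> y'"
    and W: "x \<in> W" "y \<in> W" "x' \<in> W" "y' \<in> W" 
  shows "(nb x \<union> nb x') \<inter> (nb y \<union> nb y') \<inter> W = {}"
proof (rule ccontr)
  assume "\<not> ?thesis"
  then obtain z where "z \<in> (nb x \<union> nb x') \<inter> (nb y \<union> nb y') \<inter> W" by blast
  then have z: "z \<in> W" "E x z \<or> E x' z" "E y z \<or> E y' z" by auto
  have 1: "E x z \<Longrightarrow> E y z \<Longrightarrow> False" using square_common_neighbour[OF short, where x=x and y=y and x'=x' and y'=y' and z=z] e W z by blast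
  have 2: "E x z \<Longrightarrow> E y' z \<Longrightarrow> False" using square_common_neighbour[OF short, where x=x and y=y' and x'=x' and y'=y and z=z] e W z sym by blast
  have 3: "E x' z \<Longrightarrow> E y z \<Longrightarrow> False" using square_common_neighbour[OF short, where x=x' and y=y and x'=x and y'=y' and z=z] e W z sym by blast
  have 4: "E x' z \<Longrightarrow> E y' z \<Longrightarrow> False" using square_common_neighbour[OF short, where x=x' and y=y' and x'=x and y'=y and z=z] e W z sym by blast
  show False using z 1 2 3 4 by blast
qed

section \<open>Degree sums and extremal families\<close>

text \<open>Twice the number of edges induced on \<open>X\<close>.\<close>

definition degsum :: "'a set \<Rightarrow> nat" where
  "degsum X = (\<Sum>x\<in>X. card (nb x \<inter> X))"

lemma degsum_insert:
  assumes "finite X" "x \<notin> X"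
  shows "degsum (insert x X) = degsum X + 2 * card (nb x \<inter> X)"
proof -
  have "nb x \<inter> insert x X = nb x \<inter> X" using irrefl by auto
  moreover have "card (nb y \<inter> insert x X) = card (nb y \<inter> X) + of_bool (E x y)" if "y \<in> X" for y
  proof (cases "E x y")
    case True
    then have "nb y \<inter> insert x X = insert x (nb y \<inter> X)" using sym by auto
    then show ?thesis using assms True by simp
  next
    case False
    then have "nb y \<inter> insert x X = nb y \<inter> X" using sym by auto
    then show ?thesis using False by simp
  qed
  then have "(\<Sum>y\<in>X. card (nb y \<inter> insert x X)) = degsum X + (\<Sum>y\<in>X. of_bool (E x y))"
    by (simp add: degsum_def sum.distrib)
  moreover have "(\<Sum>y\<in>X. of_bool (E x y)) = card (nb x \<inter> X)"
  proof -
    have "(\<Sum>y\<in>X. of_bool (E x y)) = card {y \<in> X. E x y}" using assms(1)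
      by (simp add: of_bool_def sum.If_cases Int_def)
    also have "{y \<in> X. E x y} = nb x \<inter> X" by auto
    finally show ?thesis .
  qed
  ultimately show ?thesis using assms by (simp add: degsum_def)
qed

lemma degsum_le: "finite X \<Longrightarrow> degsum X \<le> card X * card X"
  unfolding degsum_def using sum_bounded_above[of X "\<lambda>x. card (nb x \<inter> X)" "card X"]
  by (auto intro: card_mono)

text \<open>Vertex-minimality bounds the neighbours of a swapped-out vertex on the other cycles. The
  tie-break by edges bounds its neighbours in the remainder, by the degree of the vertex that
  replaces it.\<close>

definition best_family :: "'a set \<Rightarrow> nat \<Rightarrow> 'a set set \<Rightarrow> bool" where
  "best_family W k \<F> \<longleftrightarrow> min_family W k \<F> \<and>
     (\<forall>\<G>. min_family W k \<G> \<longrightarrow> degsum (W - \<Union>\<G>) \<le> degsum (W - \<Union>\<F>))"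

lemma best_family_exists:
  assumes "finite W" "packing \<F> W" "card \<F> = k"
  shows "\<exists>\<G>. best_family W k \<G>"
proof -
  obtain \<G> where "min_family W k \<G>"
    using ex_has_least_nat[of "\<lambda>\<G>. packing \<G> W \<and> card \<G> = k" \<F> "\<lambda>\<G>. card (\<Union>\<G>)"] assms(2,3)
    unfolding min_family_def by blast
  moreover have "degsum (W - \<Union>\<H>) < Suc (card W * card W)" for \<H>
  proof -
    have "degsum (W - \<Union>\<H>) \<le> card (W - \<Union>\<H>) * card (W - \<Union>\<H>)" using assms(1) by (intro degsum_le) auto
    also have "\<dots> \<le> card W * card W" using assms(1) by (intro mult_le_mono card_mono) auto
    finally show ?thesis by simp
  qed
  ultimately show ?thesis
    using ex_has_greatest_nat[of "min_family W k" \<G> "\<lambda>\<G>. degsum (W - \<Union>\<G>)" "Suc (card W * card W)"]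
    unfolding best_family_def by blast
qed

text \<open>The exchange replaces \<open>v\<close> by \<open>b\<close> in the remainder, which must
  not gain edges.\<close>

lemma best_family_single_swap:
  assumes fin: "finite W" and F: "best_family W k \<F>" and C: "C \<in> \<F>" and S: "ccset S" "card S = card C"
    and H: "H = W - \<Union>\<F>" and v: "v \<in> H" and b: "b \<in> C" and Seq: "S = insert v (C - {b})"
  shows "card (nb b \<inter> (H - {v})) \<le> card (nb v \<inter> H)"
proof -
  have m: "min_family W k \<F>" using F by (simp add: best_family_def)
  have Ssub: "S \<subseteq> C \<union> (W - \<Union>\<F>)" using Seq v H by auto
  note x = min_family_exchange[OF fin m C S(1) Ssub S(2)]
  have bH: "b \<notin> H" using b C H by auto
  have e: "W - \<Union>(insert S (\<F> - {C})) = insert b (H - {v})"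
    unfolding x(3) using Seq v H b C by auto
  have "degsum (insert b (H - {v})) \<le> degsum H" using F x(1) e H unfolding best_family_def by metis
  moreover have fH: "finite (H - {v})" using fin H by simp
  moreover have "degsum H = degsum (H - {v}) + 2 * card (nb v \<inter> (H - {v}))"
    using degsum_insert[OF fH, of v] v by (simp add: insert_absorb)
  moreover have "degsum (insert b (H - {v})) = degsum (H - {v}) + 2 * card (nb b \<inter> (H - {v}))"
    using degsum_insert[OF fH, of b] bH by simp
  moreover have "nb v \<inter> (H - {v}) = nb v \<inter> H" using irrefl by auto
  ultimately show ?thesis by simp
qed

text \<open>The remainder loses at most the degrees of \<open>u\<close> and \<open>v\<close> and
  gains at least the edges at \<open>b\<close>. The \<open>+ 1\<close> is the edge between
  \<open>a\<close> and \<open>b\<close>, which become neighbours inside the new remainder; the final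
  count cannot spare it.\<close>

lemma best_family_double_swap:
  assumes fin: "finite W" and F: "best_family W k \<F>" and C: "C \<in> \<F>" and S: "ccset S" "card S = card C"
    and H: "H = W - \<Union>\<F>" and uv: "u \<in> H" "v \<in> H" "u \<noteq> v" "\<not> E u v" and ab: "a \<in> C" "b \<in> C" "E b a"
    and Seq: "S = {u, v} \<union> (C - {a, b})"
  shows "card (nb b \<inter> (H - {u, v})) + 1 \<le> card (nb u \<inter> H) + card (nb v \<inter> H)"
proof -
  have m: "min_family W k \<F>" using F by (simp add: best_family_def)
  have Ssub: "S \<subseteq> C \<union> (W - \<Union>\<F>)" using Seq uv H by auto
  note x = min_family_exchange[OF fin m C S(1) Ssub S(2)]
  let ?H = "H - {u, v}"
  have abH: "a \<notin> H" "b \<notin> H" "a \<noteq> b" using ab C H irrefl by auto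
  have e: "W - \<Union>(insert S (\<F> - {C})) = insert b (insert a ?H)"
    unfolding x(3) using Seq uv H ab C by auto
  have "degsum (insert b (insert a ?H)) \<le> degsum H" using F x(1) e H unfolding best_family_def by metis
  moreover have fH: "finite ?H" using fin H by simp
  moreover have "degsum H = degsum ?H + 2 * card (nb v \<inter> ?H) + 2 * card (nb u \<inter> H)"
  proof -
    have "insert u (insert v ?H) = H" using uv by auto
    moreover have "nb u \<inter> insert v ?H = nb u \<inter> H" using uv irrefl by auto
    ultimately show ?thesis
      using degsum_insert[OF fH, of v] degsum_insert[of "insert v ?H" u] fH uv by simp
  qed
  moreover have "degsum (insert b (insert a ?H)) = degsum ?H + 2 * card (nb a \<inter> ?H) + 2 * card (nb b \<inter> insert a ?H)"
    using degsum_insert[OF fH, of a] degsum_insert[of "insert a ?H" b] fH abH by simp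
  moreover have "card (nb b \<inter> insert a ?H) = card (nb b \<inter> ?H) + 1"
  proof -
    have "nb b \<inter> insert a ?H = insert a (nb b \<inter> ?H)" using ab by auto
    then show ?thesis using abH fH by simp
  qed
  moreover have "card (nb v \<inter> ?H) \<le> card (nb v \<inter> H)" using fin H by (intro card_mono) auto
  ultimately show ?thesis by linarith
qed

lemma card_Int_family:
  assumes fin: "finite W" and F: "packing \<F> W"
  shows "card (N \<inter> W) = card (N \<inter> (W - \<Union>\<F>)) + (\<Sum>C\<in>\<F>. card (N \<inter> C))"
proof -
  have fF: "finite \<F>" and sub: "\<And>T. T \<in> \<F> \<Longrightarrow> T \<subseteq> W" using F by (auto simp: packing_def)
  have fC: "finite (N \<inter> C)" if "C \<in> \<F>" for C using sub[OF that] fin finite_subset by blast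
  have "card (\<Union>C\<in>\<F>. N \<inter> C) = (\<Sum>C\<in>\<F>. card (N \<inter> C))"
  proof (rule card_UN_disjoint[OF fF])
    show "\<forall>C\<in>\<F>. finite (N \<inter> C)" using fC by auto
    show "\<forall>C\<in>\<F>. \<forall>D\<in>\<F>. C \<noteq> D \<longrightarrow> N \<inter> C \<inter> (N \<inter> D) = {}" using packing_disjoint[OF F] by blast
  qed
  moreover have "N \<inter> W = (N \<inter> (W - \<Union>\<F>)) \<union> (\<Union>C\<in>\<F>. N \<inter> C)" using sub by auto
  moreover have "(N \<inter> (W - \<Union>\<F>)) \<inter> (\<Union>C\<in>\<F>. N \<inter> C) = {}" by auto
  moreover have "finite (N \<inter> (W - \<Union>\<F>))" using fin by simp
  moreover have "finite (\<Union>C\<in>\<F>. N \<inter> C)" by (rule finite_UN_I[OF fF fC])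
  ultimately show ?thesis using card_Un_disjoint by metis
qed

section \<open>Excluding the hexagon pattern\<close>

text \<open>The reflection that fixes the long chord exchanges \<open>a1\<close> and
  \<open>a3\<close>. As \<open>v\<close> has two neighbours among the \<open>a\<close>s, it may thus
  be taken to be adjacent to \<open>a1\<close>.\<close>

lemma hexpat_mirror: "hexpat S u v b1 a1 b2 a2 b3 a3 \<Longrightarrow> hexpat S u v b1 a3 b3 a2 b2 a1"
  unfolding hexpat_def using sym by auto

lemma hexpat_outer_edges:
  assumes "hexpat S u v b1 a1 b2 a2 b3 a3"
  shows "E u b1" "E u b2" "E u b3" "\<not> E u a1" "\<not> E u a2" "\<not> E u a3" "\<not> E v b1" "\<not> E v b2" "\<not> E v b3"
    "(E v a1 \<and> E v a2) \<or> (E v a1 \<and> E v a3) \<or> (E v a2 \<and> E v a3)"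
proof -
  have S: "S = {b1, a1, b2, a2, b3, a3}" and d: "distinct [b1, a1, b2, a2, b3, a3]"
    and u: "nb u \<inter> S = {b1, b2, b3}" and v: "nb v \<inter> S \<subseteq> {a1, a2, a3}" "card (nb v \<inter> S) \<ge> 2"
    using assms by (auto simp: hexpat_def)
  have mem: "x \<in> nb u \<inter> S \<longleftrightarrow> E u x" "x \<in> nb v \<inter> S \<longleftrightarrow> E v x" if "x \<in> S" for x using that by auto
  have inS: "b1 \<in> S" "b2 \<in> S" "b3 \<in> S" "a1 \<in> S" "a2 \<in> S" "a3 \<in> S" using S by auto
  show "E u b1" "E u b2" "E u b3" using mem(1) inS u by blast+
  show "\<not> E u a1" "\<not> E u a2" "\<not> E u a3" using mem(1) inS u d by (metis distinct_length_2_or_more insertE empty_iff)+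
  show "\<not> E v b1" "\<not> E v b2" "\<not> E v b3" using mem(2) inS v(1) d by (metis distinct_length_2_or_more insertE empty_iff subsetD)+
  show "(E v a1 \<and> E v a2) \<or> (E v a1 \<and> E v a3) \<or> (E v a2 \<and> E v a3)"
  proof (rule ccontr)
    assume n: "\<not> ?thesis"
    then have "nb v \<inter> S \<subseteq> {a1} \<or> nb v \<inter> S \<subseteq> {a2} \<or> nb v \<inter> S \<subseteq> {a3}" using v(1) by auto
    then have "card (nb v \<inter> S) \<le> 1" using card_mono[of "{_}"] by fastforce
    then show False using v by simp
  qed
qed

text \<open>The pairs \<open>{u, a2}\<close> and \<open>{b2, b3}\<close> are opposite on a 4-cycle, so their
  neighbourhoods are disjoint; together they need \<open>8 * s\<close> neighbours, which is too many.\<close>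

lemma hexpat_count:
  assumes fin: "finite W" and c: "union_cond W (4 * s)" and s: "s \<ge> 2"
    and short: "\<forall>T. T \<subseteq> W \<longrightarrow> ccset T \<longrightarrow> 6 \<le> card T"
    and F: "min_family W (s - 1) \<F>" and C: "C \<in> \<F>" and H: "H = W - \<Union>\<F>"
    and h: "hexpat C u v b1 a1 b2 a2 b3 a3" and u: "u \<in> H"
    and few: "\<And>w D. w \<in> {u, a2, b2, b3} \<Longrightarrow> D \<in> \<F> - {C} \<Longrightarrow> card D \<ge> 7 \<Longrightarrow> card (nb w \<inter> D) \<le> 2"
    and le: "card ((nb u \<union> nb a2) \<inter> H) + card ((nb b2 \<union> nb b3) \<inter> H) \<le> 9"
  shows False
proof -
  have p: "packing \<F> W" "card \<F> = s - 1" using F by (auto simp: min_family_def)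
  have CW: "C \<subseteq> W" using p C by (auto simp: packing_def)
  have hx: "C = {b1, a1, b2, a2, b3, a3}" "distinct [b1, a1, b2, a2, b3, a3]" "E b2 a2" "E a2 b3"
    using h by (auto simp: hexpat_def)
  note uo = hexpat_outer_edges[OF h]
  have uC: "u \<notin> C" "u \<in> W" using u H C by auto
  have W: "a2 \<in> W" "b2 \<in> W" "b3 \<in> W" using CW hx by auto
  have ne: "u \<noteq> a2" "b2 \<noteq> b3" using uC hx by auto
  let ?X = "nb u \<union> nb a2" and ?Y = "nb b2 \<union> nb b3"
  have disj: "?X \<inter> ?Y \<inter> W = {}"
    using square_neighbourhoods_disjoint[OF short uo(2) hx(3,4) sym[OF uo(3)] ne uC(2) W(2,1,3)] .
  have "\<not> E u a2" by (rule uo(5))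
  then have X: "4 * s \<le> card (?X \<inter> W)" using union_condD[OF c uC(2) W(1) ne(1)] by simp
  have "\<not> E b2 b3"
  proof
    assume "E b2 b3"
    then have "b3 \<in> ?X \<inter> ?Y \<inter> W" using uo W by auto
    then show False using disj by blast
  qed
  then have Y: "4 * s \<le> card (?Y \<inter> W)" using union_condD[OF c W(2,3) ne(2)] by simp
  have fD: "finite D" "D \<subseteq> W" "ccset D" if "D \<in> \<F>" for D
    using p that fin by (auto simp: packing_def intro: finite_subset)
  have six: "card (?X \<inter> D) + card (?Y \<inter> D) \<le> card D" if "D \<in> \<F>" for D
  proof -
    have "card (?X \<inter> D) + card (?Y \<inter> D) = card ((?X \<inter> D) \<union> (?Y \<inter> D))"
      using fD[OF that] disj by (intro card_Un_disjoint[symmetric]) auto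
    also have "\<dots> \<le> card D" using fD[OF that] by (intro card_mono) auto
    finally show ?thesis .
  qed
  \<comment> \<open>On at most six vertices disjointness suffices; on a longer cycle each of the
    four vertices has at most two neighbours.\<close>
  have Db: "card (?X \<inter> D) + card (?Y \<inter> D) \<le> 8" if D: "D \<in> \<F> - {C}" for D
  proof (cases "card D \<ge> 7")
    case False
    then show ?thesis using six[of D] D by auto
  next
    case True
    have "card (?X \<inter> D) \<le> card (nb u \<inter> D) + card (nb a2 \<inter> D)"
      "card (?Y \<inter> D) \<le> card (nb b2 \<inter> D) + card (nb b3 \<inter> D)"
      unfolding Int_Un_distrib2 by (rule card_Un_le)+
    then show ?thesis using few[OF _ D True, of u] few[OF _ D True, of a2] few[OF _ D True, of b2] few[OF _ D True, of b3] by simp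
  qed
  have cC: "card C = 6" using hx by simp
  have fF: "finite \<F>" using p by (auto simp: packing_def)
  have "card (?X \<inter> W) + card (?Y \<inter> W) = card (?X \<inter> H) + card (?Y \<inter> H) + (\<Sum>D\<in>\<F>. card (?X \<inter> D) + card (?Y \<inter> D))"
    using card_Int_family[OF fin p(1), of ?X] card_Int_family[OF fin p(1), of ?Y] H by (simp add: sum.distrib)
  also have "(\<Sum>D\<in>\<F>. card (?X \<inter> D) + card (?Y \<inter> D)) = (card (?X \<inter> C) + card (?Y \<inter> C)) + (\<Sum>D\<in>\<F> - {C}. card (?X \<inter> D) + card (?Y \<inter> D))"
    by (rule sum.remove[OF fF C])
  also have "(\<Sum>D\<in>\<F> - {C}. card (?X \<inter> D) + card (?Y \<inter> D)) \<le> of_nat (card (\<F> - {C})) * 8"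
    by (rule sum_bounded_above[OF Db])
  \<comment> \<open>At most 9 in \<open>H\<close>, 6 on \<open>C\<close> and 8 on each of the
    \<open>s - 2\<close> other cycles give \<open>8 * s - 1\<close>, one less than required.\<close>
  finally have "card (?X \<inter> W) + card (?Y \<inter> W) \<le> 9 + (6 + (s - 2) * 8)"
    using le six[OF C] cC p(2) C fF by simp
  then show False using X Y s by linarith
qed

text \<open>Each vertex counted in \<open>hexpat_count\<close> is \<open>u\<close> itself or can be
  swapped out of \<open>C\<close>, which bounds its neighbours both on long cycles and in
  \<open>H\<close>. \<open>u\<close> replaces \<open>a2\<close>, and \<open>v\<close> replaces
  \<open>b2\<close>; \<open>v\<close> also replaces \<open>b3\<close> if it is adjacent to
  \<open>a3\<close>. Otherwise \<open>u\<close> and \<open>v\<close> together replace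
  \<open>a3\<close> and \<open>b3\<close>.\<close>

lemma no_hexpat:
  assumes fin: "finite W" and c: "union_cond W (4 * s)" and s: "s \<ge> 2"
    and short: "\<forall>T. T \<subseteq> W \<longrightarrow> ccset T \<longrightarrow> 6 \<le> card T"
    and F: "best_family W (s - 1) \<F>" and C: "C \<in> \<F>" and H: "H = W - \<Union>\<F>"
    and h: "hexpat C u v b1 a1 b2 a2 b3 a3"
    and uv: "u \<in> H" "v \<in> H" "u \<noteq> v" "\<not> E u v" "card (nb u \<inter> H) \<le> 2" "card (nb v \<inter> H) \<le> 2"
    and va: "E v a1" "E v a3 \<or> E v a2"
  shows False
proof -
  have m: "min_family W (s - 1) \<F>" using F by (simp add: best_family_def)
  have p: "packing \<F> W" using m by (auto simp: min_family_def)
  have hx: "C = {b1, a1, b2, a2, b3, a3}" "distinct [b1, a1, b2, a2, b3, a3]" 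
    "E b1 a1" "E a1 b2" "E b2 a2" "E a2 b3" "E b3 a3" "E a3 b1" "E b1 a2"
    using h by (auto simp: hexpat_def)
  note uo = hexpat_outer_edges[OF h]
  have uvC: "u \<notin> C" "v \<notin> C" using uv H C by auto
  have fH: "finite H" using fin H by simp
  have d: "distinct [b1, a1, b2, a2, b3, a3, u, v]" using hx uvC uv by auto
  have cC: "card C = 6" using hx by simp
  have sub: "S \<subseteq> C \<union> (W - \<Union>\<F>)" if "S \<subseteq> insert u (insert v C)" for S using that uv H by auto
  have Sa2: "ccset (insert u (C - {a2}))"
  proof -
    have "fan b1 [a1, b2, u, b3, a3]" unfolding fan_def using hx uo d sym by auto
    then show ?thesis using hx(1,2) uvC by (intro fan_ccset'[of b1 "[a1, b2, u, b3, a3]"]) auto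
  qed
  have Sb2: "ccset (insert v (C - {b2}))"
  proof (cases "E v a3")
    case True
    have "fan b1 [a1, v, a3, b3, a2]" unfolding fan_def using hx uo d sym va True by auto
    then show ?thesis using hx(1,2) uvC by (intro fan_ccset'[of b1 "[a1, v, a3, b3, a2]"]) auto
  next
    case False
    then have "fan b1 [a1, v, a2, b3, a3]" unfolding fan_def using hx uo d sym va by auto
    then show ?thesis using hx(1,2) uvC by (intro fan_ccset'[of b1 "[a1, v, a2, b3, a3]"]) auto
  qed
  have cS: "card (insert w (C - {x})) = card C" if "w \<in> {u, v}" "x \<in> C" for w x
  proof -
    have "w \<notin> C - {x}" "finite C" using that uvC hx by auto
    then show ?thesis using cC that by simp
  qed
  have few: "card (nb x \<inter> D) \<le> 2"
    if "w \<in> {u, v}" "x \<in> C" "ccset (insert w (C - {x}))" "D \<in> \<F> - {C}" "card D \<ge> 7" for w x D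
    using evicted_few_neighbours[OF fin m C that(3) sub cS[OF that(1,2)] _ that(4,5)] that(1,2) uvC by auto
  have fewu: "card (nb u \<inter> D) \<le> 2" if "D \<in> \<F> - {C}" "card D \<ge> 7" for D
  proof -
    have cD: "ccset D" "u \<notin> D" using p that uv(1) H by (auto simp: packing_def)
    show ?thesis using few_neighbours_long[OF cD(1) that(2) cD(2)] min_family_local[OF fin m] that(1) uv(1) H by blast
  qed
  have a2H: "card (nb a2 \<inter> H) \<le> 2"
  proof -
    have "card (nb a2 \<inter> (H - {u})) \<le> card (nb u \<inter> H)"
      by (rule best_family_single_swap[OF fin F C Sa2 cS H uv(1) _ refl]) (use hx in auto)
    moreover have "nb a2 \<inter> (H - {u}) = nb a2 \<inter> H" using uo sym by auto
    ultimately show ?thesis using uv by simp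
  qed
  have single: "card (nb x \<inter> H) \<le> 2" if "x \<in> C" "ccset (insert v (C - {x}))" "\<not> E v x" for x
  proof -
    have "card (nb x \<inter> (H - {v})) \<le> card (nb v \<inter> H)"
      by (rule best_family_single_swap[OF fin F C that(2) cS H uv(2) that(1) refl]) (use that in auto)
    moreover have "nb x \<inter> (H - {v}) = nb x \<inter> H" using that(3) sym by auto
    ultimately show ?thesis using uv by simp
  qed
  have inC: "a2 \<in> C" "b2 \<in> C" "b3 \<in> C" "a3 \<in> C" using hx by auto
  have b2H: "card (nb b2 \<inter> H) \<le> 2" using single[OF inC(2) Sb2] uo by blast
  have XH: "card ((nb u \<union> nb a2) \<inter> H) \<le> 4"
    using card_Un_le[of "nb u \<inter> H" "nb a2 \<inter> H"] uv(5) a2H by (simp add: Int_Un_distrib2)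
  show False
  proof (cases "E v a3")
    case True
    have Sb3: "ccset (insert v (C - {b3}))"
    proof -
      have "fan b1 [a3, v, a1, b2, a2]" unfolding fan_def using hx uo d sym va True by auto
      then show ?thesis using hx(1,2) uvC by (intro fan_ccset'[of b1 "[a3, v, a1, b2, a2]"]) auto
    qed
    have b3H: "card (nb b3 \<inter> H) \<le> 2" using single[OF inC(3) Sb3] uo by blast
    have YH: "card ((nb b2 \<union> nb b3) \<inter> H) \<le> 4"
      using card_Un_le[of "nb b2 \<inter> H" "nb b3 \<inter> H"] b2H b3H by (simp add: Int_Un_distrib2)
    show False
    proof (rule hexpat_count[OF fin c s short m C H h uv(1)])
      show "card (nb w \<inter> D) \<le> 2" if "w \<in> {u, a2, b2, b3}" "D \<in> \<F> - {C}" "card D \<ge> 7" for w D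
        using that(1) fewu[OF that(2,3)] few[OF _ inC(1) Sa2 that(2,3)] few[OF _ inC(2) Sb2 that(2,3)] few[OF _ inC(3) Sb3 that(2,3)] by auto
      show "card ((nb u \<union> nb a2) \<inter> H) + card ((nb b2 \<union> nb b3) \<inter> H) \<le> 9" using XH YH by simp
    qed
  next
    case False
    let ?S = "{u, v} \<union> (C - {a3, b3})"
    have S: "ccset ?S"
    proof -
      have "fan b2 [u, b1, a1, v, a2]" unfolding fan_def using hx uo d sym va False by auto
      then show ?thesis using hx(1,2) uvC by (intro fan_ccset'[of b2 "[u, b1, a1, v, a2]"]) auto
    qed
    have cS': "card ?S = card C"
    proof -
      have "?S = {u, v, b1, a1, b2, a2}" using hx(1,2) uvC by auto
      moreover have "card {u, v, b1, a1, b2, a2} = 6" using d by auto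
      ultimately show ?thesis using cC by simp
    qed
    have "card (nb b3 \<inter> (H - {u, v})) + 1 \<le> card (nb u \<inter> H) + card (nb v \<inter> H)"
      by (rule best_family_double_swap[OF fin F C S cS' H uv(1-4) inC(4,3) hx(7) refl])
    then have b3H: "card (nb b3 \<inter> (H - {u, v})) \<le> 3" using uv by linarith
    \<comment> \<open>\<open>b3\<close> may have three neighbours in \<open>H\<close> besides
      \<open>u\<close>, but \<open>u\<close> is already counted at \<open>b2\<close>, and
      \<open>v\<close> is not adjacent to \<open>b3\<close>. This gives 5, and with the 4 of the
      other pair exactly the 9 that \<open>hexpat_count\<close> allows.\<close>
    have "(nb b2 \<union> nb b3) \<inter> H \<subseteq> (nb b2 \<inter> H) \<union> (nb b3 \<inter> (H - {u, v}))"
      using uo sym by auto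
    then have "card ((nb b2 \<union> nb b3) \<inter> H) \<le> card ((nb b2 \<inter> H) \<union> (nb b3 \<inter> (H - {u, v})))"
      using fH by (intro card_mono) auto
    also have "\<dots> \<le> card (nb b2 \<inter> H) + card (nb b3 \<inter> (H - {u, v}))" by (rule card_Un_le)
    finally have YH: "card ((nb b2 \<union> nb b3) \<inter> H) \<le> 5" using b2H b3H by linarith
    have few3: "card (nb b3 \<inter> D) \<le> 2" if "D \<in> \<F> - {C}" "card D \<ge> 7" for D
      using evicted_few_neighbours[OF fin m C S sub cS' _ that] inC uvC by auto
    show False
    proof (rule hexpat_count[OF fin c s short m C H h uv(1)])
      show "card (nb w \<inter> D) \<le> 2" if "w \<in> {u, a2, b2, b3}" "D \<in> \<F> - {C}" "card D \<ge> 7" for w D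
        using that(1) fewu[OF that(2,3)] few[OF _ inC(1) Sa2 that(2,3)] few[OF _ inC(2) Sb2 that(2,3)] few3[OF that(2,3)] by auto
      show "card ((nb u \<union> nb a2) \<inter> H) + card ((nb b2 \<union> nb b3) \<inter> H) \<le> 9" using XH YH by simp
    qed
  qed
qed

lemma end_triangle_pairs:
  assumes fin: "finite H" and p: "end_triangle H p1 p2 p3" and q: "end_triangle H q1 q2 q3" and d: "{p1, p2, p3} \<inter> {q1, q2, q3} = {}"
    and ab: "a \<in> {p1, p2}" "b \<in> {q1, q2}"
  shows "a \<in> H" "b \<in> H" "a \<noteq> b" "\<not> E a b" "card ((nb a \<union> nb b) \<inter> H) \<le> 4"
proof -
  have P: "p1 \<in> H" "p2 \<in> H" "nb p1 \<inter> H = {p2, p3}" "nb p2 \<inter> H = {p1, p3}" using p by (auto simp: end_triangle_def)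
  have Q: "q1 \<in> H" "q2 \<in> H" "nb q1 \<inter> H = {q2, q3}" "nb q2 \<inter> H = {q1, q3}" using q by (auto simp: end_triangle_def)
  show "a \<in> H" "b \<in> H" "a \<noteq> b" using ab P Q d by auto
  have na: "nb a \<inter> H \<subseteq> {p1, p2, p3}" using ab(1) P by auto
  show "\<not> E a b"
  proof
    assume "E a b"
    then have "b \<in> nb a \<inter> H" using \<open>b \<in> H\<close> by simp
    then show False using na ab(2) d by blast
  qed
  have two: "card {x, y} \<le> 2" for x y :: 'a by (simp add: card_insert_if)
  have "card (nb a \<inter> H) \<le> 2" "card (nb b \<inter> H) \<le> 2" using ab P(3,4) Q(3,4) two by (metis insertE singletonD)+
  then show "card ((nb a \<union> nb b) \<inter> H) \<le> 4"
    using card_Un_le[of "nb a \<inter> H" "nb b \<inter> H"] by (simp add: Int_Un_distrib2)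
qed

text \<open>\<open>Z\<close> shows that some packing of size \<open>s - 1\<close> misses four
  vertices. A family with fewest vertices then misses at least four as well, enough for
  \<open>low_pair_or_end_triangles\<close>.\<close>

lemma no_short_case:
  assumes fin: "finite W" and c: "union_cond W (4 * s)" and s: "s \<ge> 2"
    and short: "\<forall>T. T \<subseteq> W \<longrightarrow> ccset T \<longrightarrow> 6 \<le> card T"
    and Z: "Z \<subseteq> W" "card Z = 4" "pack (s - 1) (W - Z)"
  shows "pack s W"
proof (rule ccontr)
  assume np: "\<not> pack s W"
  obtain \<F>0 where F0: "packing \<F>0 (W - Z)" "card \<F>0 = s - 1" using Z by (auto simp: pack_def)
  then have F0W: "packing \<F>0 W" by (auto simp: packing_def)
  obtain \<F> where F: "best_family W (s - 1) \<F>" using best_family_exists[OF fin F0W F0(2)] by auto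
  then have m: "min_family W (s - 1) \<F>" by (simp add: best_family_def)
  then have p: "packing \<F> W" "card \<F> = s - 1" by (auto simp: min_family_def)
  define H where "H = W - \<Union>\<F>"
  have UW: "\<Union>\<F> \<subseteq> W" and fF: "finite \<F>" using p by (auto simp: packing_def)
  have fH: "finite H" using fin H_def by simp
  have HF: "H \<inter> D = {}" if "D \<in> \<F>" for D using that H_def by auto
  have "card (\<Union>\<F>) \<le> card (\<Union>\<F>0)" using m F0W F0(2) by (auto simp: min_family_def)
  also have "\<dots> \<le> card (W - Z)" using F0 fin by (intro card_mono) (auto simp: packing_def)
  also have "\<dots> = card W - 4" using Z fin by (simp add: card_Diff_subset finite_subset)
  finally have "card (\<Union>\<F>) \<le> card W - 4" .
  moreover have "card H = card W - card (\<Union>\<F>)" unfolding H_def using UW fin by (simp add: card_Diff_subset finite_subset)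
  moreover have "4 \<le> card W" using Z fin card_mono by metis
  ultimately have H4: "card H \<ge> 4" by linarith
  have free: "ccfree H"
  proof (rule ccontr)
    assume "\<not> ccfree H"
    then have "pack 1 H" using pack_1_iff by blast
    moreover have "pack (s - 1) (\<Union>\<F>)" unfolding pack_def using p by (intro exI[of _ \<F>]) (auto simp: packing_def)
    ultimately have "pack (s - 1 + 1) (\<Union>\<F> \<union> H)" by (intro pack_Un) (auto simp: H_def)
    moreover have "\<Union>\<F> \<union> H = W" using UW H_def by auto
    ultimately show False using np s by simp
  qed
  have total: "card (N \<inter> W) = card (N \<inter> H) + (\<Sum>C\<in>\<F>. card (N \<inter> C))" for N
    unfolding H_def by (rule card_Int_family[OF fin p(1)])
  have local: "card D \<le> card T" if "D \<in> \<F>" "ccset T" "T \<subseteq> D \<union> H" for D T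
    using min_family_local[OF fin m that(1,2)] that(3) H_def by simp
  have cc: "ccset D" "card D \<ge> 6" if "D \<in> \<F>" for D using that p short by (auto simp: packing_def)
  show False
    using low_pair_or_end_triangles[OF fH free H4]
  proof
    assume "\<exists>u\<in>H. \<exists>v\<in>H. u \<noteq> v \<and> \<not> E u v \<and> card (nb u \<inter> H) \<le> 2 \<and> card (nb v \<inter> H) \<le> 2 \<and> card ((nb u \<union> nb v) \<inter> H) \<le> 3"
    then obtain u v where uv: "u \<in> H" "v \<in> H" "u \<noteq> v" "\<not> E u v" "card (nb u \<inter> H) \<le> 2" "card (nb v \<inter> H) \<le> 2"
      "card ((nb u \<union> nb v) \<inter> H) \<le> 3" by auto
    \<comment> \<open>Three neighbours in \<open>H\<close> and four on each cycle would make only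
      \<open>4 * s - 1\<close>.\<close>
    have "\<exists>C\<in>\<F>. card ((nb u \<union> nb v) \<inter> C) \<ge> 5"
    proof (rule ccontr)
      assume "\<not> ?thesis"
      then have "(\<Sum>C\<in>\<F>. card ((nb u \<union> nb v) \<inter> C)) \<le> of_nat (card \<F>) * 4" by (intro sum_bounded_above) force
      moreover have "u \<in> W" "v \<in> W" using uv(1,2) H_def by auto
      then have "4 * s \<le> card ((nb u \<union> nb v) \<inter> W)" using union_condD[OF c _ _ uv(3,4)] by blast
      ultimately show False using total[of "nb u \<union> nb v"] uv(7) p(2) s by simp
    qed
    then obtain C where C: "C \<in> \<F>" "card ((nb u \<union> nb v) \<inter> C) \<ge> 5" by auto
    have out: "u \<notin> C" "v \<notin> C" using HF[OF C(1)] uv by auto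
    have fin': False if h: "hexpat C x y b1 a1 b2 a2 b3 a3" and xy: "(x = u \<and> y = v) \<or> (x = v \<and> y = u)" for x y b1 a1 b2 a2 b3 a3
    proof -
      have xy': "x \<in> H" "y \<in> H" "x \<noteq> y" "\<not> E x y" "card (nb x \<inter> H) \<le> 2" "card (nb y \<inter> H) \<le> 2"
        using xy uv sym by blast+
      note N = no_hexpat[OF fin c s short F C(1) H_def]
      show False
        using hexpat_outer_edges(10)[OF h] N[OF h xy'] N[OF hexpat_mirror[OF h] xy'] by blast
    qed
    have "\<exists>b1 a1 b2 a2 b3 a3. hexpat C u v b1 a1 b2 a2 b3 a3 \<or> hexpat C v u b1 a1 b2 a2 b3 a3"
    proof (rule pair_union_or_hexpat[OF cc[OF C(1)] out _ _ C(2)])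
      show "card C \<le> card T" if "T \<subseteq> insert u C" "ccset T" for T using local[OF C(1) that(2)] that(1) uv(1) by blast
      show "card C \<le> card T" if "T \<subseteq> insert v C" "ccset T" for T using local[OF C(1) that(2)] that(1) uv(2) by blast
    qed
    then show False using fin' by blast
  next
    assume "\<exists>p1 p2 p3 q1 q2 q3. end_triangle H p1 p2 p3 \<and> end_triangle H q1 q2 q3 \<and> {p1, p2, p3} \<inter> {q1, q2, q3} = {}"
    then obtain p1 p2 p3 q1 q2 q3 where T: "end_triangle H p1 p2 p3" "end_triangle H q1 q2 q3" "{p1, p2, p3} \<inter> {q1, q2, q3} = {}" by auto
    define N where "N a b = nb a \<union> nb b" for a b
    have lower: "4 * s \<le> 4 + (\<Sum>C\<in>\<F>. card (N a b \<inter> C))" if "a \<in> {p1, p2}" "b \<in> {q1, q2}" for a b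
    proof -
      note e = end_triangle_pairs[OF fH T that]
      have "a \<in> W" "b \<in> W" using e(1,2) H_def by auto
      then have "4 * s \<le> card (N a b \<inter> W)" unfolding N_def using union_condD[OF c _ _ e(3,4)] by blast
      then show ?thesis using total[of "N a b"] e(5) by (simp add: N_def)
    qed
    have Hsub: "{p1, p2, p3} \<subseteq> H" "{q1, q2, q3} \<subseteq> H" using T by (auto simp: end_triangle_def)
    \<comment> \<open>Each of the four pairs has at most four neighbours in \<open>H\<close>, so
      together they need \<open>16 * (s - 1)\<close> on the cycles, where each cycle offers only
      15.\<close>
    have "(\<Sum>C\<in>\<F>. card (N p1 q1 \<inter> C) + card (N p1 q2 \<inter> C) + card (N p2 q1 \<inter> C) + card (N p2 q2 \<inter> C)) \<le> of_nat (card \<F>) * 15"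
    proof (rule sum_bounded_above)
      fix C assume C: "C \<in> \<F>"
      have t: "triangle_off C p1 p2 p3" "triangle_off C q1 q2 q3"
        using T HF[OF C] Hsub by (auto simp: end_triangle_def triangle_off_def)
      have "card C \<ge> 5" using cc[OF C] by simp
      then show "card (N p1 q1 \<inter> C) + card (N p1 q2 \<inter> C) + card (N p2 q1 \<inter> C) + card (N p2 q2 \<inter> C) \<le> 15"
        unfolding N_def
      proof (rule two_triangles_bound[OF cc(1)[OF C] _ t])
        show "card C \<le> card T" if "T \<subseteq> {p1, p2, p3} \<union> {q1, q2, q3} \<union> C" "ccset T" for T
          using local[OF C that(2)] that(1) Hsub by blast
      qed
    qed
    then have "(\<Sum>C\<in>\<F>. card (N p1 q1 \<inter> C)) + (\<Sum>C\<in>\<F>. card (N p1 q2 \<inter> C)) + (\<Sum>C\<in>\<F>. card (N p2 q1 \<inter> C)) + (\<Sum>C\<in>\<F>. card (N p2 q2 \<inter> C)) \<le> (s - 1) * 15"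
      using p(2) by (simp add: sum.distrib)
    then show False using lower[of p1 q1] lower[of p1 q2] lower[of p2 q1] lower[of p2 q2] s by simp
  qed
qed

section \<open>The induction\<close>

text \<open>A chord of a 5-cycle joins vertices two steps apart and so cuts off a triangle.\<close>

lemma five_triangle:
  assumes "ccset S" "card S = 5"
  obtains a b c where "{a, b, c} \<subseteq> S" "E a b" "E b c" "E c a"
proof -
  obtain C where C: "chorded_cycle S E C" "set C = S" using assms by (auto simp: ccset_def)
  have cyc: "is_cycle S E C" using C by (simp add: chorded_cycle_def)
  note cl = cycle_list[OF cyc]
  have L: "length C = 5" using cl(3) C assms distinct_card by metis
  then obtain c0 c1 c2 c3 c4 where cs: "C = [c0, c1, c2, c3, c4]"
    by (auto simp: length_Suc_conv numeral_eq_Suc)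
  have e: "E c0 c1" "E c1 c2" "E c2 c3" "E c3 c4" "E c4 c0" using cl(1,2) cs by auto
  obtain p q where pq: "E p q" "p \<in> S" "q \<in> S" "{p, q} \<notin> cycle_edges C"
    using C by (auto simp: chorded_cycle_def is_chord_def)
  have ce: "cycle_edges C = {{c0, c1}, {c1, c2}, {c2, c3}, {c3, c4}, {c4, c0}}"
  proof -
    have "{..<5::nat} = {0, 1, 2, 3, 4}" by auto
    moreover have "cycle_edges C = (\<lambda>i. {C ! i, C ! ((i + 1) mod 5)}) ` {..<5}"
      unfolding cycle_edges_def using L by auto
    ultimately show ?thesis by (simp add: cs)
  qed
  have S: "S = {c0, c1, c2, c3, c4}" using C cs by auto
  have "E c2 c0 \<or> E c3 c1 \<or> E c4 c2 \<or> E c0 c3 \<or> E c1 c4"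
  proof (rule ccontr)
    assume n: "\<not> ?thesis"
    then have n': "\<not> E c0 c2" "\<not> E c1 c3" "\<not> E c2 c4" "\<not> E c3 c0" "\<not> E c4 c1" using sym by blast+
    show False using pq(2,3) unfolding S insert_iff empty_iff
      by (elim disjE) (use pq(1,4) ce n n' irrefl in \<open>simp_all add: doubleton_eq_iff\<close>)
  qed
  then show ?thesis
    using that[OF _ e(1,2)] that[OF _ e(2,3)] that[OF _ e(3,4)] that[OF _ e(4,5)] that[OF _ e(5,1)]
    unfolding S by (elim disjE) simp_all
qed

text \<open>Only five vertices need an argument. An outside vertex has at most one neighbour on the
  triangle, since two would give a diamond smaller than \<open>C\<close>. With the two vertices off
  the triangle the bound is \<open>1 + 1 + 2\<close>.\<close>

lemma short_cycle_loss:
  assumes C: "ccset C" "C \<subseteq> W" "card C \<le> 5" and mn: "\<forall>T. T \<subseteq> W \<longrightarrow> ccset T \<longrightarrow> card C \<le> card T"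
    and xy: "x \<in> W - C" "y \<in> W - C"
  shows "card ((nb x \<union> nb y) \<inter> C) \<le> 4"
proof (cases "card C = 5")
  case False
  have "card ((nb x \<union> nb y) \<inter> C) \<le> card C" using ccset_finite[OF C(1)] by (intro card_mono) auto
  then show ?thesis using False C(3) by linarith
next
  case True
  have fC: "finite C" using ccset_finite[OF C(1)] .
  obtain a b c where abc: "{a, b, c} \<subseteq> C" "E a b" "E b c" "E c a" using five_triangle[OF C(1) True] by metis
  have four: "card {p, q, r, t} \<le> 4" for p q r t :: 'a by (simp add: card_insert_if)
  have no: False if "ccset {p, q, r, t}" "{p, q, r, t} \<subseteq> W" for p q r t
    using mn[rule_format, OF that(2,1)] four[of p q r t] True by simp
  have abcW: "a \<in> W" "b \<in> W" "c \<in> W" using abc C by auto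
  have one: "card (nb w \<inter> {a, b, c}) \<le> 1" if w: "w \<in> W - C" for w
  proof -
    have wn: "w \<noteq> a" "w \<noteq> b" "w \<noteq> c" "w \<in> W" using w abc by auto
    have "\<not> (E w a \<and> E w b)" using diamond[of a b w c] no[of w a b c] abc wn abcW sym by auto
    moreover have "\<not> (E w b \<and> E w c)" using diamond[of b c w a] no[of w b c a] abc wn abcW sym by auto
    moreover have "\<not> (E w c \<and> E w a)" using diamond[of c a w b] no[of w c a b] abc wn abcW sym by auto
    ultimately have "nb w \<inter> {a, b, c} \<subseteq> {a} \<or> nb w \<inter> {a, b, c} \<subseteq> {b} \<or> nb w \<inter> {a, b, c} \<subseteq> {c}" by auto
    then show ?thesis using card_mono[of "{_}"] by fastforce
  qed
  have "a \<noteq> b" "b \<noteq> c" "c \<noteq> a" using abc(2-4) irrefl by metis+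
  then have t: "card {a, b, c} = 3" by simp
  have "(nb x \<union> nb y) \<inter> C \<subseteq> (nb x \<inter> {a, b, c}) \<union> ((nb y \<inter> {a, b, c}) \<union> (C - {a, b, c}))" by auto
  then have "card ((nb x \<union> nb y) \<inter> C) \<le> card ((nb x \<inter> {a, b, c}) \<union> ((nb y \<inter> {a, b, c}) \<union> (C - {a, b, c})))"
    using fC by (intro card_mono) auto
  also have "\<dots> \<le> card (nb x \<inter> {a, b, c}) + card ((nb y \<inter> {a, b, c}) \<union> (C - {a, b, c}))" by (rule card_Un_le)
  also have "card ((nb y \<inter> {a, b, c}) \<union> (C - {a, b, c})) \<le> card (nb y \<inter> {a, b, c}) + card (C - {a, b, c})" by (rule card_Un_le)
  also have "card (C - {a, b, c}) = 2" using abc(1) t True by (subst card_Diff_subset) auto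
  finally show ?thesis using one[OF xy(1)] one[OF xy(2)] by linarith
qed

lemma least_ccset:
  assumes "ccset T" "T \<subseteq> W"
  obtains C where "ccset C" "C \<subseteq> W" "\<forall>T. T \<subseteq> W \<longrightarrow> ccset T \<longrightarrow> card C \<le> card T"
  using ex_has_least_nat[of "\<lambda>T. ccset T \<and> T \<subseteq> W" T card] assms by blast

text \<open>Deleting \<open>p3\<close> separates \<open>p1\<close> and \<open>p2\<close> from
  \<open>y\<close>.\<close>

lemma end_triangle_cut:
  assumes t: "end_triangle W p1 p2 p3" and y: "y \<in> W - {p1, p2, p3}"
  shows "\<not> two_connected W E"
proof
  assume "two_connected W E"
  moreover have p: "p1 \<in> W" "p2 \<in> W" "p3 \<in> W" "p1 \<noteq> p3" "p2 \<noteq> p3" "nb p1 \<inter> W = {p2, p3}" "nb p2 \<inter> W = {p1, p3}"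
    using t irrefl by (auto simp: end_triangle_def)
  ultimately have "connected_on (W - {p3}) E" by (simp add: two_connected_def)
  moreover have "W - {p3} = {p1, p2} \<union> (W - {p1, p2, p3})" using p by auto
  moreover have "W - {p1, p2, p3} \<noteq> {}" using y by auto
  ultimately obtain a b where ab: "a \<in> {p1, p2}" "b \<in> W - {p1, p2, p3}" "a = b \<or> E a b"
    using connected_on_no_split[of "W - {p3}" "{p1, p2}" "W - {p1, p2, p3}"] by blast
  then have "b \<in> nb a \<inter> W" by auto
  then have "b \<in> {p1, p2, p3}" using ab(1) p(6,7) by blast
  then show False using ab(2) by blast
qed

section \<open>Two disjoint chorded cycles\<close>

lemma end_triangle_ccset:
  assumes "end_triangle H p1 p2 p3" "E c p1" "E c p2" "c \<notin> H"
  shows "ccset {c, p1, p2, p3}"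
  using assms diamond[of p1 p2 c p3] sym by (auto simp: end_triangle_def)

lemma pack_two:
  assumes "ccset S" "ccset T" "S \<inter> T = {}" "S \<subseteq> W" "T \<subseteq> W"
  shows "pack 2 W"
proof -
  have "pack (1 + 1) (S \<union> T)" by (intro pack_Un pack_1 assms)
  then have "pack 2 (S \<union> T)" by (simp add: numeral_2_eq_2)
  then show ?thesis using pack_mono assms(4,5) by blast
qed

text \<open>If \<open>H\<close> were more than the two triangles, it would have a low vertex
  \<open>r\<close> off both. Together with \<open>q1\<close>, and also with \<open>q2\<close>,
  \<open>r\<close> dominates \<open>C\<close>; as no vertex of \<open>C\<close> is adjacent to both,
  \<open>r\<close> is adjacent to all of \<open>C\<close>. Then \<open>r\<close> with three
  consecutive vertices of \<open>C\<close>, and the fourth with \<open>p1\<close>,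
  \<open>p2\<close>, \<open>p3\<close>, are two chorded cycles. So \<open>card W\<close> is 10, and
  \<open>extremal_case\<close> decides.\<close>

lemma base_half:
  assumes fin: "finite W" and c: "union_cond W 8" and np: "\<not> pack 2 W" 
    and C: "C \<subseteq> W" "ccset C" "card C = 4" and H: "H = W - C" "ccfree H"
    and p: "end_triangle H p1 p2 p3" and q: "end_triangle H q1 q2 q3" and d: "{p1, p2, p3} \<inter> {q1, q2, q3} = {}"
    and A: "\<And>c. c \<in> C \<Longrightarrow> E c p1 \<and> E c p2" and B: "\<And>c. c \<in> C \<Longrightarrow> \<not> (E c q1 \<and> E c q2)"
  shows "card W = 10 \<and> \<not> two_connected W E"
proof -
  have P: "p1 \<in> H" "p2 \<in> H" "p3 \<in> H" "nb p1 \<inter> H = {p2, p3}" "nb p2 \<inter> H = {p1, p3}" "p1 \<noteq> p2" "p2 \<noteq> p3" "p3 \<noteq> p1"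
    using p irrefl by (auto simp: end_triangle_def)
  have Q: "q1 \<in> H" "q2 \<in> H" "q3 \<in> H" "nb q1 \<inter> H = {q2, q3}" "nb q2 \<inter> H = {q1, q3}" "q1 \<noteq> q2" "q2 \<noteq> q3" "q3 \<noteq> q1"
    using q irrefl by (auto simp: end_triangle_def)
  have fH: "finite H" and fC: "finite C" using fin H C finite_subset by auto
  have HC: "H \<inter> C = {}" using H by auto
  define M where "M = H - {p1, p2, q1, q2}"
  have dist: "distinct [p1, p2, p3, q1, q2, q3]" using P(6-8) Q(6-8) d by auto
  have cH: "card H = card M + 4"
  proof -
    have "card {p1, p2, q1, q2} = 4" using dist by auto
    moreover have "card M = card H - card {p1, p2, q1, q2}" unfolding M_def using P Q by (intro card_Diff_subset) auto
    moreover have "card {p1, p2, q1, q2} \<le> card H" using P Q fH by (intro card_mono) auto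
    ultimately show ?thesis by linarith
  qed
  have "card M \<le> 2"
  proof (rule ccontr)
    assume "\<not> card M \<le> 2"
    then have "card {x \<in> M. card (nb x \<inter> M) \<le> 2} \<ge> 3"
      using three_low[of M] ccfree_mono[OF H(2), of M] fH M_def by auto
    moreover have "card {p3, q3} \<le> 2" by (simp add: card_insert_if)
    ultimately have "\<not> {x \<in> M. card (nb x \<inter> M) \<le> 2} \<subseteq> {p3, q3}"
      using card_mono[of "{p3, q3}" "{x \<in> M. card (nb x \<inter> M) \<le> 2}"] by fastforce
    then obtain r where r: "r \<in> M" "card (nb r \<inter> M) \<le> 2" "r \<noteq> p3" "r \<noteq> q3" by blast
    have rH: "r \<in> H" "r \<noteq> p1" "r \<noteq> p2" "r \<noteq> q1" "r \<noteq> q2" using r M_def by auto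
    have "r \<notin> nb p1 \<inter> H" "r \<notin> nb p2 \<inter> H" "r \<notin> nb q1 \<inter> H" "r \<notin> nb q2 \<inter> H"
      unfolding P(4,5) Q(4,5) using rH r by auto
    then have nr: "\<not> E p1 r" "\<not> E p2 r" "\<not> E q1 r" "\<not> E q2 r" using rH by auto
    have "nb r \<inter> H = nb r \<inter> M" unfolding M_def using nr sym by auto
    then have r2: "card (nb r \<inter> H) \<le> 2" using r by simp
    have two: "card {x, y} \<le> 2" for x y :: 'a by (simp add: card_insert_if)
    have dom: "C \<subseteq> nb r \<union> nb w" if w: "w \<in> {q1, q2}" for w
    proof -
      have wH: "w \<in> H" "w \<noteq> r" "\<not> E r w" "card (nb w \<inter> H) \<le> 2"
        using w Q(1,2) rH nr sym two Q(4,5) by auto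
      \<comment> \<open>At most four of these neighbours lie in \<open>H\<close>, so the others are
        all four vertices of \<open>C\<close>.\<close>
      have "8 \<le> card ((nb r \<union> nb w) \<inter> W)" using union_condD[OF c, of r w] rH wH H by auto
      also have "(nb r \<union> nb w) \<inter> W = ((nb r \<inter> H) \<union> (nb w \<inter> H)) \<union> ((nb r \<union> nb w) \<inter> C)" using H C by auto
      also have "card \<dots> \<le> card ((nb r \<inter> H) \<union> (nb w \<inter> H)) + card ((nb r \<union> nb w) \<inter> C)" by (rule card_Un_le)
      also have "card ((nb r \<inter> H) \<union> (nb w \<inter> H)) \<le> card (nb r \<inter> H) + card (nb w \<inter> H)" by (rule card_Un_le)
      finally have "card C \<le> card ((nb r \<union> nb w) \<inter> C)" using r2 wH C by linarith
      then have "(nb r \<union> nb w) \<inter> C = C" using fC by (intro card_seteq) auto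
      then show ?thesis by auto
    qed
    have rC: "E r c" if "c \<in> C" for c
      using dom[of q1] dom[of q2] B[OF that] that sym by auto
    obtain L where L: "chorded_cycle C E L" "set L = C" using C by (auto simp: ccset_def)
    then have cyc: "is_cycle C E L" by (simp add: chorded_cycle_def)
    note cl = cycle_list[OF cyc]
    have "length L = 4" using cl(3) L C distinct_card by metis
    then obtain c0 c1 c2 c3 where cs: "L = [c0, c1, c2, c3]" by (auto simp: length_Suc_conv numeral_eq_Suc)
    have C': "C = {c0, c1, c2, c3}" "distinct [c0, c1, c2, c3]" "E c0 c1" "E c1 c2" using L cl cs by auto
    have rnC: "r \<notin> C" using rH HC by auto
    have "fan r [c0, c1, c2]" unfolding fan_def using C' rC rnC by auto
    then have 1: "ccset {r, c0, c1, c2}" by (rule fan_ccset') auto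
    have 2: "ccset {c3, p1, p2, p3}" using end_triangle_ccset[OF p, of c3] A[of c3] C' HC by auto
    have 3: "{r, c0, c1, c2} \<inter> {c3, p1, p2, p3} = {}" using C' rnC rH r P(1-3) HC by auto
    have 4: "{r, c0, c1, c2} \<subseteq> W" "{c3, p1, p2, p3} \<subseteq> W" using C' C rH P(1-3) H by auto
    show False using pack_two[OF 1 2 3 4] np by simp
  qed
  moreover have "card {p3, q3} \<le> card M" using dist P Q fH M_def by (intro card_mono) auto
  moreover have "card {p3, q3} = 2" using dist by auto
  ultimately have "card H = 6" using cH by simp
  moreover have "card H = card W - 4" unfolding H(1) using C fC by (simp add: card_Diff_subset)
  ultimately have W: "card W = 10" by simp
  have "\<not> two_connected (W - C) E" using end_triangle_cut[OF p, of q1] Q(1) d H by auto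
  then have "pack 2 W \<or> \<not> two_connected W E" using extremal_case[OF fin _ _ _ C, of 2] c W by simp
  then show ?thesis using W np by blast
qed

text \<open>Each of the four pairs of free vertices dominates \<open>C\<close>, so every vertex of
  \<open>C\<close> is adjacent to both free vertices of one of the triangles. One vertex from
  \<open>A\<close> and two further ones from \<open>B\<close>, or conversely, would give two
  disjoint diamonds. As \<open>C\<close> has four vertices, \<open>A\<close> or \<open>B\<close>
  must be empty.\<close>

lemma base_case_short:
  assumes fin: "finite W" and c: "union_cond W 8" and np: "\<not> pack 2 W" 
    and C: "C \<subseteq> W" "ccset C" "card C = 4" and H: "H = W - C" "ccfree H"
    and p: "end_triangle H p1 p2 p3" and q: "end_triangle H q1 q2 q3" and d: "{p1, p2, p3} \<inter> {q1, q2, q3} = {}"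
  shows "card W = 10 \<and> \<not> two_connected W E"
proof -
  have fH: "finite H" and fC: "finite C" using fin H C finite_subset by auto
  have P: "{p1, p2, p3} \<subseteq> H" and Q: "{q1, q2, q3} \<subseteq> H" using p q by (auto simp: end_triangle_def)
  have HC: "H \<inter> C = {}" "H \<subseteq> W" using H by auto
  define A where "A = {c \<in> C. E c p1 \<and> E c p2}"
  define B where "B = {c \<in> C. E c q1 \<and> E c q2}"
  have dom: "C \<subseteq> nb a \<union> nb b" if "a \<in> {p1, p2}" "b \<in> {q1, q2}" for a b
  proof -
    note e = end_triangle_pairs[OF fH p q d that]
    have "8 \<le> card ((nb a \<union> nb b) \<inter> W)" using union_condD[OF c _ _ e(3,4)] e(1,2) HC by blast
    also have "(nb a \<union> nb b) \<inter> W = ((nb a \<union> nb b) \<inter> H) \<union> ((nb a \<union> nb b) \<inter> C)" using H C by auto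
    also have "card \<dots> \<le> card ((nb a \<union> nb b) \<inter> H) + card ((nb a \<union> nb b) \<inter> C)" by (rule card_Un_le)
    finally have "card C \<le> card ((nb a \<union> nb b) \<inter> C)" using e(5) C by linarith
    then have "(nb a \<union> nb b) \<inter> C = C" using fC by (intro card_seteq) auto
    then show ?thesis by auto
  qed
  have AB: "C = A \<union> B"
  proof
    show "C \<subseteq> A \<union> B"
    proof
      fix z assume z: "z \<in> C"
      have "z \<in> nb p1 \<union> nb q1" "z \<in> nb p1 \<union> nb q2" "z \<in> nb p2 \<union> nb q1" "z \<in> nb p2 \<union> nb q2"
        using dom z by blast+
      then have "(E p1 z \<and> E p2 z) \<or> (E q1 z \<and> E q2 z)" by auto
      then show "z \<in> A \<union> B" using z sym unfolding A_def B_def by auto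
    qed
  qed (auto simp: A_def B_def)
  have mix: False if t: "end_triangle H x1 x2 x3" "end_triangle H y1 y2 y3" "{x1, x2, x3} \<inter> {y1, y2, y3} = {}"
    "a \<in> C" "E a x1" "E a x2" "b \<in> C" "E b y1" "E b y2" "b' \<in> C" "E b' y1" "E b' y2" "a \<noteq> b" "a \<noteq> b'" "b \<noteq> b'"
    for x1 x2 x3 y1 y2 y3 a b b'
  proof -
    have X: "{x1, x2, x3} \<subseteq> H" "{y1, y2, y3} \<subseteq> H" "E y1 y2" using t by (auto simp: end_triangle_def)
    have 1: "ccset {a, x1, x2, x3}" using end_triangle_ccset[OF t(1,5,6)] t(4) HC by auto
    have 2: "ccset {b, y1, y2, b'}" using diamond[of y1 y2 b b'] t X by auto
    have 3: "{a, x1, x2, x3} \<inter> {b, y1, y2, b'} = {}" using t X HC by auto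
    have 4: "{a, x1, x2, x3} \<subseteq> W" "{b, y1, y2, b'} \<subseteq> W" using t X HC C by auto
    show False using pack_two[OF 1 2 3 4] np by simp
  qed
  have le1: "card Z \<le> 1" if "finite Z" "\<And>x y. x \<in> Z \<Longrightarrow> y \<in> Z \<Longrightarrow> x = y" for Z :: "'a set"
    using that by (metis One_nat_def card_le_Suc0_iff_eq)
  have fAB: "finite A" "finite B" using fC A_def B_def by auto
  have d': "{q1, q2, q3} \<inter> {p1, p2, p3} = {}" using d by auto
  have B1: "card (B - {a}) \<le> 1" if a: "a \<in> A" for a
  proof (rule le1)
    show "finite (B - {a})" using fAB by simp
    show "x = y" if "x \<in> B - {a}" "y \<in> B - {a}" for x y
      using mix[OF p q d, of a x y] a that unfolding A_def B_def by blast
  qed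
  have A1: "card (A - {b}) \<le> 1" if b: "b \<in> B" for b
  proof (rule le1)
    show "finite (A - {b})" using fAB by simp
    show "x = y" if "x \<in> A - {b}" "y \<in> A - {b}" for x y
      using mix[OF q p d', of b x y] b that unfolding A_def B_def by blast
  qed
  have "A = {} \<or> B = {}"
  proof (rule ccontr)
    assume "\<not> ?thesis"
    then obtain a b where ab: "a \<in> A" "b \<in> B" by auto
    have "card A \<le> card (A - {b}) + 1" "card B \<le> card (B - {a}) + 1"
      using diff_card_le_card_Diff[of "{b}" A] diff_card_le_card_Diff[of "{a}" B] by simp_all
    then have le: "card A \<le> 2" "card B \<le> 2" using A1[OF ab(2)] B1[OF ab(1)] by linarith+
    have "card A + card B = card C + card (A \<inter> B)" using card_Un_Int[OF fAB] AB by simp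
    then have "card B = 2" "card (A \<inter> B) = 0" using le C by linarith+
    then have "B - {a} = B" using ab fAB by auto
    then show False using B1[OF ab(1)] \<open>card B = 2\<close> by simp
  qed
  then show ?thesis
  proof
    assume "A = {}"
    then show ?thesis using AB A_def B_def
      by (intro base_half[OF fin c np C H q p d']) blast+
  next
    assume "B = {}"
    then show ?thesis using AB A_def B_def
      by (intro base_half[OF fin c np C H p q d]) blast+
  qed
qed

lemma not_clique_large:
  assumes "finite W" "union_cond W (4 * s)" "4 * s \<le> card W" "\<not> pack s W"
  shows "4 * s + 2 \<le> card W"
proof -
  have "s \<le> card W div 4" using assms(3) by linarith
  then have "\<not> clique W" using pack_clique_le[of W s] assms by auto
  then show ?thesis using union_cond_nonadjacent_card[OF assms(1,2)] by (auto simp: clique_def)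
qed

lemma base_case:
  assumes fin: "finite W" and c: "union_cond W 8" and n: "8 \<le> card W"
  shows "pack 2 W \<or> (card W = 10 \<and> \<not> two_connected W E)"
proof (rule disjCI, rule ccontr)
  assume A: "\<not> (card W = 10 \<and> \<not> two_connected W E)" and np: "\<not> pack 2 W"
  have W10: "10 \<le> card W" using not_clique_large[of W 2] fin c n np by simp
  have tri: "\<exists>p1 p2 p3 q1 q2 q3. end_triangle H p1 p2 p3 \<and> end_triangle H q1 q2 q3 \<and> {p1, p2, p3} \<inter> {q1, q2, q3} = {}"
    if H: "finite H" "ccfree H" "card H \<ge> 4" "union_cond H 4" for H
    using low_pair_or_end_triangles[OF H(1-3)] union_condD[OF H(4)] by fastforce
  show False
  proof (cases "\<exists>T. T \<subseteq> W \<and> ccset T \<and> card T \<le> 5")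
    case True
    then obtain T where T: "ccset T" "T \<subseteq> W" "card T \<le> 5" by auto
    obtain C where C: "ccset C" "C \<subseteq> W" "\<forall>T. T \<subseteq> W \<longrightarrow> ccset T \<longrightarrow> card C \<le> card T"
      using least_ccset[OF T(1,2)] by metis
    have C5: "card C \<le> 5" using C(3)[rule_format, OF T(2,1)] T(3) by linarith
    have fC: "finite C" using ccset_finite C(1) by auto
    define H where "H = W - C"
    have cH: "union_cond H 4" using union_cond_Diff[OF fin fC c, of 4] short_cycle_loss[OF C(1,2) C5 C(3)] H_def by simp
    have fH: "finite H" using fin H_def by simp
    have "card H = card W - card C" using H_def C fC by (simp add: card_Diff_subset)
    then have H4: "card H \<ge> 4" using W10 C5 by simp
    have free: "ccfree H"
    proof (rule ccontr)
      assume "\<not> ccfree H"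
      then have "pack 1 (W - C)" using pack_1_iff H_def by blast
      from pack_Suc[OF C(1,2) this] show False using np by (simp add: numeral_2_eq_2)
    qed
    obtain p1 p2 p3 q1 q2 q3 where T: "end_triangle H p1 p2 p3" "end_triangle H q1 q2 q3" "{p1, p2, p3} \<inter> {q1, q2, q3} = {}"
      using tri[OF fH free H4 cH] by auto
    have lower: "4 \<le> card ((nb a \<union> nb b) \<inter> C)" if "a \<in> {p1, p2}" "b \<in> {q1, q2}" for a b
    proof -
      note e = end_triangle_pairs[OF fH T that]
      have "8 \<le> card ((nb a \<union> nb b) \<inter> W)" using union_condD[OF c _ _ e(3,4)] e(1,2) H_def by blast
      also have "(nb a \<union> nb b) \<inter> W = ((nb a \<union> nb b) \<inter> H) \<union> ((nb a \<union> nb b) \<inter> C)" using H_def C by auto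
      also have "card \<dots> \<le> card ((nb a \<union> nb b) \<inter> H) + card ((nb a \<union> nb b) \<inter> C)" by (rule card_Un_le)
      finally show ?thesis using e(5) by linarith
    qed
    have Hsub: "{p1, p2, p3} \<subseteq> H" "{q1, q2, q3} \<subseteq> H" using T by (auto simp: end_triangle_def)
    \<comment> \<open>The four pairs need 16 neighbours on \<open>C\<close> in total, and a shortest
      chorded cycle on five or more vertices offers at most 15.\<close>
    have "card C = 4"
    proof (rule ccontr)
      assume "card C \<noteq> 4"
      then have c5: "card C \<ge> 5" using ccset_card_ge4[OF C(1)] by simp
      have t: "triangle_off C p1 p2 p3" "triangle_off C q1 q2 q3"
        using T H_def by (auto simp: end_triangle_def triangle_off_def)
      have mn: "card C \<le> card T" if "T \<subseteq> {p1, p2, p3} \<union> {q1, q2, q3} \<union> C" "ccset T" for T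
      proof -
        have "H \<subseteq> W" using H_def by simp
        then have "{p1, p2, p3} \<union> {q1, q2, q3} \<union> C \<subseteq> W"
          using Hsub C(2) by (intro Un_least) (rule subset_trans; assumption)+
        then have "T \<subseteq> W" using that(1) by (rule subset_trans[rotated])
        then show ?thesis using C(3) that(2) by blast
      qed
      have "card ((nb p1 \<union> nb q1) \<inter> C) + card ((nb p1 \<union> nb q2) \<inter> C)
        + card ((nb p2 \<union> nb q1) \<inter> C) + card ((nb p2 \<union> nb q2) \<inter> C) \<le> 15"
        by (rule two_triangles_bound[OF C(1) c5 t mn])
      then show False using lower[of p1 q1] lower[of p1 q2] lower[of p2 q1] lower[of p2 q2] by simp
    qed
    then show False using base_case_short[OF fin c np C(2,1) _ H_def free T] A by blast
  next
    case False
    then have short: "\<forall>T. T \<subseteq> W \<longrightarrow> ccset T \<longrightarrow> 6 \<le> card T" by force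
    obtain Z where Z: "Z \<subseteq> W" "card Z = 4" using obtain_subset_with_card_n[of 4 W] W10 by auto
    have fZ: "finite Z" using Z fin finite_subset by auto
    \<comment> \<open>Any four vertices serve as \<open>Z\<close>. Without a chorded cycle outside,
      there would be two end triangles, and a vertex of \<open>Z\<close> would form a diamond with
      one of them, which is too short.\<close>
    have "pack 1 (W - Z)"
    proof (rule ccontr)
      assume "\<not> pack 1 (W - Z)"
      then have free: "ccfree (W - Z)" using pack_1_iff by blast
      have cH: "union_cond (W - Z) 4" using union_cond_Diff_card[OF fin fZ c] Z by simp
      have fH: "finite (W - Z)" using fin by simp
      have "card (W - Z) \<ge> 4" using Z fZ W10 by (simp add: card_Diff_subset)
      then obtain p1 p2 p3 q1 q2 q3 where T: "end_triangle (W - Z) p1 p2 p3" "end_triangle (W - Z) q1 q2 q3" "{p1, p2, p3} \<inter> {q1, q2, q3} = {}"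
        using tri[OF fH free _ cH] by auto
      have dom: "Z \<subseteq> nb a \<union> nb b" if "a \<in> {p1, p2}" "b \<in> {q1, q2}" for a b
      proof -
        note e = end_triangle_pairs[OF fH T that]
        have "8 \<le> card ((nb a \<union> nb b) \<inter> W)" using union_condD[OF c _ _ e(3,4)] e(1,2) by blast
        also have "(nb a \<union> nb b) \<inter> W = ((nb a \<union> nb b) \<inter> (W - Z)) \<union> ((nb a \<union> nb b) \<inter> Z)" using Z by auto
        also have "card \<dots> \<le> card ((nb a \<union> nb b) \<inter> (W - Z)) + card ((nb a \<union> nb b) \<inter> Z)" by (rule card_Un_le)
        finally have "card Z \<le> card ((nb a \<union> nb b) \<inter> Z)" using e(5) Z by linarith
        then have "(nb a \<union> nb b) \<inter> Z = Z" using fZ by (intro card_seteq) auto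
        then show ?thesis by auto
      qed
      obtain z where z: "z \<in> Z" using Z by fastforce
      have "z \<in> nb p1 \<union> nb q1" "z \<in> nb p1 \<union> nb q2" "z \<in> nb p2 \<union> nb q1" "z \<in> nb p2 \<union> nb q2"
        using dom z by blast+
      then have "(E p1 z \<and> E p2 z) \<or> (E q1 z \<and> E q2 z)" by auto
      then have "(E z p1 \<and> E z p2) \<or> (E z q1 \<and> E z q2)" using sym by blast
      then obtain x1 x2 x3 where x: "end_triangle (W - Z) x1 x2 x3" "E z x1" "E z x2" using T by blast
      have "ccset {z, x1, x2, x3}" using end_triangle_ccset[OF x] z by auto
      moreover have "{z, x1, x2, x3} \<subseteq> W" using x(1) z Z by (auto simp: end_triangle_def)
      moreover have "card {z, x1, x2, x3} \<le> 4" by (simp add: card_insert_if)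
      ultimately show False using short[rule_format, of "{z, x1, x2, x3}"] by linarith
    qed
    then show False using no_short_case[OF fin _ _ short Z, of 2] c np by simp
  qed
qed

section \<open>The induction step and the theorem\<close>

text \<open>One of the two cliques has at least four vertices. Hence no exception remains when all
  chorded cycles are longer, and if one remains after deleting a shortest cycle \<open>C\<close>,
  then \<open>C\<close> has four vertices, as \<open>extremal_case\<close> requires.\<close>

lemma exceptional_four:
  assumes fin: "finite W" and c: "union_cond W (4 * t)" "card W = 4 * t + 2" and two: "\<not> two_connected W E" and t: "t \<ge> 2"
  obtains T where "T \<subseteq> W" "ccset T" "card T = 4"
proof -
  have "card W \<ge> 4" using c t by simp
  then obtain X Y where XY: "W = X \<union> Y" "X \<inter> Y = {}" "clique X" "clique Y"
    using not_two_connected_cliques[OF fin c two] by metis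
  have f: "finite X" "finite Y" using XY fin by auto
  then have "card X + card Y = card W" using XY by (simp add: card_Un_disjoint)
  then consider "card X \<ge> 4" | "card Y \<ge> 4" using c t by linarith
  then show ?thesis
  proof cases
    case 1 then show ?thesis using clique_four_subset[OF XY(3) f(1)] that XY(1) by (metis sup.coboundedI1)
  next
    case 2 then show ?thesis using clique_four_subset[OF XY(4) f(2)] that XY(1) by (metis sup.coboundedI2)
  qed
qed

lemma pack_or_exceptional:
  assumes "2 \<le> s"
  shows "finite W \<Longrightarrow> union_cond W (4 * s) \<Longrightarrow> 4 * s \<le> card W \<Longrightarrow> pack s W \<or> (card W = 4 * s + 2 \<and> \<not> two_connected W E)"
  using assms
proof (induction s arbitrary: W rule: dec_induct)
  case base
  then show ?case using base_case by simp
next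
  case (step t)
  note fin = step.prems(1) and c = step.prems(2) and n = step.prems(3) and t = step.hyps(1)
  show ?case
  proof (rule disjCI, rule ccontr)
    assume A: "\<not> (card W = 4 * Suc t + 2 \<and> \<not> two_connected W E)" and np: "\<not> pack (Suc t) W"
    \<comment> \<open>With fewer vertices the graph is a clique, which packs \<open>Suc t\<close> at
      once. The two spare vertices allow a cycle on five vertices to be deleted.\<close>
    have W: "4 * t + 6 \<le> card W" using not_clique_large[OF fin c n np] by simp
    show False
    proof (cases "\<exists>T. T \<subseteq> W \<and> ccset T \<and> card T \<le> 5")
      case True
      then obtain T where T: "ccset T" "T \<subseteq> W" "card T \<le> 5" by auto
      obtain C where C: "ccset C" "C \<subseteq> W" "\<forall>T. T \<subseteq> W \<longrightarrow> ccset T \<longrightarrow> card C \<le> card T"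
        using least_ccset[OF T(1,2)] by metis
      have C5: "card C \<le> 5" using C(3)[rule_format, OF T(2,1)] T(3) by linarith
      have fC: "finite C" using ccset_finite C(1) by auto
      have cH: "union_cond (W - C) (4 * t)"
        using union_cond_Diff[OF fin fC c, of 4] short_cycle_loss[OF C(1,2) C5 C(3)] by simp
      have H: "card (W - C) = card W - card C" using C fC by (simp add: card_Diff_subset)
      have "\<not> pack t (W - C)" using pack_Suc[OF C(1,2)] np by blast
      then have ex: "card (W - C) = 4 * t + 2" "\<not> two_connected (W - C) E"
        using step.IH[of "W - C"] fin cH H W C5 by auto
      obtain T where T: "T \<subseteq> W - C" "ccset T" "card T = 4"
        using exceptional_four[OF _ cH ex t] fin by auto
      then have "card C \<le> 4" using C(3)[rule_format, of T] by auto
      then have C4: "card C = 4" using ccset_card_ge4[OF C(1)] by simp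
      then have W': "card W = 4 * Suc t + 2" using ex(1) H W by simp
      have "pack (Suc t) W \<or> \<not> two_connected W E"
        using extremal_case[OF fin _ c W' C(2,1) C4 ex(2)] t by simp
      then show False using np A W' by blast
    next
      case False
      then have short: "\<forall>T. T \<subseteq> W \<longrightarrow> ccset T \<longrightarrow> 6 \<le> card T" by force
      \<comment> \<open>A chorded cycle may now cost a pair more than four neighbours, so four
        arbitrary vertices are deleted instead; \<open>no_short_case\<close> asks only for
        \<open>t\<close> cycles outside them.\<close>
      obtain Z where Z: "Z \<subseteq> W" "card Z = 4" using obtain_subset_with_card_n[of 4 W] W by auto
      have fZ: "finite Z" using Z fin finite_subset by auto
      have cH: "union_cond (W - Z) (4 * t)" using union_cond_Diff_card[OF fin fZ c] Z by simp
      have "4 * t \<le> card (W - Z)" using Z fZ W by (simp add: card_Diff_subset)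
      then have "pack t (W - Z) \<or> (card (W - Z) = 4 * t + 2 \<and> \<not> two_connected (W - Z) E)"
        using step.IH[of "W - Z"] fin cH by auto
      moreover have "\<not> (card (W - Z) = 4 * t + 2 \<and> \<not> two_connected (W - Z) E)"
      proof
        assume "card (W - Z) = 4 * t + 2 \<and> \<not> two_connected (W - Z) E"
        then obtain T where T: "T \<subseteq> W - Z" "ccset T" "card T = 4"
          using exceptional_four[OF _ cH _ _ t] fin by auto
        then show False using short[rule_format, of T] by auto
      qed
      ultimately have "pack (Suc t - 1) (W - Z)" by auto
      then have "pack (Suc t) W" using no_short_case[OF fin c _ short Z] t by simp
      then show False using np by simp
    qed
  qed
qed

text \<open>For \<open>s = 1\<close> the 2-connectivity acts directly: a graph without chorded
  cycles would have an end triangle, and with it a cut vertex.\<close>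

lemma pack_two_connected:
  assumes s: "1 \<le> s" and fin: "finite W" and c: "union_cond W (4 * s)" "4 * s \<le> card W" and two: "two_connected W E"
  shows "pack s W"
proof (cases "s = 1")
  case False
  then show ?thesis using pack_or_exceptional[of s W] assms by auto
next
  case True
  have "pack 1 W"
  proof (rule ccontr)
    assume "\<not> pack 1 W"
    then have free: "ccfree W" using pack_1_iff by blast
    have "card W \<ge> 4" "union_cond W 4" using c True by auto
    moreover have "\<not> (\<exists>u\<in>W. \<exists>v\<in>W. u \<noteq> v \<and> \<not> E u v \<and> card (nb u \<inter> W) \<le> 2 \<and> card (nb v \<inter> W) \<le> 2 \<and> card ((nb u \<union> nb v) \<inter> W) \<le> 3)"
      using union_condD[OF \<open>union_cond W 4\<close>] by fastforce
    ultimately obtain p1 p2 p3 q1 q2 q3 where T: "end_triangle W p1 p2 p3" "end_triangle W q1 q2 q3" "{p1, p2, p3} \<inter> {q1, q2, q3} = {}"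
      using low_pair_or_end_triangles[OF fin free] by auto
    then have "q1 \<in> W - {p1, p2, p3}" by (auto simp: end_triangle_def)
    then show False using end_triangle_cut[OF T(1)] two by blast
  qed
  then show ?thesis using True by simp
qed

lemma pack_cycle_list:
  assumes "pack s V"
  shows "\<exists>Cs :: 'a list list. length Cs = s \<and> (\<forall>i < s. chorded_cycle V E (Cs ! i)) \<and>
    (\<forall>i < s. \<forall>j < s. i \<noteq> j \<longrightarrow> set (Cs ! i) \<inter> set (Cs ! j) = {})"
proof -
  obtain \<F> where F: "packing \<F> V" "card \<F> = s" using assms by (auto simp: pack_def)
  then have "finite \<F>" by (simp add: packing_def)
  then obtain Ss where Ss: "set Ss = \<F>" "distinct Ss" using finite_distinct_list by blast
  then have L: "length Ss = s" using F(2) distinct_card by fastforce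
  have "\<exists>C. chorded_cycle V E C \<and> set C = S" if "S \<in> \<F>" for S
  proof -
    have S: "ccset S" "S \<subseteq> V" using that F by (auto simp: packing_def)
    then obtain C where "chorded_cycle S E C" "set C = S" by (auto simp: ccset_def)
    then show ?thesis using is_cycle_mono[OF _ S(2)] by (auto simp: chorded_cycle_def)
  qed
  then obtain f where f: "\<And>S. S \<in> \<F> \<Longrightarrow> chorded_cycle V E (f S) \<and> set (f S) = S" by metis
  show ?thesis
  proof (intro exI[of _ "map f Ss"] conjI allI impI)
    show "length (map f Ss) = s" using L by simp
    fix i assume i: "i < s"
    have iF: "Ss ! i \<in> \<F>" using i L Ss(1) by auto
    show "chorded_cycle V E (map f Ss ! i)" using f[OF iF] i L by simp
    fix j assume j: "j < s" "i \<noteq> j"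
    have jF: "Ss ! j \<in> \<F>" using j L Ss(1) by auto
    have "Ss ! i \<noteq> Ss ! j" using i j L Ss(2) by (simp add: nth_eq_iff_index_eq)
    then show "set (map f Ss ! i) \<inter> set (map f Ss ! j) = {}"
      using packing_disjoint[OF F(1) iF jF] f[OF iF] f[OF jF] i j L by simp
  qed
qed

end

theorem theorem1p3:
  fixes V :: "'a set" and E :: "'a \<Rightarrow> 'a \<Rightarrow> bool" and s :: nat
  assumes "s \<ge> 1"
    and "simple_graph V E"
    and "two_connected V E"
    and "card V \<ge> 4 * s"
    and "delta2 V E \<ge> 4 * s \<or> complete_graph V E"
  shows "\<exists>Cs :: 'a list list. length Cs = s \<and>
           (\<forall>i < s. chorded_cycle V E (Cs ! i)) \<and>
           (\<forall>i < s. \<forall>j < s. i \<noteq> j \<longrightarrow> set (Cs ! i) \<inter> set (Cs ! j) = {})"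
proof -
  interpret sgraph E using assms(2) by unfold_locales (auto simp: simple_graph_def)
  have fin: "finite V" using assms(2) by (simp add: simple_graph_def)
  have "union_cond V (4 * s)"
    unfolding union_cond_def
  proof (intro ballI impI)
    fix x y assume xy: "x \<in> V" "y \<in> V" "x \<noteq> y" "\<not> E x y"
    then have "\<not> complete_graph V E" by (auto simp: complete_graph_def)
    then have "4 * s \<le> delta2 V E" using assms(5) by blast
    also have "\<dots> \<le> card (nbhd_set V E {x, y})"
      unfolding delta2_def
    \<comment> \<open>The pair \<open>{x, y}\<close> contributes a value, so the \<open>Inf\<close>
      is a genuine minimum here and not the default 0.\<close>
    proof (rule cInf_lower)
      have "independent_set V E {x, y}" "card {x, y} = 2"
        using xy sym irrefl by (auto simp: independent_set_def)
      then show "card (nbhd_set V E {x, y}) \<in> {card (nbhd_set V E S) |S. independent_set V E S \<and> card S = 2}" by blast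
    qed simp
    also have "nbhd_set V E {x, y} = (nb x \<union> nb y) \<inter> V" by (auto simp: nbhd_set_def)
    finally show "4 * s \<le> card ((nb x \<union> nb y) \<inter> V)" .
  qed
  then show ?thesis using pack_cycle_list pack_two_connected[OF assms(1) fin _ assms(4,3)] by blast
qed

end
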